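(* Let $A$ be an artinian local ring with infinite residue field, $S$ a finitely generated standard $\mathbb N^d$-graded algebra over $A$ and $M$ a finitely generated $\mathbb N^d$-graded $S$-module such that $S_{\mathbf 1}\not\subseteq\sqrt{\mathrm{Ann}_SM}$. Let $\mathbf k=(k_1,\dots,k_d)\in\mathbb N^d$ with $|\mathbf k|=\dim\mathrm{Supp}_{++}M$. Assume that $\mathbf x$ is an $S_{++}$-filter-regular sequence with respect to $M$ consisting of $k_1$ elements of $S_1,\dots,k_d$ elements of $S_d$. Then $e(M;\mathbf k)=\ell_A\big((M/\mathbf xM)_{\mathbf n}\big)$ for all large $\mathbf n$, and $e(M;\mathbf k)\neq0$ if and only if $\dim\mathrm{Supp}_{++}(M/\mathbf xM)=0$.
   Context: Notation: $\mathbf e_i$ unit vectors, $\mathbf 1=(1,\dots,1)$, $|\mathbf k|=\sum k_i$, $\mathbf k!=\prod k_i!$, $\mathbf n^{\mathbf k}=\prod n_i^{k_i}$; "large $\mathbf n$": $\mathbf n\ge\mathbf v$ componentwise for some $\mathbf v$. $S$ standard: $S_{\mathbf 0}=A$, generated by $S_i:=S_{\mathbf e_i}$; $S_{\mathbf 1}=S_{(1,\dots,1)}$, $S_{++}=\bigoplus_{\mathbf n\ge\mathbf 1}S_{\mathbf n}$; $\mathrm{Supp}_{++}M$ = homogeneous primes not containing $S_{++}$ at which $M$ localizes nonzero (dimension $-\infty$ if empty). With $s=\dim\mathrm{Supp}_{++}M$, $\ell_A(M_{\mathbf n})$ agrees for large $\mathbf n$ with a polynomial $P_M$ of degree $s$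 whose degree-$s$ part is $\sum_{|\mathbf k|=s}e(M;\mathbf k)\mathbf n^{\mathbf k}/\mathbf k!$ (mixed multiplicities). A homogeneous $a\in S$ is $S_{++}$-filter-regular with respect to $M$ if $(0_M:a)_{\mathbf n}=0$ for all large $\mathbf n$; homogeneous $x_1,\dots,x_t$ form an $S_{++}$-filter-regular sequence w.r.t. $M$ if each $x_i$ is $S_{++}$-filter-regular w.r.t. $M/(x_1,\dots,x_{i-1})M$. *)

theory Defs
  imports "HOL-Analysis.Analysis" "HOL-Library.Function_Algebras"
begin

(* Multidegrees are functions 'd \<Rightarrow> nat for a finite index type 'd (d = CARD('d)).
   The standard graded algebra S is the whole commutative ring 'a, with grading Sg.
   The module M is the whole abelian group 'm, with scalar action sm and grading Mg. *)

definition unitv :: "'d \<Rightarrow> ('d \<Rightarrow> nat)" where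
  "unitv i = (\<lambda>j. if j = i then 1 else 0)"

definition ones :: "'d \<Rightarrow> nat" where
  "ones = (\<lambda>_. 1)"

definition add_subgroup :: "'b::ab_group_add set \<Rightarrow> bool" where
  "add_subgroup X \<longleftrightarrow> 0 \<in> X \<and> (\<forall>x\<in>X. \<forall>y\<in>X. x + y \<in> X) \<and> (\<forall>x\<in>X. - x \<in> X)"

definition is_decomp :: "(('d \<Rightarrow> nat) \<Rightarrow> 'b::ab_group_add set) \<Rightarrow> (('d \<Rightarrow> nat) \<Rightarrow> 'b) \<Rightarrow> 'b \<Rightarrow> bool" where
  "is_decomp G c x \<longleftrightarrow> finite {n. c n \<noteq> 0} \<and> (\<forall>n. c n \<in> G n) \<and> x = (\<Sum>n\<in>{n. c n \<noteq> 0}. c n)"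

definition comp :: "(('d \<Rightarrow> nat) \<Rightarrow> 'b::ab_group_add set) \<Rightarrow> 'b \<Rightarrow> ('d \<Rightarrow> nat) \<Rightarrow> 'b" where
  "comp G x = (THE c. is_decomp G c x)"

definition direct_sum_grading :: "(('d \<Rightarrow> nat) \<Rightarrow> 'b::ab_group_add set) \<Rightarrow> bool" where
  "direct_sum_grading G \<longleftrightarrow> (\<forall>n. add_subgroup (G n)) \<and> (\<forall>x. \<exists>!c. is_decomp G c x)"

definition ring_gen :: "'a::comm_ring_1 set \<Rightarrow> 'a set" where
  "ring_gen X = \<Inter>{R. X \<subseteq> R \<and> 0 \<in> R \<and> 1 \<in> R \<and> (\<forall>x\<in>R. \<forall>y\<in>R. x + y \<in> R \<and> x * y \<in> R \<and> - x \<in> R)}"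

definition graded_ring :: "(('d \<Rightarrow> nat) \<Rightarrow> 'a::comm_ring_1 set) \<Rightarrow> bool" where
  "graded_ring Sg \<longleftrightarrow> direct_sum_grading Sg \<and> 1 \<in> Sg 0 \<and>
     (\<forall>n m. \<forall>x\<in>Sg n. \<forall>y\<in>Sg m. x * y \<in> Sg (n + m))"

definition standard_graded :: "(('d \<Rightarrow> nat) \<Rightarrow> 'a::comm_ring_1 set) \<Rightarrow> bool" where
  "standard_graded Sg \<longleftrightarrow> graded_ring Sg \<and> ring_gen (Sg 0 \<union> (\<Union>i. Sg (unitv i))) = UNIV"

definition fg_algebra :: "(('d \<Rightarrow> nat) \<Rightarrow> 'a::comm_ring_1 set) \<Rightarrow> bool" where
  "fg_algebra Sg \<longleftrightarrow> (\<exists>G. finite G \<and> ring_gen (Sg 0 \<union> G) = UNIV)"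

definition is_module :: "('a::comm_ring_1 \<Rightarrow> 'm::ab_group_add \<Rightarrow> 'm) \<Rightarrow> bool" where
  "is_module sm \<longleftrightarrow> (\<forall>m. sm 1 m = m) \<and> (\<forall>a b m. sm (a * b) m = sm a (sm b m)) \<and>
     (\<forall>a b m. sm (a + b) m = sm a m + sm b m) \<and> (\<forall>a m m'. sm a (m + m') = sm a m + sm a m')"

definition graded_module :: "(('d \<Rightarrow> nat) \<Rightarrow> 'a::comm_ring_1 set) \<Rightarrow> ('a \<Rightarrow> 'm::ab_group_add \<Rightarrow> 'm)
     \<Rightarrow> (('d \<Rightarrow> nat) \<Rightarrow> 'm set) \<Rightarrow> bool" where
  "graded_module Sg sm Mg \<longleftrightarrow> is_module sm \<and> direct_sum_grading Mg \<and>
     (\<forall>n m. \<forall>a\<in>Sg n. \<forall>x\<in>Mg m. sm a x \<in> Mg (n + m))"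

definition fg_module :: "('a::comm_ring_1 \<Rightarrow> 'm::ab_group_add \<Rightarrow> 'm) \<Rightarrow> bool" where
  "fg_module sm \<longleftrightarrow> (\<exists>G. finite G \<and> (\<forall>x. \<exists>c. x = (\<Sum>g\<in>G. sm (c g) g)))"

definition ideal_in :: "'a::comm_ring_1 set \<Rightarrow> 'a set \<Rightarrow> bool" where
  "ideal_in A I \<longleftrightarrow> I \<subseteq> A \<and> add_subgroup I \<and> (\<forall>a\<in>A. \<forall>x\<in>I. a * x \<in> I)"

definition maximal_ideal_in :: "'a::comm_ring_1 set \<Rightarrow> 'a set \<Rightarrow> bool" where
  "maximal_ideal_in A I \<longleftrightarrow> ideal_in A I \<and> I \<noteq> A \<and>
     (\<forall>J. ideal_in A J \<and> I \<subseteq> J \<longrightarrow> J = I \<or> J = A)"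

definition artinian_in :: "'a::comm_ring_1 set \<Rightarrow> bool" where
  "artinian_in A \<longleftrightarrow> (\<forall>I::nat \<Rightarrow> 'a set. (\<forall>j. ideal_in A (I j)) \<and> (\<forall>j. I (Suc j) \<subseteq> I j)
       \<longrightarrow> (\<exists>N. \<forall>j\<ge>N. I j = I N))"

definition artinian_local_inf_residue :: "'a::comm_ring_1 set \<Rightarrow> bool" where
  "artinian_local_inf_residue A \<longleftrightarrow> artinian_in A \<and>
     (\<exists>m. maximal_ideal_in A m \<and> (\<forall>m'. maximal_ideal_in A m' \<longrightarrow> m' = m) \<and>
          infinite ((\<lambda>a. {b\<in>A. a - b \<in> m}) ` A))"

definition ann :: "('a::comm_ring_1 \<Rightarrow> 'm::ab_group_add \<Rightarrow> 'm) \<Rightarrow> 'a set" where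
  "ann sm = {s. \<forall>x. sm s x = 0}"

definition radical :: "'a::comm_ring_1 set \<Rightarrow> 'a set" where
  "radical I = {s. \<exists>N::nat. s ^ N \<in> I}"

definition ideal :: "'a::comm_ring_1 set \<Rightarrow> bool" where
  "ideal I \<longleftrightarrow> add_subgroup I \<and> (\<forall>a. \<forall>x\<in>I. a * x \<in> I)"

definition prime_ideal :: "'a::comm_ring_1 set \<Rightarrow> bool" where
  "prime_ideal P \<longleftrightarrow> ideal P \<and> P \<noteq> UNIV \<and> (\<forall>a b. a * b \<in> P \<longrightarrow> a \<in> P \<or> b \<in> P)"

definition homogeneous_ideal :: "(('d \<Rightarrow> nat) \<Rightarrow> 'a::comm_ring_1 set) \<Rightarrow> 'a set \<Rightarrow> bool" where
  "homogeneous_ideal Sg P \<longleftrightarrow> ideal P \<and> (\<forall>x\<in>P. \<forall>n. comp Sg x n \<in> P)"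

definition Spp :: "(('d \<Rightarrow> nat) \<Rightarrow> 'a::comm_ring_1 set) \<Rightarrow> 'a set" where
  "Spp Sg = {x. \<forall>n. comp Sg x n \<noteq> 0 \<longrightarrow> ones \<le> n}"

(* Supp_{++}(M/N) for a submodule N of M: (M/N)_P \<noteq> 0 iff some class m+N has
   no s \<notin> P with s m \<in> N *)
definition Supp_pp :: "(('d \<Rightarrow> nat) \<Rightarrow> 'a::comm_ring_1 set) \<Rightarrow> ('a \<Rightarrow> 'm::ab_group_add \<Rightarrow> 'm)
     \<Rightarrow> 'm set \<Rightarrow> 'a set set" where
  "Supp_pp Sg sm N = {P. prime_ideal P \<and> homogeneous_ideal Sg P \<and> \<not> Spp Sg \<subseteq> P \<and>
       (\<exists>x. \<forall>s. s \<notin> P \<longrightarrow> sm s x \<notin> N)}"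

(* dimension of a set of primes: supremum of lengths of strict chains; -\<infinity> if empty *)
definition dim_set :: "'a set set \<Rightarrow> ereal" where
  "dim_set X = Sup {ereal (real k) | k. \<exists>C::nat \<Rightarrow> 'a set.
       (\<forall>i\<le>k. C i \<in> X) \<and> (\<forall>i<k. C i \<subset> C (Suc i))}"

definition A_submodule :: "(('d \<Rightarrow> nat) \<Rightarrow> 'a::comm_ring_1 set) \<Rightarrow> ('a \<Rightarrow> 'm::ab_group_add \<Rightarrow> 'm)
     \<Rightarrow> 'm set \<Rightarrow> bool" where
  "A_submodule Sg sm L \<longleftrightarrow> add_subgroup L \<and> (\<forall>a\<in>Sg 0. \<forall>x\<in>L. sm a x \<in> L)"

(* \<ell>_A((M/N)_n) = \<ell>_A(M_n / (N \<inter> M_n)), as the supremum of lengths of strict chains of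
   A-submodules between N \<inter> M_n and M_n *)
definition qlen :: "(('d \<Rightarrow> nat) \<Rightarrow> 'a::comm_ring_1 set) \<Rightarrow> ('a \<Rightarrow> 'm::ab_group_add \<Rightarrow> 'm)
     \<Rightarrow> (('d \<Rightarrow> nat) \<Rightarrow> 'm set) \<Rightarrow> 'm set \<Rightarrow> ('d \<Rightarrow> nat) \<Rightarrow> enat" where
  "qlen Sg sm Mg N n = Sup {enat k | k. \<exists>L::nat \<Rightarrow> 'm set.
       (\<forall>i\<le>k. A_submodule Sg sm (L i) \<and> N \<inter> Mg n \<subseteq> L i \<and> L i \<subseteq> Mg n) \<and>
       (\<forall>i<k. L i \<subset> L (Suc i))}"

definition hilbert_poly_coeffs :: "(('d::finite \<Rightarrow> nat) \<Rightarrow> 'a::comm_ring_1 set) \<Rightarrow> ('a \<Rightarrow> 'm::ab_group_add \<Rightarrow> 'm)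
     \<Rightarrow> (('d \<Rightarrow> nat) \<Rightarrow> 'm set) \<Rightarrow> (('d \<Rightarrow> nat) \<Rightarrow> real) \<Rightarrow> bool" where
  "hilbert_poly_coeffs Sg sm Mg c \<longleftrightarrow> finite {\<alpha>. c \<alpha> \<noteq> 0} \<and>
     (\<exists>v. \<forall>n\<ge>v. \<exists>l. qlen Sg sm Mg {0} n = enat l \<and>
        real l = (\<Sum>\<alpha>\<in>{\<alpha>. c \<alpha> \<noteq> 0}. c \<alpha> * (\<Prod>i\<in>UNIV. real (n i) ^ \<alpha> i)))"

definition mixed_mult :: "(('d::finite \<Rightarrow> nat) \<Rightarrow> 'a::comm_ring_1 set) \<Rightarrow> ('a \<Rightarrow> 'm::ab_group_add \<Rightarrow> 'm)
     \<Rightarrow> (('d \<Rightarrow> nat) \<Rightarrow> 'm set) \<Rightarrow> ('d \<Rightarrow> nat) \<Rightarrow> real" where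
  "mixed_mult Sg sm Mg k = (\<Prod>i\<in>UNIV. fact (k i)) * (THE c. hilbert_poly_coeffs Sg sm Mg c) k"

definition filter_regular :: "(('d \<Rightarrow> nat) \<Rightarrow> 'm::ab_group_add set) \<Rightarrow> ('a \<Rightarrow> 'm \<Rightarrow> 'm)
     \<Rightarrow> 'm set \<Rightarrow> 'a \<Rightarrow> bool" where
  "filter_regular Mg sm N a \<longleftrightarrow> (\<exists>v. \<forall>n\<ge>v. \<forall>x\<in>Mg n. sm a x \<in> N \<longrightarrow> x \<in> N)"

(* (y_0,...,y_{j-1}) M for a list of (degree index, element) pairs, first j entries *)
definition seq_submod :: "('a::comm_ring_1 \<Rightarrow> 'm::ab_group_add \<Rightarrow> 'm) \<Rightarrow> ('d \<times> 'a) list \<Rightarrow> nat \<Rightarrow> 'm set" where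
  "seq_submod sm xs j = {(\<Sum>i<j. sm (snd (xs ! i)) (f i)) | f. True}"

definition filter_regular_seq :: "(('d \<Rightarrow> nat) \<Rightarrow> 'm::ab_group_add set) \<Rightarrow> ('a::comm_ring_1 \<Rightarrow> 'm \<Rightarrow> 'm)
     \<Rightarrow> ('d \<times> 'a) list \<Rightarrow> bool" where
  "filter_regular_seq Mg sm xs \<longleftrightarrow>
     (\<forall>j<length xs. filter_regular Mg sm (seq_submod sm xs j) (snd (xs ! j)))"

end

(* Multiplication by a filter-regular x in S_i is injective on M_n for large n, so passing from M to
   M/xM replaces the Hilbert function by its difference in direction i.  If the Hilbert polynomial
   is written in the basis of products of binomial coefficients, these differences shift the
   coefficients; as the degree of P_M is at most dim Supp_++ M = |k|, the function of M/xM is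
   eventually the coefficient at k, which is e(M;k).  A nonzero constant Hilbert function means
   dim Supp_++ = 0: two comparable primes P < Q in the support yield, from f in Q - P, submodules
   generated by f^j z of unbounded colength, and an empty support forces the function to vanish. *)

theory Submission
  imports Defs
begin

subsection \<open>Eventually polynomial functions\<close>

text \<open>Since e(M;k) is a coefficient of a polynomial named by a definite description, that
  polynomial must be shown to exist, to be unique and to have degree at most |k|. Both bounds in the
  existence proof are strict: no chain of \<open>s\<close> inclusions among the primes, degree below
  \<open>s\<close>. So \<open>s = 0\<close> matches empty support with an eventually vanishing
  function, and no convention for -\<infinity> enters the induction. No quotient is formed: K/N is a
  pair of nested submodules and length counts strict chains between them, so isomorphism theorems
  are statements about chains. The obstacle with several gradings is integration: the differences of
  a Hilbert function are known to be polynomial one direction at a time, and they must come from one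
  polynomial. In the binomial basis this is a compatibility of coefficients, which holds because
  differences in two directions commute. Lengths are finite because an artinian local ring has
  finite length over itself; the basis theorem over this ring makes S and M noetherian, and the
  graded pieces of M then have finite length.\<close>

definition degree_below :: "nat \<Rightarrow> ('d::finite \<Rightarrow> nat) set" where
  "degree_below s = {\<alpha>. sum \<alpha> UNIV < s}"

definition binom :: "('d::finite \<Rightarrow> nat) \<Rightarrow> ('d \<Rightarrow> nat) \<Rightarrow> real" where
  "binom \<alpha> n = (\<Prod>i\<in>UNIV. real (n i choose \<alpha> i))"

definition binsum :: "nat \<Rightarrow> (('d::finite \<Rightarrow> nat) \<Rightarrow> real) \<Rightarrow> ('d \<Rightarrow> nat) \<Rightarrow> real" where
  "binsum s b n = (\<Sum>\<alpha>\<in>degree_below s. b \<alpha> * binom \<alpha> n)"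

text \<open>The strict bound makes \<open>s = 0\<close> mean eventually zero. Zero coefficients
  outside \<open>degree_below s\<close> keep the family stable under shifts of the index, since
  adding \<open>unitv i\<close> only raises the degree.\<close>

definition eventually_poly :: "nat \<Rightarrow> (('d::finite \<Rightarrow> nat) \<Rightarrow> real) \<Rightarrow> bool" where
  "eventually_poly s f \<longleftrightarrow>
     (\<exists>b v. (\<forall>\<alpha>. \<alpha> \<notin> degree_below s \<longrightarrow> b \<alpha> = 0) \<and> (\<forall>n\<ge>v. f n = binsum s b n))"

lemma unitv_simps [simp]: "unitv i i = 1" "j \<noteq> i \<Longrightarrow> unitv i j = 0"
  by (auto simp: unitv_def)

lemma sum_unitv [simp]: "sum (unitv i) (UNIV :: 'd::finite set) = 1"
  by (simp add: unitv_def)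

lemma sum_add_unitv: "sum (\<alpha> + unitv i) (UNIV :: 'd::finite set) = Suc (sum \<alpha> UNIV)"
proof -
  have "sum (\<alpha> + unitv i) (UNIV :: 'd::finite set) = sum \<alpha> UNIV + sum (unitv i) UNIV"
    by (simp add: plus_fun_def sum.distrib)
  then show ?thesis by simp
qed

lemma sum_add_unitv' [simp]: "(\<Sum>a\<in>UNIV. \<alpha> a + unitv i a) = Suc (sum \<alpha> (UNIV :: 'd::finite set))"
  by (simp add: sum.distrib)

lemma finite_fun_le: "finite {\<beta>. \<beta> \<le> (\<alpha> :: 'd::finite \<Rightarrow> nat)}"
proof -
  have "{\<beta>. \<beta> \<le> \<alpha>} = PiE UNIV (\<lambda>i. {..\<alpha> i})"
    by (auto simp: le_fun_def PiE_def)
  then show ?thesis by (simp add: finite_PiE)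
qed

lemma finite_degree_below [simp]: "finite (degree_below s :: ('d::finite \<Rightarrow> nat) set)"
proof (rule finite_subset)
  show "degree_below s \<subseteq> {\<beta>. \<beta> \<le> (\<lambda>_::'d. s)}"
  proof
    fix \<alpha> :: "'d \<Rightarrow> nat" assume "\<alpha> \<in> degree_below s"
    then have "sum \<alpha> UNIV < s" by (simp add: degree_below_def)
    moreover have "\<alpha> i \<le> sum \<alpha> UNIV" for i by (rule member_le_sum) auto
    ultimately show "\<alpha> \<in> {\<beta>. \<beta> \<le> (\<lambda>_. s)}"
      by (simp add: le_fun_def) (meson le_less_trans less_imp_le)
  qed
qed (rule finite_fun_le)

lemmas finite_degree_below' [simp] = finite_degree_below[unfolded degree_below_def]

lemma nonzero_index: "\<alpha> \<noteq> 0 \<Longrightarrow> \<exists>i. (\<alpha> :: 'd \<Rightarrow> nat) i > 0"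
  by (auto simp: fun_eq_iff)

lemma add_unitv_cases:
  assumes "(\<alpha> :: 'd \<Rightarrow> nat) i > 0"
  obtains \<beta> where "\<alpha> = \<beta> + unitv i"
proof
  show "\<alpha> = (\<lambda>j. \<alpha> j - unitv i j) + unitv i"
    using assms by (auto simp: fun_eq_iff unitv_def)
qed

lemma minus_unitv_add: "(\<alpha> :: 'd \<Rightarrow> nat) i > 0 \<Longrightarrow> \<alpha> - unitv i + unitv i = \<alpha>"
  by (auto simp: fun_eq_iff unitv_def)

lemma binom_zero [simp]: "binom 0 n = 1"
  by (simp add: binom_def)

text \<open>Pascal's rule in coordinate \<open>i\<close>; the factors at the other coordinates do
  not see \<open>unitv i\<close>.\<close>

lemma binom_diff:
  "binom (\<alpha> + unitv i) (n + unitv i) - binom (\<alpha> + unitv i) n = binom \<alpha> n"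
proof -
  have *: "binom \<alpha>' n' = real (n' i choose \<alpha>' i) * (\<Prod>j\<in>UNIV - {i}. real (n' j choose \<alpha>' j))"
    for \<alpha>' n' :: "'a \<Rightarrow> nat"
    unfolding binom_def by (rule prod.remove) auto
  have "(\<Prod>j\<in>UNIV - {i}. real ((n + x) j choose (\<alpha> + y) j)) = (\<Prod>j\<in>UNIV - {i}. real (n j choose \<alpha> j))"
    if "x = unitv i \<or> x = 0" "y = unitv i \<or> y = 0" for x y
    using that by (intro prod.cong) auto
  from this[of "unitv i" "unitv i"] this[of 0 "unitv i"]
  show ?thesis
    unfolding *[of "\<alpha> + unitv i"] *[of \<alpha> n] by (simp add: algebra_simps)
qed

lemma binom_diff':
  assumes "\<alpha> i > 0"
  shows "binom \<alpha> (n + unitv i) - binom \<alpha> n = binom (\<alpha> - unitv i) n"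
  using binom_diff[of "\<alpha> - unitv i" i n] minus_unitv_add[of \<alpha> i] assms by simp

lemma binom_add_unitv_eq:
  assumes "\<alpha> i = 0"
  shows "binom \<alpha> (n + unitv i) = binom \<alpha> n"
  unfolding binom_def
proof (intro prod.cong refl)
  fix j show "real ((n + unitv i) j choose \<alpha> j) = real (n j choose \<alpha> j)"
    using assms by (cases "j = i") auto
qed

text \<open>Terms with \<open>\<alpha> i = 0\<close> cancel and Pascal's rule lowers the others, so
  after reindexing only the coefficients have moved. The index set can be restored to
  \<open>degree_below s\<close> because \<open>b\<close> vanishes beyond it.\<close>

lemma binsum_diff:
  assumes "\<And>\<alpha>. \<alpha> \<notin> degree_below s \<Longrightarrow> b \<alpha> = 0"
  shows "binsum s b (n + unitv i) - binsum s b n = binsum s (\<lambda>\<alpha>. b (\<alpha> + unitv i)) n"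
proof -
  have "binsum s b (n + unitv i) - binsum s b n
      = (\<Sum>\<alpha>\<in>degree_below s. b \<alpha> * (binom \<alpha> (n + unitv i) - binom \<alpha> n))"
    by (simp add: binsum_def sum_subtractf algebra_simps)
  also have "\<dots> = (\<Sum>\<alpha>\<in>degree_below s \<inter> {\<alpha>. \<alpha> i > 0}. b \<alpha> * (binom \<alpha> (n + unitv i) - binom \<alpha> n))"
    by (rule sum.mono_neutral_right) (auto simp: binom_add_unitv_eq)
  also have "\<dots> = (\<Sum>\<beta>\<in>{\<beta>. \<beta> + unitv i \<in> degree_below s}. b (\<beta> + unitv i) * binom \<beta> n)"
    by (rule sum.reindex_bij_witness[where i = "\<lambda>\<beta>. \<beta> + unitv i" and j = "\<lambda>\<alpha>. \<alpha> - unitv i"])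
       (auto simp: binom_diff minus_unitv_add binom_diff')
  also have "\<dots> = (\<Sum>\<beta>\<in>degree_below s. b (\<beta> + unitv i) * binom \<beta> n)"
    by (rule sum.mono_neutral_left) (auto simp: degree_below_def sum_add_unitv intro!: assms)
  finally show ?thesis by (simp add: binsum_def)
qed

lemma binsum_degree_Suc:
  assumes "\<And>\<alpha>. \<alpha> \<notin> degree_below s \<Longrightarrow> b \<alpha> = 0"
  shows "binsum (Suc s) b n = binsum s b n"
  unfolding binsum_def
proof (rule sum.mono_neutral_right)
  show "degree_below s \<subseteq> degree_below (Suc s)" by (auto simp: degree_below_def)
qed (use assms in auto)

text \<open>Induction on the degree bound. All differences of a vanishing function vanish, which
  kills every coefficient at an index of the form \<open>\<beta> + unitv i\<close>; the constant
  term is then the value at \<open>v\<close>.\<close>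

lemma binsum_unique:
  assumes "\<And>\<alpha>. \<alpha> \<notin> degree_below s \<Longrightarrow> b \<alpha> = 0"
    and "\<And>n. v \<le> n \<Longrightarrow> binsum s b n = 0"
  shows "b \<alpha> = 0"
  using assms
proof (induction s arbitrary: b \<alpha>)
  case 0
  then show ?case by (auto simp: degree_below_def)
next
  case (Suc s)
  have shifted: "b (\<beta> + unitv i) = 0" for \<beta> i
  proof (rule Suc.IH[of "\<lambda>\<beta>. b (\<beta> + unitv i)"])
    show zero: "b (\<alpha> + unitv i) = 0" if "\<alpha> \<notin> degree_below s" for \<alpha>
      using that by (intro Suc.prems) (auto simp: degree_below_def sum_add_unitv)
    fix n :: "'a \<Rightarrow> nat" assume n: "v \<le> n"
    then have "v \<le> n + unitv i" by (auto simp: le_fun_def intro: trans_le_add1)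
    then have "binsum (Suc s) b (n + unitv i) - binsum (Suc s) b n = 0"
      using Suc.prems(2) n by simp
    then show "binsum s (\<lambda>\<alpha>. b (\<alpha> + unitv i)) n = 0"
      using binsum_diff[of "Suc s" b n i] Suc.prems(1) binsum_degree_Suc[of s "\<lambda>\<alpha>. b (\<alpha> + unitv i)" n] zero
      by simp
  qed
  have nonzero: "b \<beta> = 0" if "\<beta> \<noteq> 0" for \<beta>
  proof -
    obtain i where "\<beta> i > 0" using nonzero_index[OF \<open>\<beta> \<noteq> 0\<close>] by blast
    then show ?thesis by (metis add_unitv_cases shifted)
  qed
  have "0 = (\<Sum>\<alpha>\<in>degree_below (Suc s). b \<alpha> * binom \<alpha> v)"
    using Suc.prems(2)[of v] by (simp add: binsum_def)
  also have "\<dots> = (\<Sum>\<alpha>\<in>{0}. b \<alpha> * binom \<alpha> v)"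
    by (rule sum.mono_neutral_right) (auto simp: degree_below_def nonzero)
  finally have "b 0 = 0" by simp
  then show ?case using nonzero by metis
qed

lemma constant_of_unit_steps:
  assumes "\<And>n i. v \<le> n \<Longrightarrow> g (n + unitv i) = g n" and "v \<le> (n :: 'd::finite \<Rightarrow> nat)"
  shows "g n = g v"
  using assms(2)
proof (induction "sum n UNIV" arbitrary: n rule: less_induct)
  case less
  show ?case
  proof (cases "n = v")
    case False
    then obtain i where i: "v i < n i"
      using less.prems by (metis le_fun_def le_neq_implies_less ext)
    then have "n i > 0" by simp
    then obtain m where m: "n = m + unitv i" by (rule add_unitv_cases)
    have vm: "v \<le> m"
      unfolding le_fun_def
    proof
      fix j show "v j \<le> m j"
        using less.prems i m by (cases "j = i") (auto simp: le_fun_def dest: spec[of _ j])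
    qed
    then show ?thesis using assms(1)[of m i] less.hyps[of m] m sum_add_unitv[of m i] by simp
  qed simp
qed

lemma eventually_poly_add:
  assumes "eventually_poly s f" "eventually_poly s g"
  shows "eventually_poly s (\<lambda>n. f n + g n)"
proof -
  obtain b v c w where
    b: "\<And>\<alpha>. \<alpha> \<notin> degree_below s \<Longrightarrow> b \<alpha> = 0" "\<And>n. v \<le> n \<Longrightarrow> f n = binsum s b n" and
    c: "\<And>\<alpha>. \<alpha> \<notin> degree_below s \<Longrightarrow> c \<alpha> = 0" "\<And>n. w \<le> n \<Longrightarrow> g n = binsum s c n"
    using assms unfolding eventually_poly_def by metis
  have "f n + g n = binsum s (\<lambda>\<alpha>. b \<alpha> + c \<alpha>) n" if "v + w \<le> n" for n
  proof -
    have "v \<le> n" "w \<le> n" using that by (auto simp: le_fun_def intro: order_trans[rotated])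
    then show ?thesis by (simp add: b c binsum_def sum.distrib distrib_right)
  qed
  then show ?thesis
    unfolding eventually_poly_def using b(1) c(1)
    by (intro exI[of _ "\<lambda>\<alpha>. b \<alpha> + c \<alpha>"] exI[of _ "v + w"]) auto
qed

lemma eventually_poly_zero:
  assumes "\<And>n. v \<le> n \<Longrightarrow> f n = 0"
  shows "eventually_poly s f"
  unfolding eventually_poly_def
  by (intro exI[of _ "\<lambda>_. 0"] exI[of _ v]) (simp add: assms binsum_def)

text \<open>The shifted function is the function plus its difference, and the difference obeys the
  same degree bound.\<close>

lemma eventually_poly_shift:
  assumes "eventually_poly s f"
  shows "eventually_poly s (\<lambda>n. f (n + unitv i))"
proof -
  obtain b v where
    b: "\<And>\<alpha>. \<alpha> \<notin> degree_below s \<Longrightarrow> b \<alpha> = 0" "\<And>n. v \<le> n \<Longrightarrow> f n = binsum s b n"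
    using assms unfolding eventually_poly_def by metis
  have "f (n + unitv i) = binsum s (\<lambda>\<alpha>. b \<alpha> + b (\<alpha> + unitv i)) n" if "v \<le> n" for n
  proof -
    have "v \<le> n + unitv i" using that by (auto simp: le_fun_def intro: trans_le_add1)
    then have "f (n + unitv i) = binsum s b n + binsum s (\<lambda>\<alpha>. b (\<alpha> + unitv i)) n"
      using b(2) binsum_diff[of s b n i] b(1) by simp
    then show ?thesis by (simp add: binsum_def sum.distrib distrib_right)
  qed
  moreover have "b (\<alpha> + unitv i) = 0" if "\<alpha> \<notin> degree_below s" for \<alpha>
    using that by (intro b) (auto simp: degree_below_def sum_add_unitv)
  ultimately show ?thesis
    unfolding eventually_poly_def using b(1)
    by (intro exI[of _ "\<lambda>\<alpha>. b \<alpha> + b (\<alpha> + unitv i)"] exI[of _ v]) auto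
qed

text \<open>A discrete Poincare lemma. A primitive with coefficients \<open>b\<close> must satisfy
  \<open>b (\<beta> + unitv i) = a i \<beta>\<close> for all \<open>i\<close>, so the prescriptions
  for different \<open>i\<close> have to agree; the constant term stays free.\<close>

lemma eventually_poly_antidifference:
  fixes f :: "('d::finite \<Rightarrow> nat) \<Rightarrow> real"
  assumes "\<And>i. eventually_poly s (\<lambda>n. f (n + unitv i) - f n)"
  shows "eventually_poly (Suc s) f"
proof -
  have "\<forall>i. \<exists>a v. (\<forall>\<alpha>. \<alpha> \<notin> degree_below s \<longrightarrow> a \<alpha> = 0) \<and>
      (\<forall>n\<ge>v. f (n + unitv i) - f n = binsum s a n)"
    using assms unfolding eventually_poly_def by blast
  then obtain a w where aw: "\<And>i. (\<forall>\<alpha>. \<alpha> \<notin> degree_below s \<longrightarrow> a i \<alpha> = 0) \<and>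
      (\<forall>n\<ge>w i. f (n + unitv i) - f n = binsum s (a i) n)"
    by metis
  have a0: "a i \<alpha> = 0" if "\<alpha> \<notin> degree_below s" for i \<alpha> using aw that by blast
  define v where "v = (\<lambda>j. \<Sum>i\<in>UNIV. w i j)"
  have wv: "w i \<le> v" for i
    unfolding v_def le_fun_def by (auto intro: member_le_sum)
  have fa: "f (n + unitv i) - f n = binsum s (a i) n" if "v \<le> n" for n i
    using aw that wv[of i] by (meson order_trans)
  have up: "v \<le> n + unitv i" if "v \<le> n" for n i
    using that by (auto simp: le_fun_def intro: trans_le_add1)
  have a_shift0: "a i (\<alpha> + unitv j) = 0" if "\<alpha> \<notin> degree_below s" for i j \<alpha>
    using that by (intro a0) (auto simp: degree_below_def sum_add_unitv)
  \<comment> \<open>Both sides are coefficients of the second difference in directions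
    \<open>i\<close> and \<open>j\<close>, taken in either order; \<open>binsum_unique\<close>
    passes from functions to coefficients.\<close>
  have compat: "a i (\<alpha> + unitv j) = a j (\<alpha> + unitv i)" for i j \<alpha>
  proof -
    have "a i (\<alpha> + unitv j) - a j (\<alpha> + unitv i) = 0"
    proof (rule binsum_unique[of s "\<lambda>\<alpha>. a i (\<alpha> + unitv j) - a j (\<alpha> + unitv i)" v])
      fix n assume n: "v \<le> n"
      have "binsum s (\<lambda>\<alpha>. a i (\<alpha> + unitv j)) n = binsum s (a i) (n + unitv j) - binsum s (a i) n"
        by (rule binsum_diff[symmetric]) (rule a0)
      also have "\<dots> = f (n + unitv j + unitv i) - f (n + unitv j) - (f (n + unitv i) - f n)"
        by (simp add: fa n up)
      also have "\<dots> = f (n + unitv i + unitv j) - f (n + unitv i) - (f (n + unitv j) - f n)"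
        by (simp add: add_ac)
      also have "\<dots> = binsum s (a j) (n + unitv i) - binsum s (a j) n"
        by (simp add: fa n up)
      also have "\<dots> = binsum s (\<lambda>\<alpha>. a j (\<alpha> + unitv i)) n"
        by (rule binsum_diff) (rule a0)
      finally show "binsum s (\<lambda>\<alpha>. a i (\<alpha> + unitv j) - a j (\<alpha> + unitv i)) n = 0"
        by (simp add: binsum_def left_diff_distrib sum_subtractf)
    qed (simp add: a_shift0)
    then show ?thesis by simp
  qed
  \<comment> \<open>By \<open>compat\<close> the coordinate picked by SOME does not matter. The
    value 0 at index 0 is provisional: what \<open>b\<close> misses has no differences beyond
    \<open>v\<close>, hence is a constant \<open>g v\<close>, and that becomes the constant
    term.\<close>
  define b where "b = (\<lambda>\<alpha>. if \<alpha> = 0 then 0 else (let i = SOME i. \<alpha> i > 0 in a i (\<alpha> - unitv i)))"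
  have b_shift: "b (\<beta> + unitv i) = a i \<beta>" for \<beta> i
  proof -
    define j where "j = (SOME j. (\<beta> + unitv i) j > 0)"
    have "(\<beta> + unitv i) i > 0" by simp
    then have j: "(\<beta> + unitv i) j > 0" unfolding j_def by (rule someI)
    have ne: "\<beta> + unitv i \<noteq> 0" using j by (metis less_irrefl zero_fun_apply)
    have bj: "b (\<beta> + unitv i) = a j (\<beta> + unitv i - unitv j)"
      by (simp only: b_def Let_def j_def ne if_False)
    show ?thesis
    proof (cases "j = i")
      case False
      then have "\<beta> j > 0" using j by simp
      then obtain \<gamma> where "\<beta> = \<gamma> + unitv j" by (rule add_unitv_cases)
      moreover from this have "\<beta> + unitv i - unitv j = \<gamma> + unitv i"
        by (simp add: fun_eq_iff)
      ultimately show ?thesis using bj compat[of i \<gamma> j] by simp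
    next
      case True
      then show ?thesis using bj by simp
    qed
  qed
  have b0: "b \<alpha> = 0" if "\<alpha> \<notin> degree_below (Suc s)" for \<alpha>
  proof (cases "\<alpha> = 0")
    case False
    then obtain i where "\<alpha> i > 0" using nonzero_index by blast
    then obtain \<beta> where \<beta>: "\<alpha> = \<beta> + unitv i" by (rule add_unitv_cases)
    then have "\<beta> \<notin> degree_below s" using that by (simp add: degree_below_def sum_add_unitv)
    then show ?thesis using b_shift a0 \<beta> by simp
  qed (simp add: b_def)
  define g where "g = (\<lambda>n. f n - binsum (Suc s) b n)"
  have "g (n + unitv i) = g n" if "v \<le> n" for n i
  proof -
    have "binsum (Suc s) b (n + unitv i) - binsum (Suc s) b n = binsum (Suc s) (a i) n"
      using binsum_diff[of "Suc s" b n i] b0 by (simp add: b_shift)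
    also have "\<dots> = binsum s (a i) n" by (rule binsum_degree_Suc) (rule a0)
    finally show ?thesis using fa[OF that, of i] by (simp add: g_def)
  qed
  then have g: "g n = g v" if "v \<le> n" for n using that by (rule constant_of_unit_steps)
  have "f n = binsum (Suc s) (b(0 := g v)) n" if "v \<le> n" for n
  proof -
    have "(0::'d \<Rightarrow> nat) \<in> degree_below (Suc s)" by (simp add: degree_below_def)
    then have split: "binsum (Suc s) c n = c 0 + (\<Sum>\<alpha>\<in>degree_below (Suc s) - {0}. c \<alpha> * binom \<alpha> n)" for c
      unfolding binsum_def by (subst sum.remove[of _ 0]) auto
    have "binsum (Suc s) (b(0 := g v)) n = g v + binsum (Suc s) b n"
      unfolding split by (simp add: b_def)
    then show ?thesis using g[OF that] by (simp add: g_def)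
  qed
  moreover have "(b(0 := g v)) \<alpha> = 0" if "\<alpha> \<notin> degree_below (Suc s)" for \<alpha>
    using that b0 by (auto simp: degree_below_def)
  ultimately show ?thesis
    unfolding eventually_poly_def by (intro exI[of _ "b(0 := g v)"] exI[of _ v]) blast
qed

section \<open>Change of basis between binomial coefficients and powers\<close>

lemma prod_change_basis:
  fixes \<alpha> n :: "'d::finite \<Rightarrow> nat" and p q :: "nat \<Rightarrow> nat \<Rightarrow> real"
  assumes "\<And>a x. p a x = (\<Sum>j\<le>a. t a j * q j x)"
  shows "(\<Prod>i\<in>UNIV. p (\<alpha> i) (n i))
    = (\<Sum>\<beta>\<in>{\<beta>. \<beta> \<le> \<alpha>}. (\<Prod>i\<in>UNIV. t (\<alpha> i) (\<beta> i)) * (\<Prod>i\<in>UNIV. q (\<beta> i) (n i)))"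
proof -
  have "(\<Prod>i\<in>UNIV. p (\<alpha> i) (n i)) = (\<Prod>i\<in>UNIV. \<Sum>j\<in>{..\<alpha> i}. t (\<alpha> i) j * q j (n i))"
    by (simp add: assms)
  also have "\<dots> = (\<Sum>\<beta>\<in>PiE UNIV (\<lambda>i. {..\<alpha> i}). \<Prod>i\<in>UNIV. t (\<alpha> i) (\<beta> i) * q (\<beta> i) (n i))"
    by (rule prod_sum_PiE) auto
  also have "PiE UNIV (\<lambda>i. {..\<alpha> i}) = {\<beta>. \<beta> \<le> \<alpha>}"
    by (auto simp: le_fun_def PiE_def)
  finally show ?thesis by (simp add: prod.distrib)
qed

lemma Suc_times_choose: "real (Suc a) * real (x choose Suc a) = (real x - real a) * real (x choose a)"
proof (cases "a \<le> x")
  case True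
  have "Suc a * (x choose Suc a) = (x - a) * (x choose a)"
    by (simp only: binomial_absorb_comp binomial_absorption)
  then show ?thesis using True by (metis of_nat_diff of_nat_mult)
qed (simp add: binomial_eq_0)

lemma sum_strict_mono_fun:
  fixes \<alpha> \<beta> :: "'d::finite \<Rightarrow> nat"
  assumes "\<alpha> \<le> \<beta>" "\<alpha> \<noteq> \<beta>"
  shows "sum \<alpha> UNIV < sum \<beta> UNIV"
proof -
  obtain i where "\<alpha> i < \<beta> i" using assms by (metis antisym le_fun_def not_le)
  then show ?thesis using assms(1) by (intro sum_strict_mono_ex1) (auto simp: le_fun_def)
qed

text \<open>Signed Stirling numbers of the first kind divided by \<open>fact a\<close>; the
  recursion is \<open>Suc_times_choose\<close> read coefficientwise.\<close>

fun choose_coeff :: "nat \<Rightarrow> nat \<Rightarrow> real" where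
  "choose_coeff 0 j = (if j = 0 then 1 else 0)"
| "choose_coeff (Suc a) j =
     ((if j = 0 then 0 else choose_coeff a (j - 1)) - real a * choose_coeff a j) / real (Suc a)"

lemma choose_coeff_above: "j > a \<Longrightarrow> choose_coeff a j = 0"
  by (induction a arbitrary: j) auto

lemma choose_coeff_diag: "choose_coeff a a = 1 / fact a"
  by (induction a) (auto simp: choose_coeff_above)

lemma choose_conv_powers: "real (x choose a) = (\<Sum>j\<le>a. choose_coeff a j * real x ^ j)"
proof (induction a)
  case (Suc a)
  have "real (Suc a) * real (x choose Suc a) = (real x - real a) * real (x choose a)"
    by (rule Suc_times_choose)
  also have "\<dots> = (\<Sum>j\<le>a. choose_coeff a j * real x ^ Suc j) - (\<Sum>j\<le>a. real a * choose_coeff a j * real x ^ j)"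
    unfolding Suc sum_distrib_left sum_subtractf[symmetric]
    by (intro sum.cong) (auto simp: algebra_simps)
  also have "(\<Sum>j\<le>a. choose_coeff a j * real x ^ Suc j)
      = (\<Sum>j\<le>Suc a. (if j = 0 then 0 else choose_coeff a (j - 1)) * real x ^ j)"
    by (subst sum.atMost_Suc_shift) simp
  also have "(\<Sum>j\<le>a. real a * choose_coeff a j * real x ^ j) = (\<Sum>j\<le>Suc a. real a * choose_coeff a j * real x ^ j)"
    by (simp add: choose_coeff_above)
  also have "(\<Sum>j\<le>Suc a. (if j = 0 then 0 else choose_coeff a (j - 1)) * real x ^ j) - \<dots>
      = (\<Sum>j\<le>Suc a. real (Suc a) * choose_coeff (Suc a) j * real x ^ j)"
    unfolding sum_subtractf[symmetric] by (intro sum.cong) (auto simp: field_simps)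
  finally have "real (Suc a) * real (x choose Suc a)
      = real (Suc a) * (\<Sum>j\<le>Suc a. choose_coeff (Suc a) j * real x ^ j)"
    by (simp only: sum_distrib_left mult.assoc)
  then show ?case by (simp only: mult_cancel_left) simp
qed simp

text \<open>The number of surjections from \<open>a\<close> points onto \<open>j\<close> points,
  that is, \<open>fact j\<close> times a Stirling number of the second kind.\<close>

fun power_coeff :: "nat \<Rightarrow> nat \<Rightarrow> real" where
  "power_coeff 0 j = (if j = 0 then 1 else 0)"
| "power_coeff (Suc a) j =
     (if j = 0 then 0 else real j * power_coeff a (j - 1)) + real j * power_coeff a j"

lemma power_coeff_above: "j > a \<Longrightarrow> power_coeff a j = 0"
  by (induction a arbitrary: j) auto

lemma power_coeff_diag: "power_coeff a a = fact a"
  by (induction a) (auto simp: power_coeff_above)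

lemma power_conv_choose: "real x ^ a = (\<Sum>j\<le>a. power_coeff a j * real (x choose j))"
proof (induction a)
  case (Suc a)
  have step: "real x * real (x choose j) = real (Suc j) * real (x choose Suc j) + real j * real (x choose j)" for j
    unfolding Suc_times_choose by (simp add: algebra_simps)
  have "real x ^ Suc a = (\<Sum>j\<le>a. power_coeff a j * (real x * real (x choose j)))"
    by (simp add: Suc sum_distrib_left mult_ac)
  also have "\<dots> = (\<Sum>j\<le>a. real (Suc j) * power_coeff a j * real (x choose Suc j))
      + (\<Sum>j\<le>a. real j * power_coeff a j * real (x choose j))"
    unfolding step sum.distrib[symmetric] by (intro sum.cong) (auto simp: algebra_simps)
  also have "(\<Sum>j\<le>a. real (Suc j) * power_coeff a j * real (x choose Suc j))
      = (\<Sum>j\<le>Suc a. (if j = 0 then 0 else real j * power_coeff a (j - 1)) * real (x choose j))"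
    by (subst sum.atMost_Suc_shift) simp
  also have "(\<Sum>j\<le>a. real j * power_coeff a j * real (x choose j))
      = (\<Sum>j\<le>Suc a. real j * power_coeff a j * real (x choose j))"
    by (simp add: power_coeff_above)
  finally show ?case
    unfolding sum.distrib[symmetric] by (simp only: power_coeff.simps distrib_right)
qed simp

definition monom_sum :: "(('d::finite \<Rightarrow> nat) \<Rightarrow> real) \<Rightarrow> ('d \<Rightarrow> nat) \<Rightarrow> real" where
  "monom_sum c n = (\<Sum>\<alpha>\<in>{\<alpha>. c \<alpha> \<noteq> 0}. c \<alpha> * (\<Prod>i\<in>UNIV. real (n i) ^ \<alpha> i))"

text \<open>Compare with the binomial basis at an exponent \<open>m\<close> of maximal total degree
  among those with nonzero coefficient. Only exponents above \<open>m\<close> contribute to the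
  binomial coefficient there, hence only \<open>m\<close> itself, and the contribution is
  \<open>c m\<close> times a product of factorials.\<close>

lemma monom_sum_unique_zero:
  fixes c :: "('d::finite \<Rightarrow> nat) \<Rightarrow> real"
  assumes fin: "finite {\<alpha>. c \<alpha> \<noteq> 0}" and zero: "\<And>n. v \<le> n \<Longrightarrow> monom_sum c n = 0"
  shows "c \<alpha> = 0"
proof (rule ccontr)
  assume "c \<alpha> \<noteq> 0"
  define F where "F = {\<alpha>. c \<alpha> \<noteq> 0}"
  have F: "finite F" "F \<noteq> {}" using fin \<open>c \<alpha> \<noteq> 0\<close> by (auto simp: F_def)
  define s where "s = Suc (Max ((\<lambda>\<alpha>. sum \<alpha> UNIV) ` F))"
  have F_deg: "\<alpha> \<in> degree_below s" if "\<alpha> \<in> F" for \<alpha>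
    using that F by (simp add: degree_below_def s_def less_Suc_eq_le)
  have "Max ((\<lambda>\<alpha>. sum \<alpha> UNIV) ` F) \<in> (\<lambda>\<alpha>. sum \<alpha> UNIV) ` F" using F by (intro Max_in) auto
  then obtain m where m: "m \<in> F" "sum m UNIV = Max ((\<lambda>\<alpha>. sum \<alpha> UNIV) ` F)" by auto
  define t where "t = (\<lambda>\<alpha> \<beta> :: 'd \<Rightarrow> nat. \<Prod>i\<in>UNIV. power_coeff (\<alpha> i) (\<beta> i))"
  have t0: "t \<alpha> \<beta> = 0" if "\<not> \<beta> \<le> \<alpha>" for \<alpha> \<beta>
    using that unfolding t_def le_fun_def not_le
    by (metis UNIV_I finite not_le power_coeff_above prod_zero)
  define b where "b = (\<lambda>\<beta>. \<Sum>\<alpha>\<in>F. c \<alpha> * t \<alpha> \<beta>)"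
  have below: "\<beta> \<in> degree_below s" if "\<beta> \<le> \<alpha>" "\<alpha> \<in> F" for \<alpha> \<beta>
    using F_deg[OF that(2)] sum_mono[of UNIV \<beta> \<alpha>] that(1) by (auto simp: degree_below_def le_fun_def)
  have "b m = 0"
  proof (rule binsum_unique[of s b v])
    fix \<beta> :: "'d \<Rightarrow> nat" assume "\<beta> \<notin> degree_below s"
    then show "b \<beta> = 0" unfolding b_def using below t0 by (intro sum.neutral) fastforce
  next
    fix n :: "'d \<Rightarrow> nat" assume "v \<le> n"
    then have "0 = monom_sum c n" using zero by simp
    also have "\<dots> = (\<Sum>\<alpha>\<in>F. c \<alpha> * (\<Sum>\<beta>\<in>{\<beta>. \<beta> \<le> \<alpha>}. t \<alpha> \<beta> * binom \<beta> n))"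
      unfolding monom_sum_def F_def t_def binom_def
      by (intro sum.cong refl arg_cong2[of _ _ _ _ "(*)"] prod_change_basis power_conv_choose)
    also have "\<dots> = (\<Sum>\<alpha>\<in>F. c \<alpha> * (\<Sum>\<beta>\<in>degree_below s. t \<alpha> \<beta> * binom \<beta> n))"
      using below t0
      by (intro sum.cong refl arg_cong2[of _ _ _ _ "(*)"] sum.mono_neutral_left) auto
    also have "\<dots> = binsum s b n"
      unfolding binsum_def b_def sum_distrib_left sum_distrib_right
      by (subst sum.swap) (simp add: mult_ac)
    finally show "binsum s b n = 0" by simp
  qed
  moreover have "b m = (\<Sum>\<alpha>\<in>{m}. c \<alpha> * t \<alpha> m)"
    unfolding b_def
  proof (rule sum.mono_neutral_right)
    show "\<forall>\<alpha>\<in>F - {m}. c \<alpha> * t \<alpha> m = 0"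
    proof
      fix \<alpha> assume \<alpha>: "\<alpha> \<in> F - {m}"
      have "\<not> m \<le> \<alpha>"
      proof
        assume "m \<le> \<alpha>"
        then have "sum m UNIV < sum \<alpha> UNIV" using \<alpha> by (intro sum_strict_mono_fun) auto
        moreover have "sum \<alpha> UNIV \<le> sum m UNIV" using \<alpha> F m(2) by simp
        ultimately show False by simp
      qed
      then show "c \<alpha> * t \<alpha> m = 0" using t0 by simp
    qed
  qed (use F m in auto)
  ultimately have "c m * (\<Prod>i\<in>UNIV. fact (m i)) = 0" by (simp add: t_def power_coeff_diag)
  then show False using m(1) by (simp add: F_def)
qed

lemma monom_sum_unique:
  assumes fin: "finite {\<alpha>. c \<alpha> \<noteq> 0}" "finite {\<alpha>. d \<alpha> \<noteq> 0}"
    and eq: "\<And>n. v \<le> n \<Longrightarrow> monom_sum c n = monom_sum d n"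
  shows "c = d"
proof
  fix \<alpha>
  define F where "F = {\<alpha>. c \<alpha> \<noteq> 0} \<union> {\<alpha>. d \<alpha> \<noteq> 0}"
  have F: "finite F" using fin by (simp add: F_def)
  have ext: "monom_sum e n = (\<Sum>\<alpha>\<in>F. e \<alpha> * (\<Prod>i\<in>UNIV. real (n i) ^ \<alpha> i))"
    if "{\<alpha>. e \<alpha> \<noteq> 0} \<subseteq> F" for e n
    unfolding monom_sum_def using F that by (intro sum.mono_neutral_left) auto
  have sub: "{\<alpha>. c \<alpha> - d \<alpha> \<noteq> 0} \<subseteq> F" and subc: "{\<alpha>. c \<alpha> \<noteq> 0} \<subseteq> F" and subd: "{\<alpha>. d \<alpha> \<noteq> 0} \<subseteq> F"
    by (auto simp: F_def)
  have "c \<alpha> - d \<alpha> = 0"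
  proof (rule monom_sum_unique_zero[of "\<lambda>\<alpha>. c \<alpha> - d \<alpha>" v])
    show "finite {\<alpha>. c \<alpha> - d \<alpha> \<noteq> 0}" using sub F by (rule finite_subset)
    fix n assume "v \<le> n"
    have "monom_sum (\<lambda>\<alpha>. c \<alpha> - d \<alpha>) n = monom_sum c n - monom_sum d n"
      unfolding ext[OF sub] ext[OF subc] ext[OF subd] by (simp only: left_diff_distrib sum_subtractf)
    then show "monom_sum (\<lambda>\<alpha>. c \<alpha> - d \<alpha>) n = 0" using eq \<open>v \<le> n\<close> by simp
  qed
  then show "c \<alpha> = d \<alpha>" by simp
qed

text \<open>In top degree the change of basis from binomials to monomials is diagonal, so the
  normalised leading coefficients are the coefficients in the binomial basis.\<close>

lemma binsum_conv_monom_sum: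
  fixes b :: "('d::finite \<Rightarrow> nat) \<Rightarrow> real"
  obtains c where "finite {\<alpha>. c \<alpha> \<noteq> 0}" and "\<And>n. monom_sum c n = binsum (Suc s) b n"
    and "\<And>k. sum k UNIV = s \<Longrightarrow> (\<Prod>i\<in>UNIV. fact (k i)) * c k = b k"
proof
  define t where "t = (\<lambda>\<alpha> \<beta> :: 'd \<Rightarrow> nat. \<Prod>i\<in>UNIV. choose_coeff (\<alpha> i) (\<beta> i))"
  have t0: "t \<alpha> \<beta> = 0" if "\<not> \<beta> \<le> \<alpha>" for \<alpha> \<beta>
    using that unfolding t_def le_fun_def not_le
    by (metis UNIV_I finite not_le choose_coeff_above prod_zero)
  define c where "c = (\<lambda>\<beta>. \<Sum>\<alpha>\<in>degree_below (Suc s). b \<alpha> * t \<alpha> \<beta>)"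
  have below: "\<beta> \<in> degree_below (Suc s)" if "\<beta> \<le> \<alpha>" "\<alpha> \<in> degree_below (Suc s)" for \<alpha> \<beta> :: "'d \<Rightarrow> nat"
    using that sum_mono[of UNIV \<beta> \<alpha>] by (auto simp: degree_below_def le_fun_def)
  have supp: "{\<beta>. c \<beta> \<noteq> 0} \<subseteq> degree_below (Suc s)"
  proof safe
    fix \<beta> assume "c \<beta> \<noteq> 0"
    then obtain \<alpha> where "\<alpha> \<in> degree_below (Suc s)" "t \<alpha> \<beta> \<noteq> 0"
      unfolding c_def by (metis (no_types, lifting) mult_zero_right sum.neutral)
    then show "\<beta> \<in> degree_below (Suc s)" using t0 below by blast
  qed
  then show "finite {\<beta>. c \<beta> \<noteq> 0}" by (rule finite_subset) simp
  show "monom_sum c n = binsum (Suc s) b n" for n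
  proof -
    have "binsum (Suc s) b n = (\<Sum>\<alpha>\<in>degree_below (Suc s). b \<alpha> *
        (\<Sum>\<beta>\<in>{\<beta>. \<beta> \<le> \<alpha>}. t \<alpha> \<beta> * (\<Prod>i\<in>UNIV. real (n i) ^ \<beta> i)))"
      unfolding binsum_def binom_def t_def
      by (intro sum.cong refl arg_cong2[of _ _ _ _ "(*)"] prod_change_basis choose_conv_powers)
    also have "\<dots> = (\<Sum>\<alpha>\<in>degree_below (Suc s). b \<alpha> *
        (\<Sum>\<beta>\<in>degree_below (Suc s). t \<alpha> \<beta> * (\<Prod>i\<in>UNIV. real (n i) ^ \<beta> i)))"
      using below t0
      by (intro sum.cong refl arg_cong2[of _ _ _ _ "(*)"] sum.mono_neutral_left) auto
    also have "\<dots> = (\<Sum>\<beta>\<in>degree_below (Suc s). c \<beta> * (\<Prod>i\<in>UNIV. real (n i) ^ \<beta> i))"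
      unfolding c_def sum_distrib_left sum_distrib_right
      by (subst sum.swap) (simp add: mult_ac)
    also have "\<dots> = monom_sum c n"
      unfolding monom_sum_def using supp by (intro sum.mono_neutral_right) auto
    finally show ?thesis by simp
  qed
  fix k :: "'d \<Rightarrow> nat" assume k: "sum k UNIV = s"
  have "c k = (\<Sum>\<alpha>\<in>{k}. b \<alpha> * t \<alpha> k)"
    unfolding c_def
  proof (rule sum.mono_neutral_right)
    show "\<forall>\<alpha>\<in>degree_below (Suc s) - {k}. b \<alpha> * t \<alpha> k = 0"
    proof
      fix \<alpha> assume \<alpha>: "\<alpha> \<in> degree_below (Suc s) - {k}"
      have "\<not> k \<le> \<alpha>"
      proof
        assume "k \<le> \<alpha>"
        then have "sum k UNIV < sum \<alpha> UNIV" using \<alpha> by (intro sum_strict_mono_fun) auto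
        then show False using \<alpha> k by (simp add: degree_below_def)
      qed
      then show "b \<alpha> * t \<alpha> k = 0" using t0 by simp
    qed
    qed (use k in \<open>auto simp: degree_below_def\<close>)
  then show "(\<Prod>i\<in>UNIV. fact (k i)) * c k = b k"
    by (simp add: t_def choose_coeff_diag prod_dividef)
qed

subsection \<open>Modules over a set of scalars\<close>

text \<open>The scalar set \<open>R\<close> is arbitrary: \<open>UNIV\<close> gives S-submodules,
  \<open>Sg 0\<close> gives the A-submodules that length counts, and in the basis theorem generators
  of S are adjoined to \<open>R\<close> one at a time.\<close>

definition submod :: "('a::comm_ring_1 \<Rightarrow> 'm::ab_group_add \<Rightarrow> 'm) \<Rightarrow> 'a set \<Rightarrow> 'm set \<Rightarrow> bool" where
  "submod sm R X \<longleftrightarrow> add_subgroup X \<and> (\<forall>a\<in>R. \<forall>x\<in>X. sm a x \<in> X)"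

definition ssum :: "'m::ab_group_add set \<Rightarrow> 'm set \<Rightarrow> 'm set" where
  "ssum X Y = {x + y | x y. x \<in> X \<and> y \<in> Y}"

lemma ssumI: "x \<in> X \<Longrightarrow> y \<in> Y \<Longrightarrow> x + y \<in> ssum X Y"
  by (auto simp: ssum_def)

lemma add_subgroupD:
  assumes "add_subgroup X"
  shows "0 \<in> X" "x \<in> X \<Longrightarrow> y \<in> X \<Longrightarrow> x + y \<in> X" "x \<in> X \<Longrightarrow> - x \<in> X"
    "x \<in> X \<Longrightarrow> y \<in> X \<Longrightarrow> x - y \<in> X"
  using assms unfolding add_subgroup_def by auto (metis diff_conv_add_uminus)

lemma submodD:
  assumes "submod sm R X"
  shows "0 \<in> X" "x \<in> X \<Longrightarrow> y \<in> X \<Longrightarrow> x + y \<in> X" "x \<in> X \<Longrightarrow> - x \<in> X"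
    "x \<in> X \<Longrightarrow> y \<in> X \<Longrightarrow> x - y \<in> X" "a \<in> R \<Longrightarrow> x \<in> X \<Longrightarrow> sm a x \<in> X"
  using assms add_subgroupD[of X] unfolding submod_def by auto

lemma submodI:
  assumes "0 \<in> X" "\<And>x y. x \<in> X \<Longrightarrow> y \<in> X \<Longrightarrow> x + y \<in> X" "\<And>x. x \<in> X \<Longrightarrow> - x \<in> X"
    "\<And>a x. a \<in> R \<Longrightarrow> x \<in> X \<Longrightarrow> sm a x \<in> X"
  shows "submod sm R X"
  using assms unfolding submod_def add_subgroup_def by auto

lemma submod_sum:
  assumes "submod sm R X" "\<And>i. i \<in> I \<Longrightarrow> f i \<in> X"
  shows "sum f I \<in> X"
  using assms(2) by (induction I rule: infinite_finite_induct) (auto simp: submodD[OF assms(1)])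

lemma submod_Int: "submod sm R X \<Longrightarrow> submod sm R Y \<Longrightarrow> submod sm R (X \<inter> Y)"
  by (auto simp: submod_def add_subgroup_def)

lemma submod_Union_chain:
  assumes "C \<noteq> {}" "\<And>X. X \<in> C \<Longrightarrow> submod sm R X" "\<And>X Y. X \<in> C \<Longrightarrow> Y \<in> C \<Longrightarrow> X \<subseteq> Y \<or> Y \<subseteq> X"
  shows "submod sm R (\<Union>C)"
proof (rule submodI)
  show "0 \<in> \<Union>C" using assms(1,2) submodD(1) by blast
  show "- x \<in> \<Union>C" if "x \<in> \<Union>C" for x using that assms(2) submodD(3) by blast
  fix x y assume "x \<in> \<Union>C" "y \<in> \<Union>C"
  then obtain X where "X \<in> C" "x \<in> X" "y \<in> X" using assms(3) by blast
  then show "x + y \<in> \<Union>C" using submodD(2)[OF assms(2), of X x y] by blast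
next
  fix r x assume r: "r \<in> R" and x: "x \<in> \<Union>C"
  obtain X where X: "X \<in> C" "x \<in> X" using x by blast
  then show "sm r x \<in> \<Union>C" using submodD(5)[OF assms(2) r, of X x] by blast
qed

lemma is_moduleD:
  assumes "is_module sm"
  shows "sm 1 m = m" "sm (a * b) m = sm a (sm b m)" "sm (a + b) m = sm a m + sm b m"
    "sm a (x + y) = sm a x + sm a y"
  using assms unfolding is_module_def by auto

lemma is_module_mult: "is_module ((*) :: 'a::comm_ring_1 \<Rightarrow> _)"
  by (simp add: is_module_def algebra_simps)

locale act =
  fixes sm :: "'a::comm_ring_1 \<Rightarrow> 'm::ab_group_add \<Rightarrow> 'm"
  assumes is_module: "is_module sm"
begin

lemmas sm_simps = is_moduleD[OF is_module]

lemma sm_zero_right [simp]: "sm a 0 = 0"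
  using sm_simps(4)[of a 0 0] by simp

lemma sm_zero_left [simp]: "sm 0 x = 0"
  using sm_simps(3)[of 0 0 x] by simp

lemma sm_minus_right: "sm a (- x) = - sm a x"
  using sm_simps(4)[of a x "- x"] by (simp add: eq_neg_iff_add_eq_0 add.commute)

lemma sm_minus_left: "sm (- a) x = - sm a x"
  using sm_simps(3)[of a "- a" x] by (simp add: eq_neg_iff_add_eq_0 add.commute)

lemma sm_diff_left: "sm (a - b) x = sm a x - sm b x"
  using sm_simps(3)[of a "- b" x] by (simp add: sm_minus_left)

lemma sm_sum_right: "sm a (sum f I) = (\<Sum>i\<in>I. sm a (f i))"
  by (induction I rule: infinite_finite_induct) (simp_all add: sm_simps)

lemma sm_sum_left: "sm (sum f I) x = (\<Sum>i\<in>I. sm (f i) x)"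
  by (induction I rule: infinite_finite_induct) (simp_all add: sm_simps)

lemma sm_commute: "sm a (sm b x) = sm b (sm a x)"
  by (metis mult.commute sm_simps(2))

lemma submod_ssum:
  assumes "submod sm R X" "submod sm R Y"
  shows "submod sm R (ssum X Y)"
proof (rule submodI)
  show "0 \<in> ssum X Y" using ssumI[of 0 X 0 Y] assms submodD(1) by fastforce
next
  fix x y assume "x \<in> ssum X Y" "y \<in> ssum X Y"
  then obtain a b c d where *: "x = a + b" "y = c + d" "a \<in> X" "c \<in> X" "b \<in> Y" "d \<in> Y"
    unfolding ssum_def by blast
  then have "x + y = (a + c) + (b + d)" by simp
  then show "x + y \<in> ssum X Y" using * assms by (metis ssumI submodD(2))
next
  fix x assume "x \<in> ssum X Y"
  then obtain a b where *: "x = a + b" "a \<in> X" "b \<in> Y" unfolding ssum_def by blast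
  then have "- x = - a + - b" by simp
  then show "- x \<in> ssum X Y" using * assms by (metis ssumI submodD(3))
next
  fix r x assume "r \<in> R" "x \<in> ssum X Y"
  moreover from this obtain a b where *: "x = a + b" "a \<in> X" "b \<in> Y" unfolding ssum_def by blast
  ultimately show "sm r x \<in> ssum X Y" using assms by (metis ssumI submodD(5) sm_simps(4))
qed

end

lemma ssum_upper1: "0 \<in> Y \<Longrightarrow> X \<subseteq> ssum X Y"
  by (auto simp: ssum_def) (metis add.right_neutral)

lemma ssum_upper2: "0 \<in> X \<Longrightarrow> Y \<subseteq> ssum X Y"
  by (auto simp: ssum_def) (metis add.left_neutral)

lemma ssum_least: "submod sm R Z \<Longrightarrow> X \<subseteq> Z \<Longrightarrow> Y \<subseteq> Z \<Longrightarrow> ssum X Y \<subseteq> Z"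
  by (auto simp: ssum_def intro: submodD)

subsection \<open>Length\<close>

definition chain_between :: "('a::comm_ring_1 \<Rightarrow> 'm::ab_group_add \<Rightarrow> 'm) \<Rightarrow> 'a set \<Rightarrow> 'm set \<Rightarrow> 'm set \<Rightarrow> nat \<Rightarrow> bool" where
  "chain_between sm R X Y k \<longleftrightarrow> (\<exists>L::nat \<Rightarrow> 'm set.
     (\<forall>i\<le>k. submod sm R (L i) \<and> X \<subseteq> L i \<and> L i \<subseteq> Y) \<and> (\<forall>i<k. L i \<subset> L (Suc i)))"

definition fin_len :: "('a::comm_ring_1 \<Rightarrow> 'm::ab_group_add \<Rightarrow> 'm) \<Rightarrow> 'a set \<Rightarrow> 'm set \<Rightarrow> 'm set \<Rightarrow> bool" where
  "fin_len sm R X Y \<longleftrightarrow> (\<exists>b. \<forall>k. chain_between sm R X Y k \<longrightarrow> k \<le> b)"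

text \<open>Under \<open>fin_len\<close> this is the length of Y/X. Without a bound on the chains
  GREATEST carries no information, which is why additivity asks for \<open>fin_len\<close>.\<close>

definition len :: "('a::comm_ring_1 \<Rightarrow> 'm::ab_group_add \<Rightarrow> 'm) \<Rightarrow> 'a set \<Rightarrow> 'm set \<Rightarrow> 'm set \<Rightarrow> nat" where
  "len sm R X Y = (GREATEST k. chain_between sm R X Y k)"

lemma chain_between_0: "submod sm R X \<Longrightarrow> X \<subseteq> Y \<Longrightarrow> chain_between sm R X Y 0"
  unfolding chain_between_def by (intro exI[of _ "\<lambda>_. X"]) auto

lemma chain_between_mono:
  "chain_between sm R X Y k \<Longrightarrow> X' \<subseteq> X \<Longrightarrow> Y \<subseteq> Y' \<Longrightarrow> chain_between sm R X' Y' k"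
  unfolding chain_between_def by (elim ex_forward) (meson order_trans)

lemma chain_between_Suc:
  assumes "chain_between sm R X Y k" "submod sm R Z" "Y \<subset> Z" "X \<subseteq> Y"
  shows "chain_between sm R X Z (Suc k)"
proof -
  obtain L where L: "\<And>i. i \<le> k \<Longrightarrow> submod sm R (L i) \<and> X \<subseteq> L i \<and> L i \<subseteq> Y"
    "\<And>i. i < k \<Longrightarrow> L i \<subset> L (Suc i)"
    using assms(1) unfolding chain_between_def by blast
  have "submod sm R ((L(Suc k := Z)) i) \<and> X \<subseteq> (L(Suc k := Z)) i \<and> (L(Suc k := Z)) i \<subseteq> Z" if "i \<le> Suc k" for i
    using that L(1)[of i] assms by (cases "i = Suc k") auto
  moreover have "(L(Suc k := Z)) i \<subset> (L(Suc k := Z)) (Suc i)" if "i < Suc k" for i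
    using that L(1)[of k] L(2)[of i] assms by (cases "i = k") auto
  ultimately show ?thesis unfolding chain_between_def by (intro exI[of _ "L(Suc k := Z)"]) blast
qed

lemma chain_between_append:
  assumes "chain_between sm R X Y k" "chain_between sm R Y Z l" "X \<subseteq> Y" "Y \<subseteq> Z"
  shows "chain_between sm R X Z (k + l)"
proof -
  obtain K where K: "\<And>i. i \<le> k \<Longrightarrow> submod sm R (K i) \<and> X \<subseteq> K i \<and> K i \<subseteq> Y"
    "\<And>i. i < k \<Longrightarrow> K i \<subset> K (Suc i)"
    using assms(1) unfolding chain_between_def by blast
  obtain L where L: "\<And>i. i \<le> l \<Longrightarrow> submod sm R (L i) \<and> Y \<subseteq> L i \<and> L i \<subseteq> Z"
    "\<And>i. i < l \<Longrightarrow> L i \<subset> L (Suc i)"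
    using assms(2) unfolding chain_between_def by blast
  \<comment> \<open>\<open>L 0\<close> is left out: \<open>K k\<close> and \<open>L 0\<close> may
    coincide, and strictness at the junction is inherited from the inclusion of \<open>L 0\<close>
    in \<open>L 1\<close>.\<close>
  define M where "M = (\<lambda>i. if i \<le> k then K i else L (i - k))"
  have "submod sm R (M i) \<and> X \<subseteq> M i \<and> M i \<subseteq> Z" if "i \<le> k + l" for i
  proof (cases "i \<le> k")
    case True
    then show ?thesis using K(1)[of i] assms(4) by (auto simp: M_def)
  next
    case False
    then have "i - k \<le> l" using that by simp
    then show ?thesis using False L(1)[of "i - k"] assms(3) by (auto simp: M_def)
  qed
  moreover have "M i \<subset> M (Suc i)" if i: "i < k + l" for i
  proof -
    consider "i < k" | "i = k" | "i > k" by linarith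
    then show ?thesis
    proof cases
      case 2
      then show ?thesis using i K(1)[of k] L(1)[of 0] L(2)[of 0] by (auto simp: M_def)
    next
      case 3
      then show ?thesis using i L(2)[of "i - k"] by (simp add: M_def Suc_diff_le)
    qed (use K(2)[of i] in \<open>simp add: M_def\<close>)
  qed
  ultimately show ?thesis unfolding chain_between_def by (intro exI[of _ M]) blast
qed

lemma len_props:
  assumes "fin_len sm R X Y" "submod sm R X" "X \<subseteq> Y"
  shows "chain_between sm R X Y (len sm R X Y)"
    and "chain_between sm R X Y k \<Longrightarrow> k \<le> len sm R X Y"
proof -
  obtain b where b: "\<And>k. chain_between sm R X Y k \<Longrightarrow> k \<le> b"
    using assms(1) unfolding fin_len_def by blast
  show "chain_between sm R X Y (len sm R X Y)"
    unfolding len_def using chain_between_0[OF assms(2,3)] b by (rule GreatestI_nat)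
  show "k \<le> len sm R X Y" if "chain_between sm R X Y k"
    unfolding len_def using that b by (rule Greatest_le_nat)
qed

lemma len_eqI:
  assumes "chain_between sm R X Y l" "\<And>k. chain_between sm R X Y k \<Longrightarrow> k \<le> l"
  shows "fin_len sm R X Y \<and> len sm R X Y = l"
  unfolding fin_len_def len_def using assms Greatest_equality[of "chain_between sm R X Y" l] by blast

text \<open>By the modular law a strict inclusion stays strict after intersecting with, or after adding,
  a fixed submodule.\<close>

lemma (in act) chain_between_split:
  assumes "chain_between sm R X Z k" "submod sm R X" "submod sm R Y" "submod sm R Z" "X \<subseteq> Y" "Y \<subseteq> Z"
  shows "\<exists>k1 k2. k \<le> k1 + k2 \<and> chain_between sm R X Y k1 \<and> chain_between sm R Y Z k2"
proof -
  obtain L where L: "\<And>i. i \<le> k \<Longrightarrow> submod sm R (L i) \<and> X \<subseteq> L i \<and> L i \<subseteq> Z"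
    "\<And>i. i < k \<Longrightarrow> L i \<subset> L (Suc i)"
    using assms(1) unfolding chain_between_def by blast
  \<comment> \<open>\<open>k1\<close> grows at the steps where the trace on \<open>Y\<close> grows
    and \<open>k2\<close> at all the others, so no step of the chain is lost.\<close>
  have "\<exists>k1 k2. j \<le> k1 + k2 \<and> chain_between sm R X (L j \<inter> Y) k1 \<and> chain_between sm R Y (ssum (L j) Y) k2"
    if "j \<le> k" for j
    using that
  proof (induction j)
    case 0
    have "chain_between sm R X (L 0 \<inter> Y) 0" "chain_between sm R Y (ssum (L 0) Y) 0"
      using L(1)[of 0] assms by (auto intro!: chain_between_0 ssum_upper2[THEN subsetD] dest: submodD(1))
    then show ?case by blast
  next
    case (Suc j)
    then obtain k1 k2 where k: "j \<le> k1 + k2" "chain_between sm R X (L j \<inter> Y) k1"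
      "chain_between sm R Y (ssum (L j) Y) k2" by auto
    have sub: "submod sm R (L j)" "submod sm R (L (Suc j))" "X \<subseteq> L j" "X \<subseteq> L (Suc j)"
      using L(1)[of j] L(1)[of "Suc j"] Suc.prems by auto
    have lt: "L j \<subset> L (Suc j)" using L(2) Suc.prems by simp
    have le2: "ssum (L j) Y \<subseteq> ssum (L (Suc j)) Y" using lt by (auto simp: ssum_def)
    show ?case
    proof (cases "L j \<inter> Y = L (Suc j) \<inter> Y")
      case False
      then have "L j \<inter> Y \<subset> L (Suc j) \<inter> Y" using lt by blast
      then have "chain_between sm R X (L (Suc j) \<inter> Y) (Suc k1)"
        using k(2) sub assms by (intro chain_between_Suc[of _ _ _ "L j \<inter> Y"]) (auto intro: submod_Int)
      moreover have "chain_between sm R Y (ssum (L (Suc j)) Y) k2"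
        using k(3) le2 by (rule chain_between_mono[OF _ order_refl])
      ultimately show ?thesis using k(1) by (intro exI[of _ "Suc k1"] exI[of _ k2]) simp
    next
      case True
      have "ssum (L j) Y \<noteq> ssum (L (Suc j)) Y"
      proof
        assume eq: "ssum (L j) Y = ssum (L (Suc j)) Y"
        obtain x where x: "x \<in> L (Suc j)" "x \<notin> L j" using lt by blast
        then have "x \<in> ssum (L j) Y"
          unfolding eq using ssum_upper1[of Y "L (Suc j)"] submodD(1)[OF assms(3)] by blast
        then obtain u y where uy: "x = u + y" "u \<in> L j" "y \<in> Y" unfolding ssum_def by blast
        have "x - u \<in> L (Suc j)" using x(1) uy(2) lt by (intro submodD(4)[OF sub(2)]) auto
        then have "y \<in> L j" using uy True by auto
        then show False using x uy submodD(2)[OF sub(1)] by blast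
      qed
      then have "ssum (L j) Y \<subset> ssum (L (Suc j)) Y" using le2 by blast
      then have "chain_between sm R Y (ssum (L (Suc j)) Y) (Suc k2)"
        using k(3) sub assms
        by (intro chain_between_Suc[of _ _ _ "ssum (L j) Y"] submod_ssum ssum_upper2) (auto dest: submodD(1))
      moreover have "chain_between sm R X (L (Suc j) \<inter> Y) k1"
        using k(2) True by simp
      ultimately show ?thesis using k(1) by (intro exI[of _ k1] exI[of _ "Suc k2"]) simp
    qed
  qed
  from this[of k] obtain k1 k2 where k: "k \<le> k1 + k2" "chain_between sm R X (L k \<inter> Y) k1"
    "chain_between sm R Y (ssum (L k) Y) k2" by auto
  have "ssum (L k) Y \<subseteq> Z" using L(1)[of k] assms by (intro ssum_least[of sm R]) auto
  then have "chain_between sm R X Y k1" "chain_between sm R Y Z k2"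
    using k chain_between_mono[of sm R X _ k1 X Y] chain_between_mono[of sm R Y _ k2 Y Z] by blast+
  then show ?thesis using k(1) by blast
qed

context act
begin

text \<open>Appending maximal chains gives one inequality, splitting an arbitrary chain at
  \<open>Y\<close> the other.\<close>

lemma len_add:
  assumes "submod sm R X" "submod sm R Y" "submod sm R Z" "X \<subseteq> Y" "Y \<subseteq> Z"
    and fin: "fin_len sm R X Y" "fin_len sm R Y Z"
  shows "fin_len sm R X Z \<and> len sm R X Z = len sm R X Y + len sm R Y Z"
proof (rule len_eqI)
  show "chain_between sm R X Z (len sm R X Y + len sm R Y Z)"
    using assms by (intro chain_between_append[of sm R X Y] len_props)
  fix k assume "chain_between sm R X Z k"
  then obtain k1 k2 where "k \<le> k1 + k2" "chain_between sm R X Y k1" "chain_between sm R Y Z k2"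
    using chain_between_split assms by metis
  then show "k \<le> len sm R X Y + len sm R Y Z"
    using len_props(2)[OF fin(1), of k1] len_props(2)[OF fin(2), of k2] assms by linarith
qed

end

lemma fin_len_mono: "fin_len sm R X Y \<Longrightarrow> X \<subseteq> X' \<Longrightarrow> Y' \<subseteq> Y \<Longrightarrow> fin_len sm R X' Y'"
  unfolding fin_len_def using chain_between_mono by blast

lemma chain_between_refl: "chain_between sm R X X k \<Longrightarrow> k = 0"
  unfolding chain_between_def by (metis le0 less_eq_Suc_le neq0_conv psubset_eq subset_antisym)

lemma fin_len_refl: "fin_len sm R X X"
  unfolding fin_len_def using chain_between_refl by (metis le0)

lemma len_refl: "submod sm R X \<Longrightarrow> len sm R X X = 0"
  using len_props(1)[OF fin_len_refl] chain_between_refl by blast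

lemma len_eq_0D:
  assumes "fin_len sm R X Y" "submod sm R X" "submod sm R Y" "X \<subseteq> Y" "len sm R X Y = 0"
  shows "X = Y"
proof (rule ccontr)
  assume "X \<noteq> Y"
  then have "chain_between sm R X Y (Suc 0)"
    using assms chain_between_0[of sm R X X] by (intro chain_between_Suc[of sm R X X 0 Y]) auto
  then show False using len_props(2)[OF assms(1,2,4)] assms(5) by fastforce
qed

text \<open>The isomorphism theorem on the level of chains: \<open>L\<close> corresponds to X +
  \<phi>(L), with inverse the preimage intersected with \<open>Y\<close>. Two module types are
  allowed because \<phi> will be a \<mapsto> a w from the ring to the module as well as
  multiplication by a scalar on the module.\<close>

lemma chain_between_iso:
  fixes sm :: "'a::comm_ring_1 \<Rightarrow> 'm::ab_group_add \<Rightarrow> 'm"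
    and sm' :: "'a \<Rightarrow> 'n::ab_group_add \<Rightarrow> 'n"
  assumes mod: "is_module sm" "is_module sm'"
    and add: "\<And>x y. \<phi> (x + y) = \<phi> x + \<phi> y"
    and lin: "\<And>a x. a \<in> R \<Longrightarrow> \<phi> (sm a x) = sm' a (\<phi> x)"
    and Y: "submod sm R Y" and X: "submod sm' R X"
  shows "chain_between sm R (Y \<inter> \<phi> -` X) Y k \<longleftrightarrow> chain_between sm' R X (ssum X (\<phi> ` Y)) k"
proof
  interpret m: act sm using mod(1) by unfold_locales
  interpret m': act sm' using mod(2) by unfold_locales
  have zero: "\<phi> 0 = 0" using add[of 0 0] by simp
  have neg: "\<phi> (- x) = - \<phi> x" for x using add[of x "- x"] zero by (simp add: eq_neg_iff_add_eq_0 add.commute)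
  have diff: "\<phi> (x - y) = \<phi> x - \<phi> y" for x y using add[of x "- y"] neg by simp
  have img: "submod sm' R (\<phi> ` L)" if "submod sm R L" for L
  proof (rule submodI)
    show "0 \<in> \<phi> ` L" using submodD(1)[OF that] zero by force
  qed (use submodD[OF that] in \<open>auto simp flip: add neg lin\<close>)
  have pre: "submod sm R (Y \<inter> \<phi> -` L)" if "submod sm' R L" for L
    by (rule submodI) (use submodD[OF that] submodD[OF Y] zero in \<open>auto simp: add neg lin\<close>)
  {
    assume "chain_between sm R (Y \<inter> \<phi> -` X) Y k"
    then obtain L where L: "\<And>i. i \<le> k \<Longrightarrow> submod sm R (L i) \<and> Y \<inter> \<phi> -` X \<subseteq> L i \<and> L i \<subseteq> Y"
      "\<And>i. i < k \<Longrightarrow> L i \<subset> L (Suc i)"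
      unfolding chain_between_def by blast
    have "submod sm' R (ssum X (\<phi> ` L i)) \<and> X \<subseteq> ssum X (\<phi> ` L i) \<and> ssum X (\<phi> ` L i) \<subseteq> ssum X (\<phi> ` Y)"
      if "i \<le> k" for i
    proof (intro conjI)
      have Li: "submod sm R (L i)" "L i \<subseteq> Y" using L that by auto
      show "submod sm' R (ssum X (\<phi> ` L i))" using X img[OF Li(1)] by (rule m'.submod_ssum)
      show "X \<subseteq> ssum X (\<phi> ` L i)" using submodD(1)[OF img[OF Li(1)]] by (rule ssum_upper1)
      show "ssum X (\<phi> ` L i) \<subseteq> ssum X (\<phi> ` Y)" using Li(2) unfolding ssum_def by blast
    qed
    moreover have "ssum X (\<phi> ` L i) \<subset> ssum X (\<phi> ` L (Suc i))" if "i < k" for i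
    proof
      have lt: "L i \<subset> L (Suc i)" using L(2) that .
      show "ssum X (\<phi> ` L i) \<subseteq> ssum X (\<phi> ` L (Suc i))" using lt unfolding ssum_def by blast
      obtain y where y: "y \<in> L (Suc i)" "y \<notin> L i" using lt by blast
      have Li: "submod sm R (L i)" "Y \<inter> \<phi> -` X \<subseteq> L i" "L i \<subseteq> Y" "L (Suc i) \<subseteq> Y"
        using L(1)[of i] L(1)[of "Suc i"] that by auto
      have "\<phi> y \<in> ssum X (\<phi> ` L (Suc i))" using y(1) ssum_upper2[OF submodD(1)[OF X]] by blast
      moreover have "\<phi> y \<notin> ssum X (\<phi> ` L i)"
      proof
        assume "\<phi> y \<in> ssum X (\<phi> ` L i)"
        then obtain x l where *: "\<phi> y = x + \<phi> l" "x \<in> X" "l \<in> L i" unfolding ssum_def by blast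
        then have "\<phi> (y - l) \<in> X" by (simp add: diff)
        moreover have "y - l \<in> Y" using y(1) *(3) Li by (intro submodD(4)[OF Y]) auto
        ultimately have "y - l \<in> L i" using Li by blast
        then have "y - l + l \<in> L i" using *(3) by (rule submodD(2)[OF Li(1)])
        then show False using y(2) by simp
      qed
      ultimately show "ssum X (\<phi> ` L i) \<noteq> ssum X (\<phi> ` L (Suc i))" by blast
    qed
    ultimately show "chain_between sm' R X (ssum X (\<phi> ` Y)) k"
      unfolding chain_between_def by (intro exI[of _ "\<lambda>i. ssum X (\<phi> ` L i)"]) blast
  next
    assume "chain_between sm' R X (ssum X (\<phi> ` Y)) k"
    then obtain L where L: "\<And>i. i \<le> k \<Longrightarrow> submod sm' R (L i) \<and> X \<subseteq> L i \<and> L i \<subseteq> ssum X (\<phi> ` Y)"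
      "\<And>i. i < k \<Longrightarrow> L i \<subset> L (Suc i)"
      unfolding chain_between_def by blast
    have "submod sm R (Y \<inter> \<phi> -` L i) \<and> Y \<inter> \<phi> -` X \<subseteq> Y \<inter> \<phi> -` L i \<and> Y \<inter> \<phi> -` L i \<subseteq> Y"
      if "i \<le> k" for i
      using L(1)[OF that] pre by auto
    moreover have "Y \<inter> \<phi> -` L i \<subset> Y \<inter> \<phi> -` L (Suc i)" if "i < k" for i
    proof
      have lt: "L i \<subset> L (Suc i)" using L(2) that .
      show "Y \<inter> \<phi> -` L i \<subseteq> Y \<inter> \<phi> -` L (Suc i)" using lt by blast
      obtain w where w: "w \<in> L (Suc i)" "w \<notin> L i" using lt by blast
      have Li: "submod sm' R (L i)" "submod sm' R (L (Suc i))" "X \<subseteq> L i" "X \<subseteq> L (Suc i)"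
        "L (Suc i) \<subseteq> ssum X (\<phi> ` Y)"
        using L(1)[of i] L(1)[of "Suc i"] that by auto
      then obtain x y where xy: "w = x + \<phi> y" "x \<in> X" "y \<in> Y" using w(1) unfolding ssum_def by blast
      then have "\<phi> y \<in> L (Suc i)" using submodD(4)[OF Li(2) w(1), of x] Li(4) by auto
      moreover have "\<phi> y \<notin> L i" using submodD(2)[OF Li(1), of x "\<phi> y"] xy Li(3) w(2) by auto
      ultimately show "Y \<inter> \<phi> -` L i \<noteq> Y \<inter> \<phi> -` L (Suc i)" using xy(3) by blast
    qed
    ultimately show "chain_between sm R (Y \<inter> \<phi> -` X) Y k"
      unfolding chain_between_def by (intro exI[of _ "\<lambda>i. Y \<inter> \<phi> -` L i"]) blast
  }
qed

lemma len_iso: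
  fixes sm :: "'a::comm_ring_1 \<Rightarrow> 'm::ab_group_add \<Rightarrow> 'm"
    and sm' :: "'a \<Rightarrow> 'n::ab_group_add \<Rightarrow> 'n"
  assumes "is_module sm" "is_module sm'"
    and "\<And>x y. \<phi> (x + y) = \<phi> x + \<phi> y"
    and "\<And>a x. a \<in> R \<Longrightarrow> \<phi> (sm a x) = sm' a (\<phi> x)"
    and "submod sm R Y" and "submod sm' R X"
  shows "fin_len sm R (Y \<inter> \<phi> -` X) Y \<longleftrightarrow> fin_len sm' R X (ssum X (\<phi> ` Y))"
    and "len sm R (Y \<inter> \<phi> -` X) Y = len sm' R X (ssum X (\<phi> ` Y))"
proof -
  have "chain_between sm R (Y \<inter> \<phi> -` X) Y = chain_between sm' R X (ssum X (\<phi> ` Y))"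
    using chain_between_iso[OF assms] by blast
  then show "fin_len sm R (Y \<inter> \<phi> -` X) Y \<longleftrightarrow> fin_len sm' R X (ssum X (\<phi> ` Y))"
    and "len sm R (Y \<inter> \<phi> -` X) Y = len sm' R X (ssum X (\<phi> ` Y))"
    unfolding fin_len_def len_def by simp_all
qed

lemma qlen_eq_len:
  assumes "fin_len sm (Sg 0) (N \<inter> Mg n) (Mg n)" "submod sm (Sg 0) (N \<inter> Mg n)"
  shows "qlen Sg sm Mg N n = enat (len sm (Sg 0) (N \<inter> Mg n) (Mg n))"
proof -
  have "qlen Sg sm Mg N n = Sup {enat k | k. chain_between sm (Sg 0) (N \<inter> Mg n) (Mg n) k}"
    unfolding qlen_def chain_between_def A_submodule_def submod_def by simp
  also have "\<dots> = enat (len sm (Sg 0) (N \<inter> Mg n) (Mg n))"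
    using len_props[OF assms] by (intro Sup_eqI) auto
  finally show ?thesis .
qed

subsection \<open>Noetherian modules\<close>

definition noeth :: "('a::comm_ring_1 \<Rightarrow> 'm::ab_group_add \<Rightarrow> 'm) \<Rightarrow> 'a set \<Rightarrow> 'm set \<Rightarrow> bool" where
  "noeth sm R V \<longleftrightarrow> (\<forall>J::nat \<Rightarrow> 'm set. (\<forall>j. submod sm R (J j) \<and> J j \<subseteq> V \<and> J j \<subseteq> J (Suc j))
     \<longrightarrow> (\<exists>N. \<forall>j\<ge>N. J j = J N))"

lemma noethD:
  assumes "noeth sm R V" "\<And>j. submod sm R (J j)" "\<And>j. J j \<subseteq> V" "\<And>j. J j \<subseteq> J (Suc j)"
  obtains N where "\<And>j. j \<ge> N \<Longrightarrow> J j = J N"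
  using assms(1)[unfolded noeth_def, THEN spec[of _ J]] assms(2-4) that by auto

lemma noeth_mono:
  assumes "noeth sm R V" "R \<subseteq> R'" "V' \<subseteq> V"
  shows "noeth sm R' V'"
  unfolding noeth_def
proof (intro allI impI)
  fix J assume J: "\<forall>j. submod sm R' (J j) \<and> J j \<subseteq> V' \<and> J j \<subseteq> J (Suc j)"
  have "submod sm R (J j)" for j using J assms(2) by (auto simp: submod_def)
  moreover have "J j \<subseteq> V" for j using J assms(3) by blast
  ultimately obtain N where "\<And>j. j \<ge> N \<Longrightarrow> J j = J N"
    using J noethD[OF assms(1), of J] by blast
  then show "\<exists>N. \<forall>j\<ge>N. J j = J N" by blast
qed

lemma noeth_maximal:
  assumes V: "noeth sm R V" and F: "X0 \<in> F" "\<And>X. X \<in> F \<Longrightarrow> submod sm R X \<and> X \<subseteq> V"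
  shows "\<exists>X\<in>F. \<forall>Y\<in>F. \<not> X \<subset> Y"
proof (rule ccontr)
  assume "\<not> ?thesis"
  then have "\<forall>X. X \<in> F \<longrightarrow> (\<exists>Y. Y \<in> F \<and> X \<subset> Y)" by blast
  then obtain g where g: "\<And>X. X \<in> F \<Longrightarrow> g X \<in> F \<and> X \<subset> g X" by metis
  have inF: "(g ^^ j) X0 \<in> F" for j by (induction j) (use F g in auto)
  obtain N where "\<And>j. j \<ge> N \<Longrightarrow> (g ^^ j) X0 = (g ^^ N) X0"
  proof (rule noethD[OF V, of "\<lambda>j. (g ^^ j) X0"])
    show "(g ^^ j) X0 \<subseteq> (g ^^ Suc j) X0" for j using g inF by auto
  qed (use F inF in auto)
  from this[of "Suc N"] show False using g[OF inF[of N]] by auto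
qed

lemma mono_bounded_nat_stabilizes:
  assumes "\<And>j. f j \<le> f (Suc j)" "\<And>j. f j \<le> (b :: nat)"
  obtains N where "\<And>j. j \<ge> N \<Longrightarrow> f j = f N"
proof -
  obtain N where N: "\<And>j. f j \<le> f N"
    using ex_has_greatest_nat[of "\<lambda>_. True" 0 f "Suc b"] assms(2) by (auto simp: less_Suc_eq_le)
  have "f N \<le> f j" if "N \<le> j" for j using lift_Suc_mono_le[of f, OF assms(1) that] .
  then show thesis using that[of N] N by (simp add: dual_order.antisym)
qed

context act
begin

text \<open>Lengths along an ascending chain are monotone and bounded by that of \<open>V\<close>;
  once they are constant, the successive quotients have length 0.\<close>

lemma noeth_fin_len:
  assumes "fin_len sm R {0} V" "submod sm R V"
  shows "noeth sm R V"
  unfolding noeth_def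
proof (intro allI impI)
  fix J assume J: "\<forall>j. submod sm R (J j) \<and> J j \<subseteq> V \<and> J j \<subseteq> J (Suc j)"
  have z: "submod sm R {0}" by (rule submodI) auto
  have J': "submod sm R (J j)" "J j \<subseteq> V" "J j \<subseteq> J (Suc j)" for j using J by auto
  have fin: "fin_len sm R {0} (J j)" "submod sm R (J j)" "{0} \<subseteq> J j" for j
    using fin_len_mono[OF assms(1) order_refl J'(2)] J'(1) submodD(1)[OF J'(1)] by auto
  have fin': "fin_len sm R (J i) (J j)" for i j
    by (rule fin_len_mono[OF fin(1)[of j] fin(3) order_refl])
  have add: "len sm R {0} (J j) = len sm R {0} (J i) + len sm R (J i) (J j)" if "J i \<subseteq> J j" for i j
    using len_add[OF z fin(2)[of i] fin(2)[of j] fin(3) that fin(1) fin'] by blast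
  have "len sm R {0} (J j) \<le> len sm R {0} V" for j
  proof (rule len_props(2)[OF assms(1) z])
    show "{0} \<subseteq> V" using submodD(1)[OF assms(2)] by simp
    show "chain_between sm R {0} V (len sm R {0} (J j))"
      by (rule chain_between_mono[OF len_props(1)[OF fin(1) z fin(3)] order_refl J'(2)])
  qed
  moreover have "len sm R {0} (J j) \<le> len sm R {0} (J (Suc j))" for j using J add[of j "Suc j"] by simp
  ultimately obtain N where N: "\<And>j. j \<ge> N \<Longrightarrow> len sm R {0} (J j) = len sm R {0} (J N)"
    using mono_bounded_nat_stabilizes[of "\<lambda>j. len sm R {0} (J j)"] by metis
  have "J j = J N" if "j \<ge> N" for j
  proof -
    have le: "J N \<subseteq> J j" using lift_Suc_mono_le[of J, OF J'(3) that] .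
    then have "len sm R (J N) (J j) = 0" using add[OF le] N[OF that] by simp
    then show ?thesis using len_eq_0D[OF fin' fin(2) fin(2) le] by simp
  qed
  then show "\<exists>N. \<forall>j\<ge>N. J j = J N" by blast
qed

text \<open>The leading coefficients of degree \<open>d\<close> of \<open>J\<close> are the \<open>v \<in> V\<close> such that
  \<open>J\<close> contains an element \<open>g\<^sup>d v\<close> plus an element of \<open>poly_below g V d\<close>.\<close>

fun poly_below :: "'a \<Rightarrow> 'm set \<Rightarrow> nat \<Rightarrow> 'm set" where
  "poly_below g V 0 = {0}"
| "poly_below g V (Suc d) = ssum (sm (g ^ d) ` V) (poly_below g V d)"

definition lead_mod :: "'a \<Rightarrow> 'm set \<Rightarrow> 'm set \<Rightarrow> nat \<Rightarrow> 'm set" where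
  "lead_mod g V J d = {v\<in>V. \<exists>w\<in>poly_below g V d. sm (g ^ d) v + w \<in> J}"

lemma submod_image:
  assumes "submod sm R V"
  shows "submod sm R (sm a ` V)"
proof (rule submodI)
  show "0 \<in> sm a ` V" using submodD(1)[OF assms] by force
  fix r x assume "r \<in> R" "x \<in> sm a ` V"
  then obtain v where v: "x = sm a v" "v \<in> V" by blast
  then have "sm r x = sm a (sm r v)" by (simp add: sm_commute)
  then show "sm r x \<in> sm a ` V" using submodD(5)[OF assms \<open>r \<in> R\<close> v(2)] by blast
qed (use submodD[OF assms] in \<open>auto simp flip: sm_simps(4) sm_minus_right\<close>)

lemma submod_poly_below:
  assumes "submod sm R V"
  shows "submod sm R (poly_below g V d)"
proof (induction d)
  case 0
  show ?case by (rule submodI) auto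
qed (use assms in \<open>auto intro: submod_ssum submod_image\<close>)

lemma poly_below_mono:
  assumes "submod sm R V" "d \<le> e"
  shows "poly_below g V d \<subseteq> poly_below g V e"
proof (rule lift_Suc_mono_le[OF _ assms(2)])
  fix d show "poly_below g V d \<subseteq> poly_below g V (Suc d)"
    using submodD(1)[OF submod_image[OF assms(1)]] by (simp add: ssum_upper2)
qed

lemma poly_below_shift:
  assumes "submod sm R V" "w \<in> poly_below g V d"
  shows "sm g w \<in> poly_below g V (Suc d)"
  using assms(2)
proof (induction d arbitrary: w)
  case 0
  then show ?case using submodD(1)[OF submod_poly_below[OF assms(1)], of g "Suc 0"] by simp
next
  case (Suc d)
  then obtain v u where *: "w = sm (g ^ d) v + u" "v \<in> V" "u \<in> poly_below g V d"
    by (auto simp: ssum_def)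
  then have "sm g w = sm (g ^ Suc d) v + sm g u" by (simp add: sm_simps)
  moreover have "sm (g ^ Suc d) v \<in> sm (g ^ Suc d) ` V" using *(2) by (rule imageI)
  moreover have "sm g u \<in> poly_below g V (Suc d)" using *(3) by (rule Suc.IH)
  ultimately show ?case using ssumI poly_below.simps(2)[of g V "Suc d"] by metis
qed

lemma submod_lead_mod:
  assumes V: "submod sm R V" and J: "submod sm R J"
  shows "submod sm R (lead_mod g V J d)"
proof (rule submodI)
  note P = submodD[OF submod_poly_below[OF V, of g d]]
  show "0 \<in> lead_mod g V J d"
    unfolding lead_mod_def using submodD(1)[OF V] submodD(1)[OF J] P(1) by force
  fix x assume "x \<in> lead_mod g V J d"
  then obtain w where x: "x \<in> V" "w \<in> poly_below g V d" "sm (g ^ d) x + w \<in> J"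
    unfolding lead_mod_def by blast
  have "sm (g ^ d) (- x) + - w \<in> J" using submodD(3)[OF J x(3)] by (simp add: sm_minus_right)
  then show "- x \<in> lead_mod g V J d"
    unfolding lead_mod_def using P(3)[OF x(2)] submodD(3)[OF V x(1)] by blast
  show "sm r x \<in> lead_mod g V J d" if "r \<in> R" for r
  proof -
    have "sm (g ^ d) (sm r x) + sm r w \<in> J"
      using submodD(5)[OF J that x(3)] by (simp add: sm_simps sm_commute)
    then show ?thesis
      unfolding lead_mod_def using P(5)[OF that x(2)] submodD(5)[OF V that x(1)] by blast
  qed
  fix y assume "y \<in> lead_mod g V J d"
  then obtain u where y: "y \<in> V" "u \<in> poly_below g V d" "sm (g ^ d) y + u \<in> J"
    unfolding lead_mod_def by blast
  have "sm (g ^ d) (x + y) + (w + u) \<in> J"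
    using submodD(2)[OF J x(3) y(3)] by (simp add: sm_simps add_ac)
  then show "x + y \<in> lead_mod g V J d"
    unfolding lead_mod_def using P(2)[OF x(2) y(2)] submodD(2)[OF V x(1) y(1)] by blast
qed

lemma lead_mod_Suc:
  assumes V: "submod sm R V" and J: "submod sm (insert g R) J"
  shows "lead_mod g V J d \<subseteq> lead_mod g V J (Suc d)"
proof
  fix x assume "x \<in> lead_mod g V J d"
  then obtain w where x: "x \<in> V" "w \<in> poly_below g V d" "sm (g ^ d) x + w \<in> J"
    unfolding lead_mod_def by blast
  have "sm (g ^ Suc d) x + sm g w \<in> J"
    using submodD(5)[OF J insertI1 x(3)] by (simp add: sm_simps)
  then show "x \<in> lead_mod g V J (Suc d)"
    unfolding lead_mod_def using poly_below_shift[OF V x(2)] x(1) by blast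
qed

text \<open>Induction on the degree: an element of \<open>K\<close> is corrected by an element of
  \<open>J\<close> with the same leading coefficient, and the remainder lies in \<open>K\<close>
  with smaller degree.\<close>

lemma lead_mod_determines:
  assumes V: "submod sm R V" and J: "submod sm (insert g R) J" and K: "submod sm (insert g R) K"
    and JK: "J \<subseteq> K" and eq: "\<And>d. lead_mod g V K d \<subseteq> lead_mod g V J d"
    and sub: "K \<subseteq> (\<Union>d. poly_below g V d)"
  shows "J = K"
proof -
  have "K \<inter> poly_below g V d \<subseteq> J" for d
  proof (induction d)
    case 0
    then show ?case using submodD(1)[OF J] by auto
  next
    case (Suc d)
    show ?case
    proof
      fix x assume x: "x \<in> K \<inter> poly_below g V (Suc d)"
      then obtain v w where vw: "x = sm (g ^ d) v + w" "v \<in> V" "w \<in> poly_below g V d"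
        by (auto simp: ssum_def)
      then have "v \<in> lead_mod g V K d" using x unfolding lead_mod_def by blast
      then obtain u where u: "u \<in> poly_below g V d" "sm (g ^ d) v + u \<in> J"
        using eq[of d] unfolding lead_mod_def by blast
      have "x - (sm (g ^ d) v + u) \<in> K" using x u JK by (intro submodD(4)[OF K]) auto
      moreover have diff: "x - (sm (g ^ d) v + u) = w - u" using vw(1) by simp
      moreover have "w - u \<in> poly_below g V d"
        using vw(3) u(1) by (rule submodD(4)[OF submod_poly_below[OF V]])
      ultimately have "x - (sm (g ^ d) v + u) \<in> J" using Suc unfolding diff by blast
      then have "x - (sm (g ^ d) v + u) + (sm (g ^ d) v + u) \<in> J" using u(2) by (rule submodD(2)[OF J])
      then show "x \<in> J" by simp
    qed
  qed
  then show ?thesis using JK sub by blast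
qed

text \<open>The inductive step of the basis theorem, carried out for the sum of all g^d V inside the
  given module instead of for a polynomial extension. A chain of submodules is controlled by its
  leading modules, which ascend both along the chain and with the degree.\<close>

lemma noeth_adjoin:
  assumes V: "submod sm R V" and noeth: "noeth sm R V"
  shows "noeth sm (insert g R) (\<Union>d. poly_below g V d)"
  unfolding noeth_def
proof (intro allI impI)
  fix J :: "nat \<Rightarrow> 'm set"
  assume J: "\<forall>j. submod sm (insert g R) (J j) \<and> J j \<subseteq> (\<Union>d. poly_below g V d) \<and> J j \<subseteq> J (Suc j)"
  then have J1: "\<And>j. submod sm (insert g R) (J j)" and J2: "\<And>i j. i \<le> j \<Longrightarrow> J i \<subseteq> J j"
    and J3: "\<And>j. submod sm R (J j)"
    using lift_Suc_mono_le[of J] by (auto simp: submod_def)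
  have mono_j: "lead_mod g V (J i) d \<subseteq> lead_mod g V (J j) d" if "i \<le> j" for i j d
    using J2[OF that] unfolding lead_mod_def by blast
  have mono_d: "lead_mod g V (J i) d \<subseteq> lead_mod g V (J i) e" if "d \<le> e" for i d e
    using lift_Suc_mono_le[of "lead_mod g V (J i)", OF lead_mod_Suc[OF V J1] that] .
  \<comment> \<open>The diagonal of the double sequence stabilises at some \<open>N\<close>, which
    settles all degrees above \<open>N\<close> at once; the finitely many degrees up to
    \<open>N\<close> get their own bounds \<open>T d\<close>.\<close>
  obtain N where N: "\<And>j. j \<ge> N \<Longrightarrow> lead_mod g V (J j) j = lead_mod g V (J N) N"
  proof (rule noethD[OF noeth, of "\<lambda>j. lead_mod g V (J j) j"])
    show "lead_mod g V (J j) j \<subseteq> lead_mod g V (J (Suc j)) (Suc j)" for j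
      using mono_j[of j "Suc j" j] mono_d[of j "Suc j" "Suc j"] by simp
  qed (auto simp: lead_mod_def intro: submod_lead_mod[unfolded lead_mod_def, OF V J3])
  have in_V: "lead_mod g V (J j) d \<subseteq> V" for j d by (auto simp: lead_mod_def)
  have "\<exists>T. \<forall>j\<ge>T. lead_mod g V (J j) d = lead_mod g V (J T) d" for d
  proof (rule noethD[OF noeth, of "\<lambda>j. lead_mod g V (J j) d"])
    show "lead_mod g V (J j) d \<subseteq> lead_mod g V (J (Suc j)) d" for j by (rule mono_j) simp
  qed (use in_V submod_lead_mod[OF V J3] in auto)
  then obtain T where T: "\<And>d j. j \<ge> T d \<Longrightarrow> lead_mod g V (J j) d = lead_mod g V (J (T d)) d"
    by metis
  define B where "B = N + (\<Sum>d\<le>N. T d)"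
  have "J j = J B" if "j \<ge> B" for j
  proof -
    have "lead_mod g V (J j) d \<subseteq> lead_mod g V (J B) d" for d
    proof (cases "d \<le> N")
      case True
      then have "T d \<le> (\<Sum>d\<le>N. T d)" by (intro member_le_sum) auto
      then have "T d \<le> B" by (simp add: B_def)
      then show ?thesis using T[of d j] T[of d B] that by simp
    next
      case False
      have "lead_mod g V (J j) d \<subseteq> lead_mod g V (J (max j d)) (max j d)"
        using mono_j[of j "max j d" d] mono_d[of d "max j d" "max j d"] by auto
      also have "\<dots> = lead_mod g V (J N) N" using False by (intro N) auto
      also have "\<dots> \<subseteq> lead_mod g V (J B) d"
        using mono_j[of N B N] mono_d[of N d B] False by (auto simp: B_def)
      finally show ?thesis .
    qed
    then have "J B = J j"
      using J1 J2[OF that] J by (intro lead_mod_determines[OF V, of g]) auto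
    then show ?thesis by simp
  qed
  then show "\<exists>N. \<forall>j\<ge>N. J j = J N" by blast
qed

lemma submod_adjoin:
  assumes V: "submod sm R V"
  shows "submod sm (insert g R) (\<Union>d. poly_below g V d)"
proof (rule submodI)
  note P = submodD[OF submod_poly_below[OF V]]
  show "0 \<in> (\<Union>d. poly_below g V d)" using P(1) by blast
  show "- x \<in> (\<Union>d. poly_below g V d)" if "x \<in> (\<Union>d. poly_below g V d)" for x using that P(3) by blast
  show "sm a x \<in> (\<Union>d. poly_below g V d)" if a: "a \<in> insert g R" and x: "x \<in> (\<Union>d. poly_below g V d)" for a x
  proof -
    obtain d where d: "x \<in> poly_below g V d" using x by blast
    then show ?thesis
      using poly_below_shift[OF V d] P(5)[of a x g d] a by (cases "a = g") blast+
  qed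
  fix x y assume "x \<in> (\<Union>d. poly_below g V d)" "y \<in> (\<Union>d. poly_below g V d)"
  then obtain d e where "x \<in> poly_below g V d" "y \<in> poly_below g V e" by blast
  then have "x \<in> poly_below g V (max d e)" "y \<in> poly_below g V (max d e)"
    using poly_below_mono[OF V] by (meson max.cobounded1 max.cobounded2 subsetD)+
  then show "x + y \<in> (\<Union>d. poly_below g V d)" using P(2) by blast
qed

lemma subset_adjoin: "V \<subseteq> (\<Union>d. poly_below g V d)"
proof
  fix x assume "x \<in> V"
  then have "x \<in> poly_below g V (Suc 0)" by (force simp: ssum_def sm_simps)
  then show "x \<in> (\<Union>d. poly_below g V d)" by blast
qed

lemma noeth_adjoin_finite:
  assumes "finite G" "submod sm R V" "noeth sm R V"
  shows "\<exists>W. V \<subseteq> W \<and> submod sm (R \<union> G) W \<and> noeth sm (R \<union> G) W"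
  using assms
proof (induction G)
  case empty
  then show ?case by auto
next
  case (insert g G)
  then obtain W where W: "V \<subseteq> W" "submod sm (R \<union> G) W" "noeth sm (R \<union> G) W" by blast
  note submod_adjoin[OF W(2), of g] noeth_adjoin[OF W(2,3), of g]
  moreover have "V \<subseteq> (\<Union>d. poly_below g W d)" using W(1) subset_adjoin[of W g] by blast
  ultimately show ?case by (intro exI[of _ "\<Union>d. poly_below g W d"]) simp
qed

text \<open>Hilbert's basis theorem; \<open>V\<close> is the span over \<open>R\<close> of module generators.\<close>

lemma noeth_ring_gen:
  assumes "finite G" "ring_gen (R \<union> G) = UNIV" "submod sm R V" "noeth sm R V"
    and gen: "\<And>W. V \<subseteq> W \<Longrightarrow> submod sm UNIV W \<Longrightarrow> W = UNIV"
  shows "noeth sm UNIV UNIV"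
proof -
  obtain W where W: "V \<subseteq> W" "submod sm (R \<union> G) W" "noeth sm (R \<union> G) W"
    using noeth_adjoin_finite[OF assms(1,3,4)] by blast
  note D = submodD[OF W(2)]
  \<comment> \<open>The scalars that preserve \<open>W\<close> form a subring containing
    \<open>R\<close> and \<open>G\<close>, hence they are all scalars.\<close>
  have "ring_gen (R \<union> G) \<subseteq> {a. \<forall>x\<in>W. sm a x \<in> W}"
    unfolding ring_gen_def using D by (intro Inter_lower) (auto simp: sm_simps sm_minus_left)
  then have "submod sm UNIV W" using assms(2) D by (intro submodI) auto
  then have "W = UNIV" using gen W(1) by blast
  then show ?thesis using noeth_mono[OF W(3)] by simp
qed

text \<open>(X + R w)/X is a quotient of R, namely by the scalars that send \<open>w\<close> into
  \<open>X\<close>, so it inherits finite length from R. The leastness clause keeps the enlarged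
  submodule inside any submodule that contains \<open>X\<close> and \<open>w\<close>.\<close>

lemma fin_len_adjoin:
  fixes R :: "'a set"
  assumes R: "fin_len (*) R {0} R" "submod (*) R R" "1 \<in> R" and X: "submod sm R X" "fin_len sm R {0} X"
  obtains Y where "submod sm R Y" "fin_len sm R {0} Y" "X \<subseteq> Y" "w \<in> Y"
    "\<forall>Z. submod sm R Z \<and> X \<subseteq> Z \<and> w \<in> Z \<longrightarrow> Y \<subseteq> Z"
proof
  let ?Rw = "(\<lambda>a. sm a w) ` R" and ?Y = "ssum X ((\<lambda>a. sm a w) ` R)"
  have z: "submod sm R {0}" by (rule submodI) auto
  have Rw: "submod sm R ?Rw"
  proof (rule submodI)
    show "0 \<in> ?Rw" using submodD(1)[OF R(2)] by force
  qed (use submodD[OF R(2)] in \<open>auto simp flip: sm_simps(2,3) sm_minus_left\<close>)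
  show Y: "submod sm R ?Y" using X(1) Rw by (rule submod_ssum)
  show up: "X \<subseteq> ?Y" using submodD(1)[OF Rw] by (rule ssum_upper1)
  have "fin_len (*) R (R \<inter> (\<lambda>a. sm a w) -` X) R \<longleftrightarrow> fin_len sm R X ?Y"
    by (rule len_iso(1)[OF is_module_mult is_module]) (use R X in \<open>auto simp: sm_simps\<close>)
  moreover have "fin_len (*) R (R \<inter> (\<lambda>a. sm a w) -` X) R"
    by (rule fin_len_mono[OF R(1)]) (use submodD(1)[OF R(2)] submodD(1)[OF X(1)] in auto)
  ultimately show "fin_len sm R {0} ?Y"
    using len_add[OF z X(1) Y _ up X(2)] submodD(1)[OF X(1)] by blast
  have "w \<in> ?Rw" using R(3) by (auto intro!: image_eqI[of _ _ 1] simp: sm_simps)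
  then show "w \<in> ?Y" by (rule subsetD[OF ssum_upper2[OF submodD(1)[OF X(1)]]])
  show "\<forall>Z. submod sm R Z \<and> X \<subseteq> Z \<and> w \<in> Z \<longrightarrow> ?Y \<subseteq> Z"
    by (intro allI impI ssum_least[of sm R]) (auto simp: submodD)
qed

text \<open>Adjoining the module generators one at a time gives an R-submodule of finite length that
  contains them; it is noetherian over R, and the basis theorem passes from R to the whole
  ring.\<close>

lemma noeth_fin_gen:
  fixes R :: "'a set"
  assumes G: "finite G" "\<And>x. \<exists>c. x = (\<Sum>g\<in>G. sm (c g) g)"
    and H: "finite H" "ring_gen (R \<union> H) = UNIV"
    and R: "fin_len (*) R {0} R" "submod (*) R R" "1 \<in> R"
  shows "noeth sm UNIV UNIV"
proof -
  have "\<exists>V. submod sm R V \<and> fin_len sm R {0} V \<and> G \<subseteq> V"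
    using G(1)
  proof (induction G)
    case empty
    have "submod sm R {0}" by (rule submodI) auto
    then show ?case using fin_len_refl by blast
  next
    case (insert g G)
    then obtain V where V: "submod sm R V" "fin_len sm R {0} V" "G \<subseteq> V" by blast
    obtain Y where "submod sm R Y" "fin_len sm R {0} Y" "V \<subseteq> Y" "g \<in> Y"
      by (rule fin_len_adjoin[OF R V(1,2), of g])
    then show ?case using V(3) by (intro exI[of _ Y]) auto
  qed
  then obtain V where V: "submod sm R V" "fin_len sm R {0} V" "G \<subseteq> V" by blast
  show ?thesis
  proof (rule noeth_ring_gen[OF H V(1) noeth_fin_len[OF V(2,1)]])
    fix W assume W: "V \<subseteq> W" "submod sm UNIV W"
    have "x \<in> W" for x
    proof -
      obtain c where "x = (\<Sum>g\<in>G. sm (c g) g)" using G(2) by blast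
      moreover have "(\<Sum>g\<in>G. sm (c g) g) \<in> W"
        using V(3) W by (intro submod_sum[OF W(2)] submodD(5)[OF W(2)]) auto
      ultimately show ?thesis by simp
    qed
    then show "W = UNIV" by blast
  qed
qed

text \<open>A submodule maximal among those of finite length must be all of \<open>V\<close>, since
  one more element could be adjoined to it otherwise.\<close>

lemma fin_len_noeth:
  fixes R :: "'a set"
  assumes R: "fin_len (*) R {0} R" "submod (*) R R" "1 \<in> R" and V: "noeth sm R V" "submod sm R V"
  shows "fin_len sm R {0} V"
proof -
  define F where "F = {X. submod sm R X \<and> X \<subseteq> V \<and> fin_len sm R {0} X}"
  have "submod sm R {0}" by (rule submodI) auto
  then have F0: "{0} \<in> F" using submodD(1)[OF V(2)] fin_len_refl by (auto simp: F_def)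
  have F_sub: "submod sm R X \<and> X \<subseteq> V" if "X \<in> F" for X using that by (simp add: F_def)
  obtain X where X: "X \<in> F" "\<forall>Y\<in>F. \<not> X \<subset> Y" using noeth_maximal[OF V(1) F0 F_sub] by blast
  then have X': "submod sm R X" "X \<subseteq> V" "fin_len sm R {0} X" by (auto simp: F_def)
  have "V \<subseteq> X"
  proof
    fix w assume w: "w \<in> V"
    obtain Y where Y: "submod sm R Y" "fin_len sm R {0} Y" "X \<subseteq> Y" "w \<in> Y"
      and least: "\<forall>Z. submod sm R Z \<and> X \<subseteq> Z \<and> w \<in> Z \<longrightarrow> Y \<subseteq> Z"
      by (rule fin_len_adjoin[OF R X'(1,3), of w])
    have "Y \<in> F" using Y least V(2) X'(2) w by (simp add: F_def)
    then show "w \<in> X" using X(2) Y(3,4) by blast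
  qed
  then show ?thesis using X' by (metis subset_antisym)
qed

end

subsection \<open>Artinian local rings\<close>

lemma ideal_in_iff_submod: "ideal_in A I \<longleftrightarrow> I \<subseteq> A \<and> submod (*) A I"
  by (simp add: ideal_in_def submod_def)

text \<open>The ring is a subset of an ambient ring because it will be \<open>Sg 0\<close> inside S;
  ideals and lengths are therefore relative to \<open>A\<close>.\<close>

locale artinian_local =
  fixes A m :: "'a::comm_ring_1 set"
  assumes one: "1 \<in> A" and sub: "add_subgroup A" and mult: "x \<in> A \<Longrightarrow> y \<in> A \<Longrightarrow> x * y \<in> A"
    and artinian: "artinian_in A"
    and maximal: "maximal_ideal_in A m" and unique: "maximal_ideal_in A m' \<Longrightarrow> m' = m"
begin

sublocale act "(*) :: 'a \<Rightarrow> 'a \<Rightarrow> 'a"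
  by unfold_locales (rule is_module_mult)

lemma submod_A: "submod (*) A A"
  using sub mult by (simp add: submod_def)

lemma ideal_minimal:
  assumes "X0 \<in> F" and F: "\<And>X. X \<in> F \<Longrightarrow> ideal_in A X"
  shows "\<exists>X\<in>F. \<forall>Y\<in>F. \<not> Y \<subset> X"
proof (rule ccontr)
  assume "\<not> ?thesis"
  then have "\<forall>X. X \<in> F \<longrightarrow> (\<exists>Y. Y \<in> F \<and> Y \<subset> X)" by blast
  then obtain g where g: "\<And>X. X \<in> F \<Longrightarrow> g X \<in> F \<and> g X \<subset> X" by metis
  have inF: "(g ^^ j) X0 \<in> F" for j by (induction j) (use assms g in auto)
  have "\<exists>N. \<forall>j\<ge>N. (g ^^ j) X0 = (g ^^ N) X0"
    by (rule artinian[unfolded artinian_in_def, THEN spec[of _ "\<lambda>j. (g ^^ j) X0"], THEN mp])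
       (use F inF g in auto)
  then obtain N where N: "\<And>j. j \<ge> N \<Longrightarrow> (g ^^ j) X0 = (g ^^ N) X0" by blast
  from this[of "Suc N"] show False using g[OF inF[of N]] by auto
qed

text \<open>If \<open>a\<close> is not a unit, the ideal a A is proper and lies in a maximal ideal,
  which can only be \<open>m\<close>. That ideal comes from Zorn's lemma, as no ascending chain
  condition is available at this stage.\<close>

lemma unit_of_not_maximal:
  assumes a: "a \<in> A" "a \<notin> m"
  obtains b where "b \<in> A" "a * b = 1"
proof (cases "\<exists>b\<in>A. a * b = 1")
  case False
  define F where "F = {I. ideal_in A I \<and> a \<in> I \<and> 1 \<notin> I}"
  have aA: "(*) a ` A \<in> F"
  proof -
    have "submod (*) A ((*) a ` A)" by (rule submod_image[OF submod_A])
    moreover have "a \<in> (*) a ` A" using one by force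
    ultimately show ?thesis using False a mult unfolding F_def ideal_in_iff_submod by force
  qed
  have "\<exists>M\<in>F. \<forall>X\<in>F. M \<subseteq> X \<longrightarrow> X = M"
  proof (rule subset_Zorn_nonempty)
    show "F \<noteq> {}" using aA by blast
    fix C assume C: "C \<noteq> {}" "subset.chain F C"
    then have C': "\<And>I. I \<in> C \<Longrightarrow> I \<in> F" "\<And>I J. I \<in> C \<Longrightarrow> J \<in> C \<Longrightarrow> I \<subseteq> J \<or> J \<subseteq> I"
      unfolding subset_chain_def by blast+
    have C_id: "\<And>I. I \<in> C \<Longrightarrow> submod (*) A I \<and> I \<subseteq> A \<and> a \<in> I \<and> 1 \<notin> I"
      using C'(1) by (auto simp: F_def ideal_in_iff_submod)
    have "submod (*) A (\<Union>C)" using C(1) C_id C'(2) by (intro submod_Union_chain) auto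
    then show "\<Union>C \<in> F" using C(1) C_id unfolding F_def ideal_in_iff_submod by blast
  qed
  then obtain M where M: "M \<in> F" "\<And>X. X \<in> F \<Longrightarrow> M \<subseteq> X \<Longrightarrow> X = M" by blast
  have "maximal_ideal_in A M"
    unfolding maximal_ideal_in_def
  proof (intro conjI allI impI)
    show "ideal_in A M" "M \<noteq> A" using M(1) one by (auto simp: F_def)
    fix J assume J: "ideal_in A J \<and> M \<subseteq> J"
    show "J = M \<or> J = A"
    proof (cases "1 \<in> J")
      case True
      have "x \<in> J" if "x \<in> A" for x
        using J True submodD(5)[of "(*)" A J x 1] that by (auto simp: ideal_in_iff_submod)
      then show ?thesis using J by (auto simp: ideal_in_def)
    next
      case False
      then have "J \<in> F" using J M(1) by (auto simp: F_def)
      then show ?thesis using M(2) J by blast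
    qed
  qed
  then have "M = m" by (rule unique)
  then show thesis using M(1) a by (auto simp: F_def)
qed (use that in blast)

lemma m_ideal: "m \<subseteq> A" "submod (*) A m" "1 \<notin> m"
proof -
  show m: "m \<subseteq> A" "submod (*) A m"
    using maximal by (auto simp: maximal_ideal_in_def ideal_in_iff_submod)
  show "1 \<notin> m"
  proof
    assume "1 \<in> m"
    then have "x \<in> m" if "x \<in> A" for x using submodD(5)[OF m(2) that, of 1] by simp
    then show False using maximal m(1) by (auto simp: maximal_ideal_in_def)
  qed
qed

text \<open>Nakayama's lemma without finite generation: an ideal \<open>K = x A\<close> minimal with \<open>K I \<noteq> 0\<close>
  would satisfy \<open>x m = x A\<close>.\<close>

lemma nakayama:
  assumes I: "ideal_in A I" "I \<noteq> {0}"
  obtains K where "ideal_in A K" "K \<subset> I" "\<And>y i. y \<in> m \<Longrightarrow> i \<in> I \<Longrightarrow> y * i \<in> K"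
proof -
  have Isub: "I \<subseteq> A" "submod (*) A I" using I(1) by (auto simp: ideal_in_iff_submod)
  have "\<exists>K. ideal_in A K \<and> K \<subset> I \<and> (\<forall>y\<in>m. \<forall>i\<in>I. y * i \<in> K)"
  proof (rule ccontr)
    assume "\<not> ?thesis"
    \<comment> \<open>Failure of the claim in usable form: every ideal inside \<open>I\<close> that
      contains m I is \<open>I\<close> itself.\<close>
    then have no: "K = I" if "submod (*) A K" "K \<subseteq> I" "\<And>y i. y \<in> m \<Longrightarrow> i \<in> I \<Longrightarrow> y * i \<in> K" for K
      using that Isub unfolding ideal_in_iff_submod by blast
    define F where "F = {K. ideal_in A K \<and> (\<exists>a\<in>K. \<exists>i\<in>I. a * i \<noteq> 0)}"
    have "\<exists>i\<in>I. 1 * i \<noteq> 0" using I(2) submodD(1)[OF Isub(2)] by auto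
    then have AF: "A \<in> F" using one submod_A unfolding F_def ideal_in_iff_submod by blast
    have F_ideal: "\<And>X. X \<in> F \<Longrightarrow> ideal_in A X" by (simp add: F_def)
    obtain K where K: "K \<in> F" "\<And>Y. Y \<in> F \<Longrightarrow> \<not> Y \<subset> K"
      using ideal_minimal[OF AF F_ideal] by blast
    obtain x where x: "x \<in> K" "\<exists>i\<in>I. x * i \<noteq> 0" using K(1) by (auto simp: F_def)
    have Kid: "K \<subseteq> A" "submod (*) A K" using K(1) by (auto simp: F_def ideal_in_iff_submod)
    have xm: "submod (*) A ((*) x ` m)" by (rule submod_image[OF m_ideal(2)])
    have "x * y \<in> K" if "y \<in> A" for y
      using submodD(5)[OF Kid(2) that x(1)] by (simp add: mult.commute)
    then have xmK: "(*) x ` m \<subseteq> K" using m_ideal(1) by blast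
    have "\<exists>y\<in>m. \<exists>i\<in>I. x * y * i \<noteq> 0"
    proof (rule ccontr)
      assume none: "\<not> ?thesis"
      \<comment> \<open>If x m I were zero, the annihilator of \<open>x\<close> in \<open>I\<close>
        would contain m I, hence be all of \<open>I\<close>, against the choice of
        \<open>x\<close>.\<close>
      have "{i\<in>I. x * i = 0} = I"
      proof (rule no)
        show "submod (*) A {i\<in>I. x * i = 0}"
          by (rule submodI) (use submodD[OF Isub(2)] in \<open>auto simp: algebra_simps\<close>)
        show "y * i \<in> {i\<in>I. x * i = 0}" if "y \<in> m" "i \<in> I" for y i
          using none that submodD(5)[OF Isub(2), of y i] m_ideal(1) by (auto simp: mult.assoc)
      qed auto
      then show False using x(2) by blast
    qed
    then have "(*) x ` m \<in> F"
      using xm xmK Kid(1) unfolding F_def ideal_in_iff_submod by blast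
    then have "(*) x ` m = K" using K(2) xmK by blast
    \<comment> \<open>As \<open>x\<close> lies in x m, it is killed by some \<open>1 - y\<close>
      with \<open>y\<close> in \<open>m\<close>, and \<open>1 - y\<close> is a unit.\<close>
    then obtain y where y: "y \<in> m" "x = x * y" using x(1) by blast
    have "1 - y \<notin> m" using submodD(2)[OF m_ideal(2), of "1 - y" y] y(1) m_ideal(3) by auto
    moreover have "1 - y \<in> A" using y(1) m_ideal(1) by (intro submodD(4)[OF submod_A one]) auto
    ultimately obtain b where b: "(1 - y) * b = 1" using unit_of_not_maximal by blast
    have "x * (1 - y) = 0" using y(2) by (simp add: right_diff_distrib)
    then have "x = 0" using b by (metis mult.assoc mult.right_neutral mult_zero_left)
    then show False using x(2) by simp
  qed
  then show thesis using that by blast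
qed

text \<open>Since m I lies in \<open>K\<close>, the quotient I/K is a vector space over the residue
  field. A subspace maximal among those that miss a given nonzero vector is a hyperplane, so I/J is
  simple.\<close>

lemma colength_one:
  assumes I: "ideal_in A I" "I \<noteq> {0}"
  obtains J where "ideal_in A J" "J \<subset> I" "fin_len (*) A J I"
proof -
  obtain K where K: "ideal_in A K" "K \<subset> I" "\<And>y i. y \<in> m \<Longrightarrow> i \<in> I \<Longrightarrow> y * i \<in> K"
    using nakayama[OF I] by blast
  then obtain x where x: "x \<in> I" "x \<notin> K" by blast
  have Isub: "I \<subseteq> A" "submod (*) A I" using I(1) by (auto simp: ideal_in_iff_submod)
  define F where "F = {J. submod (*) A J \<and> K \<subseteq> J \<and> J \<subseteq> I \<and> x \<notin> J}"
  have "\<exists>M\<in>F. \<forall>X\<in>F. M \<subseteq> X \<longrightarrow> X = M"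
  proof (rule subset_Zorn_nonempty)
    show "F \<noteq> {}" using K x by (auto simp: F_def ideal_in_iff_submod)
    fix C assume C: "C \<noteq> {}" "subset.chain F C"
    then have C': "\<And>I. I \<in> C \<Longrightarrow> I \<in> F" "\<And>I J. I \<in> C \<Longrightarrow> J \<in> C \<Longrightarrow> I \<subseteq> J \<or> J \<subseteq> I"
      unfolding subset_chain_def by blast+
    have C_id: "\<And>J. J \<in> C \<Longrightarrow> submod (*) A J \<and> K \<subseteq> J \<and> J \<subseteq> I \<and> x \<notin> J"
      using C'(1) by (auto simp: F_def)
    have "submod (*) A (\<Union>C)" using C(1) C_id C'(2) by (intro submod_Union_chain) auto
    then show "\<Union>C \<in> F" using C(1) C_id unfolding F_def by blast
  qed
  then obtain J where J: "J \<in> F" "\<And>X. X \<in> F \<Longrightarrow> J \<subseteq> X \<Longrightarrow> X = J" by blast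
  then have Jsub: "submod (*) A J" "K \<subseteq> J" "J \<subseteq> I" "x \<notin> J" by (auto simp: F_def)
  \<comment> \<open>For \<open>y\<close> outside \<open>J\<close>, maximality writes
    \<open>x = j + y * a\<close>. Here \<open>a\<close> is a unit, because y m lies in
    \<open>J\<close>; so \<open>y\<close> is recovered from \<open>x\<close> and \<open>j\<close>,
    both of which lie in \<open>L\<close>.\<close>
  have simple: "L = I" if L: "submod (*) A L" "J \<subset> L" "L \<subseteq> I" for L
  proof
    have xL: "x \<in> L" using J(2)[of L] L Jsub by (auto simp: F_def)
    show "I \<subseteq> L"
    proof
      fix y assume y: "y \<in> I"
      show "y \<in> L"
      proof (cases "y \<in> J")
        case False
        define Y where "Y = ssum J ((*) y ` A)"
        have yA: "submod (*) A ((*) y ` A)" by (rule submod_image[OF submod_A])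
        have Y: "submod (*) A Y" unfolding Y_def using Jsub(1) yA by (rule submod_ssum)
        have JY: "J \<subseteq> Y" unfolding Y_def using submodD(1)[OF yA] by (rule ssum_upper1)
        have "y \<in> (*) y ` A" using one by force
        then have "y \<in> Y" unfolding Y_def using ssum_upper2[OF submodD(1)[OF Jsub(1)]] by blast
        moreover have "(*) y ` A \<subseteq> I"
          using submodD(5)[OF Isub(2) _ y] by (auto simp: mult.commute)
        then have "Y \<subseteq> I" unfolding Y_def using Jsub(3) by (intro ssum_least[OF Isub(2)])
        ultimately have "x \<in> Y" using J(2)[of Y] Y JY Jsub(2) False by (auto simp: F_def)
        then obtain j a where ja: "x = j + y * a" "j \<in> J" "a \<in> A" unfolding Y_def ssum_def by auto
        have "a \<notin> m"
        proof
          assume "a \<in> m"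
          then have "y * a \<in> J" using K(3)[of a y] y Jsub(2) by (auto simp: mult.commute)
          then show False using ja Jsub submodD(2) by blast
        qed
        then obtain b where b: "b \<in> A" "a * b = 1" using unit_of_not_maximal ja(3) by blast
        have "x - j \<in> L" using xL ja(2) L by (intro submodD(4)[OF L(1)]) auto
        then have "b * (x - j) \<in> L" using b(1) by (intro submodD(5)[OF L(1)])
        moreover have "b * (x - j) = y * (a * b)" using ja(1) by (simp add: algebra_simps)
        ultimately show ?thesis using b(2) by simp
      qed (use L in blast)
    qed
  qed (use L in blast)
  have "k \<le> 1" if k: "chain_between (*) A J I k" for k
  proof (rule ccontr)
    assume "\<not> k \<le> 1"
    then obtain L where L: "\<And>i. i \<le> k \<Longrightarrow> submod (*) A (L i) \<and> J \<subseteq> L i \<and> L i \<subseteq> I"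
      "\<And>i. i < k \<Longrightarrow> L i \<subset> L (Suc i)" and k2: "2 \<le> k"
      using k unfolding chain_between_def by auto
    have "L 0 \<subset> L (Suc 0)" "L (Suc 0) \<subset> L (Suc (Suc 0))" using L(2) k2 by auto
    then show False using L(1)[of 0] L(1)[of "Suc 0"] L(1)[of "Suc (Suc 0)"] simple[of "L (Suc 0)"] k2 by auto
  qed
  then have "fin_len (*) A J I" unfolding fin_len_def by blast
  moreover have "J \<subset> I" using Jsub x by blast
  ultimately show thesis using that Jsub Isub by (auto simp: ideal_in_iff_submod)
qed

text \<open>An ideal minimal among those of finite colength must be zero: otherwise
  \<open>colength_one\<close> and additivity of length produce a smaller one.\<close>

lemma fin_len_self: "fin_len (*) A {0} A"
proof -
  define F where "F = {I. ideal_in A I \<and> fin_len (*) A I A}"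
  have AF: "A \<in> F" using submod_A fin_len_refl by (auto simp: F_def ideal_in_iff_submod)
  have F_ideal: "\<And>X. X \<in> F \<Longrightarrow> ideal_in A X" by (simp add: F_def)
  obtain I where I: "I \<in> F" "\<And>Y. Y \<in> F \<Longrightarrow> \<not> Y \<subset> I"
    using ideal_minimal[OF AF F_ideal] by blast
  have "I = {0}"
  proof (rule ccontr)
    assume "I \<noteq> {0}"
    then obtain J where J: "ideal_in A J" "J \<subset> I" "fin_len (*) A J I"
      using colength_one[of I] I(1) by (auto simp: F_def)
    then have "fin_len (*) A J A"
      using len_add[of A J I A] I(1) submod_A by (auto simp: F_def ideal_in_iff_submod)
    then show False using I(2)[of J] J by (auto simp: F_def)
  qed
  then show ?thesis using I(1) by (simp add: F_def)
qed

end

subsection \<open>Graded rings and modules\<close>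

lemma is_decompI:
  assumes "finite F" "\<And>n. c n \<in> G n" "\<And>n. n \<notin> F \<Longrightarrow> c n = 0" "x = sum c F"
  shows "is_decomp G c x"
proof -
  have sub: "{n. c n \<noteq> 0} \<subseteq> F" using assms(3) by blast
  moreover have "sum c F = sum c {n. c n \<noteq> 0}"
    using assms(1) sub by (intro sum.mono_neutral_right) auto
  ultimately show ?thesis using assms finite_subset by (auto simp: is_decomp_def)
qed

locale grading =
  fixes G :: "('d::finite \<Rightarrow> nat) \<Rightarrow> 'b::ab_group_add set"
  assumes direct: "direct_sum_grading G"
begin

lemma sub: "add_subgroup (G n)"
  using direct by (simp add: direct_sum_grading_def)

lemma ex1_decomp: "\<exists>!c. is_decomp G c x"
  using direct unfolding direct_sum_grading_def by (elim conjE) (rule spec)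

lemma is_decomp_comp: "is_decomp G (comp G x) x"
  unfolding comp_def using ex1_decomp by (rule theI'[of "\<lambda>c. is_decomp G c x"])

lemma comp_eqI: "is_decomp G c x \<Longrightarrow> comp G x = c"
  unfolding comp_def using ex1_decomp by (rule the1_equality)

lemma comp_in: "comp G x n \<in> G n" and finite_comp: "finite {n. comp G x n \<noteq> 0}"
  and sum_comp: "x = (\<Sum>n\<in>{n. comp G x n \<noteq> 0}. comp G x n)"
  using is_decomp_comp[of x] by (auto simp: is_decomp_def)

lemma comp_homog: "x \<in> G n \<Longrightarrow> comp G x m = (if m = n then x else 0)"
proof -
  assume "x \<in> G n"
  then have "is_decomp G (\<lambda>m. if m = n then x else 0) x"
    by (intro is_decompI[of "{n}"]) (auto simp: add_subgroupD[OF sub])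
  then show ?thesis by (simp add: comp_eqI)
qed

lemma comp_add: "comp G (x + y) n = comp G x n + comp G y n"
proof -
  define F where "F = {n. comp G x n \<noteq> 0} \<union> {n. comp G y n \<noteq> 0}"
  have F: "finite F" by (simp add: F_def finite_comp)
  have "x = (\<Sum>n\<in>F. comp G x n)" "y = (\<Sum>n\<in>F. comp G y n)"
    by (subst sum_comp, intro sum.mono_neutral_left; use F in \<open>auto simp: F_def\<close>)+
  then have "x + y = (\<Sum>n\<in>F. comp G x n + comp G y n)" by (simp add: sum.distrib)
  then have "is_decomp G (\<lambda>n. comp G x n + comp G y n) (x + y)"
    using F by (intro is_decompI[of F]) (auto simp: F_def comp_in add_subgroupD[OF sub])
  then show ?thesis by (simp add: comp_eqI)
qed

lemma comp_zero [simp]: "comp G 0 n = 0"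
  using comp_add[of 0 0 n] by simp

lemma comp_minus: "comp G (- x) n = - comp G x n"
  using comp_add[of x "- x" n] by (simp add: eq_neg_iff_add_eq_0 add.commute)

lemma comp_sum: "comp G (sum f I) n = (\<Sum>i\<in>I. comp G (f i) n)"
  by (induction I rule: infinite_finite_induct) (simp_all add: comp_add)

lemma mem_of_comps:
  assumes "add_subgroup X" "\<And>n. comp G x n \<in> X"
  shows "x \<in> X"
proof -
  have "sum f I \<in> X" if "\<And>i. f i \<in> X" for f and I :: "('d \<Rightarrow> nat) set"
    using that by (induction I rule: infinite_finite_induct) (auto simp: add_subgroupD[OF assms(1)])
  then show ?thesis using sum_comp[of x] assms(2) by metis
qed

end

text \<open>The lexicographic order along an injective numbering of the coordinates. Its
  compatibility with addition gives products a well-defined leading multidegree.\<close>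

lemma monomial_order:
  obtains lt :: "('d::finite \<Rightarrow> nat) \<Rightarrow> ('d \<Rightarrow> nat) \<Rightarrow> bool"
  where "\<And>n. \<not> lt n n" "\<And>n m p. lt n m \<Longrightarrow> lt m p \<Longrightarrow> lt n p" "\<And>n m. n \<noteq> m \<Longrightarrow> lt n m \<or> lt m n"
    "\<And>n m k. lt n m \<Longrightarrow> lt (n + k) (m + k)"
proof -
  obtain ix :: "'d \<Rightarrow> nat" where ix: "inj ix"
    using finite_imp_inj_to_nat_seg[of "UNIV :: 'd set"] by auto
  define lt :: "('d \<Rightarrow> nat) \<Rightarrow> ('d \<Rightarrow> nat) \<Rightarrow> bool"
    where "lt = (\<lambda>n m. \<exists>i. n i < m i \<and> (\<forall>j. ix j < ix i \<longrightarrow> n j = m j))"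
  show thesis
  proof (rule that[of lt])
    show "\<not> lt n n" for n by (simp add: lt_def)
    show "lt (n + k) (m + k)" if "lt n m" for n m k using that by (simp add: lt_def)
    show "lt n m \<or> lt m n" if "n \<noteq> m" for n m
    proof -
      have "\<exists>i. n i \<noteq> m i" using that by (auto simp: fun_eq_iff)
      then obtain i where i: "n i \<noteq> m i" "\<And>j. n j \<noteq> m j \<Longrightarrow> ix i \<le> ix j"
        using exists_least_iff[of "\<lambda>a. \<exists>i. a = ix i \<and> n i \<noteq> m i"] by (metis not_le)
      then have "\<forall>j. ix j < ix i \<longrightarrow> n j = m j" by (meson not_le)
      then show ?thesis using i(1) unfolding lt_def by (metis nat_neq_iff)
    qed
    show "lt n p" if nm: "lt n m" and mp: "lt m p" for n m p
    proof -
      obtain i j where i: "n i < m i" "\<And>l. ix l < ix i \<Longrightarrow> n l = m l"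
        and j: "m j < p j" "\<And>l. ix l < ix j \<Longrightarrow> m l = p l"
        using nm mp unfolding lt_def by blast
      consider "ix i < ix j" | "i = j" | "ix j < ix i"
        using ix by (metis inj_eq linorder_neqE_nat)
      then show ?thesis
      proof cases
        case 1
        then show ?thesis unfolding lt_def using i j by (intro exI[of _ i]) auto
      next
        case 2
        then show ?thesis unfolding lt_def using i j by (intro exI[of _ i]) auto
      next
        case 3
        then show ?thesis unfolding lt_def using i j by (intro exI[of _ j]) auto
      qed
    qed
  qed
qed

lemma finite_maximal_wrt:
  assumes "finite F" "F \<noteq> {}"
    and "\<And>n m p. lt n m \<Longrightarrow> lt m p \<Longrightarrow> lt n p" "\<And>n m. n \<noteq> m \<Longrightarrow> lt n m \<or> lt m n"
  shows "\<exists>p\<in>F. \<forall>m\<in>F. m = p \<or> lt m p"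
  using assms(1,2)
proof (induction F rule: finite_ne_induct)
  case (insert x F)
  then obtain p where "p \<in> F" "\<forall>m\<in>F. m = p \<or> lt m p" by blast
  then show ?case using assms(3,4) by (metis insert_iff)
qed simp

lemma one_notin_prime: "prime_ideal P \<Longrightarrow> 1 \<notin> P"
  unfolding prime_ideal_def ideal_def by (metis UNIV_eq_I mult.right_neutral)

locale graded = act sm for sm :: "'a::comm_ring_1 \<Rightarrow> 'm::ab_group_add \<Rightarrow> 'm" +
  fixes Sg :: "('d::finite \<Rightarrow> nat) \<Rightarrow> 'a set" and Mg :: "('d \<Rightarrow> nat) \<Rightarrow> 'm set"
  assumes standard: "standard_graded Sg" and graded_module: "graded_module Sg sm Mg"
begin

sublocale S: grading Sg
  using standard by unfold_locales (simp add: standard_graded_def graded_ring_def)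

sublocale M: grading Mg
  using graded_module by unfold_locales (simp add: graded_module_def)

lemma one_mem: "1 \<in> Sg 0" and mult_mem: "x \<in> Sg n \<Longrightarrow> y \<in> Sg m \<Longrightarrow> x * y \<in> Sg (n + m)"
  and ring_gen: "ring_gen (Sg 0 \<union> (\<Union>i. Sg (unitv i))) = UNIV"
  using standard by (auto simp: standard_graded_def graded_ring_def)

lemma sm_mem: "a \<in> Sg n \<Longrightarrow> x \<in> Mg m \<Longrightarrow> sm a x \<in> Mg (n + m)"
  using graded_module by (auto simp: graded_module_def)

lemma comp_mult:
  "comp Sg (a * b) k = (\<Sum>m\<in>{m. comp Sg a m \<noteq> 0}. \<Sum>n\<in>{n. comp Sg b n \<noteq> 0}.
     if m + n = k then comp Sg a m * comp Sg b n else 0)"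
proof -
  have "a * b = (\<Sum>m\<in>{m. comp Sg a m \<noteq> 0}. \<Sum>n\<in>{n. comp Sg b n \<noteq> 0}. comp Sg a m * comp Sg b n)"
    using S.sum_comp[of a] S.sum_comp[of b] sum_product by metis
  then have "comp Sg (a * b) k = (\<Sum>m\<in>{m. comp Sg a m \<noteq> 0}. \<Sum>n\<in>{n. comp Sg b n \<noteq> 0}.
      comp Sg (comp Sg a m * comp Sg b n) k)"
    by (simp only: S.comp_sum)
  moreover have "comp Sg (comp Sg a m * comp Sg b n) k = (if m + n = k then comp Sg a m * comp Sg b n else 0)" for m n
    using S.comp_homog[OF mult_mem[OF S.comp_in S.comp_in], of a m b n k] by auto
  ultimately show ?thesis by (simp only:)
qed

lemma comp_sm_left:
  assumes "a \<in> Sg e"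
  shows "comp Mg (sm a x) (e + n) = sm a (comp Mg x n)"
proof -
  have "sm a x = (\<Sum>m\<in>{m. comp Mg x m \<noteq> 0}. sm a (comp Mg x m))"
    using M.sum_comp[of x] sm_sum_right by metis
  then have "comp Mg (sm a x) (e + n) = (\<Sum>m\<in>{m. comp Mg x m \<noteq> 0}. comp Mg (sm a (comp Mg x m)) (e + n))"
    by (simp only: M.comp_sum)
  also have "\<dots> = (\<Sum>m\<in>{m. comp Mg x m \<noteq> 0}. if m = n then sm a (comp Mg x n) else 0)"
    by (intro sum.cong refl) (use M.comp_homog[OF sm_mem[OF assms M.comp_in], of x _ "e + n"] in auto)
  also have "\<dots> = sm a (comp Mg x n)"
    using M.finite_comp[of x] by simp
  finally show ?thesis .
qed

lemma comp_sm_right: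
  assumes "z \<in> Mg d"
  shows "comp Mg (sm s z) (n + d) = sm (comp Sg s n) z"
    and "\<not> d \<le> p \<Longrightarrow> comp Mg (sm s z) p = 0"
proof -
  have "sm s z = (\<Sum>m\<in>{m. comp Sg s m \<noteq> 0}. sm (comp Sg s m) z)"
    using S.sum_comp[of s] sm_sum_left by metis
  then have *: "comp Mg (sm s z) p = (\<Sum>m\<in>{m. comp Sg s m \<noteq> 0}. comp Mg (sm (comp Sg s m) z) p)" for p
    by (simp only: M.comp_sum)
  have h: "comp Mg (sm (comp Sg s m) z) p = (if p = m + d then sm (comp Sg s m) z else 0)" for m p
    by (rule M.comp_homog[OF sm_mem[OF S.comp_in assms]])
  have "comp Mg (sm s z) (n + d) = (\<Sum>m\<in>{m. comp Sg s m \<noteq> 0}. if m = n then sm (comp Sg s n) z else 0)"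
    unfolding * by (intro sum.cong refl) (auto simp: h)
  also have "\<dots> = sm (comp Sg s n) z" using S.finite_comp[of s] by simp
  finally show "comp Mg (sm s z) (n + d) = sm (comp Sg s n) z" .
  show "comp Mg (sm s z) p = 0" if "\<not> d \<le> p"
  proof -
    have "p \<noteq> m + d" for m using that by (auto simp: le_fun_def)
    then show ?thesis unfolding * h by simp
  qed
qed

text \<open>For \<open>a\<close> and \<open>b\<close> outside \<open>P\<close>, take their largest
  components outside \<open>P\<close>, in degrees \<open>p\<close> and \<open>q\<close>. Every other
  contribution to the component of \<open>a * b\<close> in degree \<open>p + q\<close> has a factor
  in \<open>P\<close>, so the product of these two components would lie in \<open>P\<close>.\<close>

lemma homogeneous_prime_idealI:
  assumes P: "homogeneous_ideal Sg P" "1 \<notin> P"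
    and prime: "\<And>a b m n. a \<in> Sg m \<Longrightarrow> b \<in> Sg n \<Longrightarrow> a * b \<in> P \<Longrightarrow> a \<in> P \<or> b \<in> P"
  shows "prime_ideal P"
  unfolding prime_ideal_def
proof (intro conjI allI impI)
  show "ideal P" using P(1) by (simp add: homogeneous_ideal_def)
  then have sub: "add_subgroup P" and absorb: "\<And>a x. x \<in> P \<Longrightarrow> a * x \<in> P" by (auto simp: ideal_def)
  have absorb': "\<And>a x. x \<in> P \<Longrightarrow> x * a \<in> P" using absorb by (metis mult.commute)
  show "P \<noteq> UNIV" using P(2) by blast
  fix a b assume ab: "a * b \<in> P"
  obtain lt :: "('d \<Rightarrow> nat) \<Rightarrow> ('d \<Rightarrow> nat) \<Rightarrow> bool" where
    lt: "\<And>n. \<not> lt n n" "\<And>n m p. lt n m \<Longrightarrow> lt m p \<Longrightarrow> lt n p" "\<And>n m. n \<noteq> m \<Longrightarrow> lt n m \<or> lt m n"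
    and lt_add: "\<And>n m k. lt n m \<Longrightarrow> lt (n + k) (m + k)"
    using monomial_order by blast
  have top: "\<exists>p. comp Sg x p \<notin> P \<and> (\<forall>m. comp Sg x m \<notin> P \<longrightarrow> m = p \<or> lt m p)" if "x \<notin> P" for x
  proof -
    have "{m. comp Sg x m \<notin> P} \<subseteq> {m. comp Sg x m \<noteq> 0}" using add_subgroupD(1)[OF sub] by auto
    then have fin: "finite {m. comp Sg x m \<notin> P}" using S.finite_comp by (rule finite_subset)
    have ne: "{m. comp Sg x m \<notin> P} \<noteq> {}" using S.mem_of_comps[OF sub, of x] that by blast
    have "\<exists>p\<in>{m. comp Sg x m \<notin> P}. \<forall>m\<in>{m. comp Sg x m \<notin> P}. m = p \<or> lt m p"
      by (rule finite_maximal_wrt[where lt = lt, OF fin ne lt(2) lt(3)])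
    then show ?thesis by simp
  qed
  show "a \<in> P \<or> b \<in> P"
  proof (rule ccontr)
    assume "\<not> (a \<in> P \<or> b \<in> P)"
    then have a: "a \<notin> P" and b: "b \<notin> P" by simp_all
    obtain p where p: "comp Sg a p \<notin> P" "\<forall>m. comp Sg a m \<notin> P \<longrightarrow> m = p \<or> lt m p"
      using top[OF a] by (elim exE conjE)
    obtain q where q: "comp Sg b q \<notin> P" "\<forall>m. comp Sg b m \<notin> P \<longrightarrow> m = q \<or> lt m q"
      using top[OF b] by (elim exE conjE)
    define A where "A = {m. comp Sg a m \<noteq> 0} \<times> {n. comp Sg b n \<noteq> 0}"
    define t where "t = (\<lambda>(m, n). if m + n = p + q then comp Sg a m * comp Sg b n else 0)"
    have A: "finite A" "(p, q) \<in> A"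
      using p(1) q(1) add_subgroupD(1)[OF sub] by (auto simp: A_def S.finite_comp)
    have "t x \<in> P" if "x \<noteq> (p, q)" for x
    proof -
      obtain m n where x: "x = (m, n)" by fastforce
      show ?thesis
      proof (cases "m + n = p + q \<and> comp Sg a m \<notin> P \<and> comp Sg b n \<notin> P")
        case True
        then have mn: "m = p \<or> lt m p" "n = q \<or> lt n q" "m + n = p + q" using p q by auto
        have "m \<noteq> p" using mn(3) that x by auto
        then have "lt (m + n) (p + n)" using mn(1) lt_add by blast
        moreover have "p + n = p + q \<or> lt (p + n) (p + q)"
          using mn(2) lt_add[of n q p] by (auto simp: add.commute)
        ultimately have "lt (m + n) (p + q)" using lt(2) by metis
        then show ?thesis using mn(3) lt(1) by simp
      qed (use x absorb absorb' add_subgroupD(1)[OF sub] in \<open>auto simp: t_def\<close>)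
    qed
    then have "sum t (A - {(p, q)}) \<in> P"
      by (intro submod_sum[of "(*)" "{}"]) (auto simp: submod_def sub)
    moreover have "sum t A = comp Sg (a * b) (p + q)"
      unfolding comp_mult A_def t_def sum.cartesian_product ..
    then have "sum t A \<in> P" using P(1) ab by (simp add: homogeneous_ideal_def)
    ultimately have "sum t A - sum t (A - {(p, q)}) \<in> P" by (intro add_subgroupD(4)[OF sub])
    moreover have "sum t A - sum t (A - {(p, q)}) = comp Sg a p * comp Sg b q"
      using A by (simp add: sum.remove t_def)
    ultimately show False using prime[OF S.comp_in S.comp_in] p(1) q(1) by metis
  qed
qed

text \<open>If all of S_i lay in \<open>P\<close>, standardness would put every component of a
  degree with positive i-th entry into \<open>P\<close>: the set \<open>T\<close> of elements with
  this property is a subring containing the generators. All degrees of S_++ are of that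
  kind.\<close>

lemma unitv_mem_outside:
  assumes P: "homogeneous_ideal Sg P" and Spp: "\<not> Spp Sg \<subseteq> P"
  shows "\<exists>f\<in>Sg (unitv i). f \<notin> P"
proof (rule ccontr)
  assume "\<not> ?thesis"
  then have SP: "Sg (unitv i) \<subseteq> P" by blast
  have sub: "add_subgroup P" and absorb: "\<And>a x. x \<in> P \<Longrightarrow> a * x \<in> P"
    using P by (auto simp: ideal_def homogeneous_ideal_def)
  have absorb': "\<And>a x. x \<in> P \<Longrightarrow> x * a \<in> P" using absorb by (metis mult.commute)
  define T where "T = {x. \<forall>n. n i > 0 \<longrightarrow> comp Sg x n \<in> P}"
  have "ring_gen (Sg 0 \<union> (\<Union>i. Sg (unitv i))) \<subseteq> T"
    unfolding ring_gen_def
  proof (rule Inter_lower, rule CollectI, intro conjI ballI)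
    show "Sg 0 \<union> (\<Union>i. Sg (unitv i)) \<subseteq> T"
    proof
      fix x assume "x \<in> Sg 0 \<union> (\<Union>i. Sg (unitv i))"
      then consider "x \<in> Sg 0" | j where "x \<in> Sg (unitv j)" by blast
      then show "x \<in> T"
      proof cases
        case 1
        then show ?thesis using add_subgroupD(1)[OF sub] by (auto simp: T_def S.comp_homog)
      next
        case 2
        then show ?thesis using add_subgroupD(1)[OF sub] SP
          by (cases "j = i") (auto simp: T_def S.comp_homog unitv_def)
      qed
    qed
    show "0 \<in> T" using add_subgroupD(1)[OF sub] by (simp add: T_def)
    show "1 \<in> T" using add_subgroupD(1)[OF sub] by (auto simp: T_def S.comp_homog[OF one_mem])
    fix x y assume xy: "x \<in> T" "y \<in> T"
    show "x + y \<in> T" "- x \<in> T"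
      using xy add_subgroupD[OF sub] by (auto simp: T_def S.comp_add S.comp_minus)
    show "x * y \<in> T"
      unfolding T_def
    proof (rule CollectI, intro allI impI)
      fix n assume n: "(n :: 'd \<Rightarrow> nat) i > 0"
      have "(if m + l = n then comp Sg x m * comp Sg y l else 0) \<in> P" for m l
      proof (cases "m + l = n")
        case True
        then have "m i > 0 \<or> l i > 0" using n by auto
        then show ?thesis using xy absorb absorb' True by (auto simp: T_def)
      qed (simp add: add_subgroupD(1)[OF sub])
      then show "comp Sg (x * y) n \<in> P"
        unfolding comp_mult by (intro submod_sum[of "(*)" "{}"]) (auto simp: submod_def sub)
    qed
  qed
  then have T: "x \<in> T" for x using ring_gen by blast
  have "Spp Sg \<subseteq> P"
  proof
    fix x assume x: "x \<in> Spp Sg"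
    show "x \<in> P"
    proof (rule S.mem_of_comps[OF sub])
      fix n show "comp Sg x n \<in> P"
      proof (cases "comp Sg x n = 0")
        case False
        then have "ones \<le> n" using x by (simp add: Spp_def)
        then have "n i > 0" by (auto simp: ones_def le_fun_def dest: spec[of _ i])
        then show ?thesis using T by (simp add: T_def)
      qed (simp add: add_subgroupD(1)[OF sub])
    qed
  qed
  then show False using Spp by blast
qed

text \<open>Products of degree \<open>unitv i\<close> elements outside \<open>P\<close> stay outside
  the prime \<open>P\<close>, and they reach every multidegree.\<close>

lemma mem_outside:
  assumes P: "prime_ideal P" "homogeneous_ideal Sg P" and Spp: "\<not> Spp Sg \<subseteq> P"
  shows "\<exists>h\<in>Sg n. h \<notin> P"
proof (induction "sum n UNIV" arbitrary: n)
  case 0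
  then have "n = 0" by (auto simp: fun_eq_iff)
  moreover have "1 \<notin> P" by (rule one_notin_prime[OF P(1)])
  ultimately show ?case using one_mem by blast
next
  case (Suc s)
  have "\<exists>i. n i > 0" using Suc.hyps(2) by (metis Zero_not_Suc neq0_conv sum.neutral)
  then obtain i where i: "n i > 0" by blast
  define m where "m = n - unitv i"
  have n: "n = m + unitv i" using i by (auto simp: m_def fun_eq_iff unitv_def)
  have "sum n UNIV = Suc (sum m UNIV)"
    unfolding n by (simp add: sum.distrib unitv_def)
  then obtain h where h: "h \<in> Sg m" "h \<notin> P" using Suc by (metis diff_Suc_1)
  obtain f where f: "f \<in> Sg (unitv i)" "f \<notin> P" using unitv_mem_outside[OF P(2) Spp] by blast
  have "h * f \<in> Sg n" unfolding n using h(1) f(1) by (rule mult_mem)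
  moreover have "h * f \<notin> P" using P(1) h(2) f(2) unfolding prime_ideal_def by blast
  ultimately show ?case by blast
qed

section \<open>Graded submodules and lengths of their components\<close>

definition gsub :: "'m set \<Rightarrow> bool" where
  "gsub N \<longleftrightarrow> submod sm UNIV N \<and> (\<forall>x\<in>N. \<forall>n. comp Mg x n \<in> N)"

lemma gsubD: "gsub N \<Longrightarrow> submod sm UNIV N" "gsub N \<Longrightarrow> x \<in> N \<Longrightarrow> comp Mg x n \<in> N"
  by (auto simp: gsub_def)

lemma gsub_zero: "gsub {0}" and gsub_UNIV: "gsub UNIV"
  by (auto simp: gsub_def submod_def add_subgroup_def)

lemma gsub_ssum:
  assumes "gsub N" "gsub K"
  shows "gsub (ssum N K)"
  using assms unfolding gsub_def by (auto intro: submod_ssum) (auto simp: ssum_def M.comp_add; blast)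

lemma submod_component: "submod sm UNIV N \<Longrightarrow> submod sm (Sg 0) (N \<inter> Mg n)"
  by (rule submodI)
     (use sm_mem[of _ 0 _ n] in \<open>auto simp: submodD add_subgroupD[OF M.sub]\<close>)

lemma gsub_image:
  assumes f: "f \<in> Sg e" and K: "gsub K"
  shows "gsub (sm f ` K)"
  unfolding gsub_def
proof (intro conjI ballI allI)
  show sub: "submod sm UNIV (sm f ` K)" using gsubD(1)[OF K] by (rule submod_image)
  fix x n assume "x \<in> sm f ` K"
  then obtain y where y: "x = sm f y" "y \<in> K" by blast
  show "comp Mg x n \<in> sm f ` K"
  proof (cases "e \<le> n")
    case True
    then have "n = e + (n - e)" by (auto simp: fun_eq_iff le_fun_def)
    then have "comp Mg x n = sm f (comp Mg y (n - e))" using comp_sm_left[OF f, of y "n - e"] y(1) by simp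
    then show ?thesis using gsubD(2)[OF K y(2)] by blast
  next
    case False
    have "comp Mg x n = (\<Sum>m\<in>{m. comp Mg y m \<noteq> 0}. comp Mg (sm f (comp Mg y m)) n)"
      using M.sum_comp[of y] y(1) sm_sum_right M.comp_sum by metis
    also have "\<dots> = 0"
    proof (intro sum.neutral ballI)
      fix m
      have "n \<noteq> e + m" using False by (auto simp: le_fun_def)
      then show "comp Mg (sm f (comp Mg y m)) n = 0"
        using M.comp_homog[OF sm_mem[OF f M.comp_in]] by simp
    qed
    finally show ?thesis using submodD(1)[OF sub] by simp
  qed
qed

definition cyc :: "'m \<Rightarrow> 'm set" where
  "cyc z = range (\<lambda>s. sm s z)"

lemma submod_cyc: "submod sm UNIV (cyc z)"
proof (rule submodI)
  show "0 \<in> cyc z" unfolding cyc_def by (rule range_eqI[of _ _ 0]) simp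
qed (auto simp: cyc_def simp flip: sm_simps(2,3) sm_minus_left)

lemma self_in_cyc: "z \<in> cyc z"
  unfolding cyc_def by (rule range_eqI[of _ _ 1]) (simp add: sm_simps)

lemma gsub_cyc:
  assumes "z \<in> Mg d"
  shows "gsub (cyc z)"
  unfolding gsub_def
proof (intro conjI ballI allI submod_cyc)
  fix x n assume "x \<in> cyc z"
  then obtain s where s: "x = sm s z" by (auto simp: cyc_def)
  show "comp Mg x n \<in> cyc z"
  proof (cases "d \<le> n")
    case True
    then have "n = (n - d) + d" by (auto simp: fun_eq_iff le_fun_def)
    then have "comp Mg x n = sm (comp Sg s (n - d)) z" using comp_sm_right(1)[OF assms, of s "n - d"] s by simp
    then show ?thesis by (auto simp: cyc_def)
  qed (use comp_sm_right(2)[OF assms] s submodD(1)[OF submod_cyc] in simp)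
qed

lemma component_ssum_image:
  assumes f: "f \<in> Sg e" and N: "gsub N" and K: "gsub K"
  shows "ssum (N \<inter> Mg (e + n)) (sm f ` (K \<inter> Mg n)) = ssum N (sm f ` K) \<inter> Mg (e + n)"
proof
  show "ssum (N \<inter> Mg (e + n)) (sm f ` (K \<inter> Mg n)) \<subseteq> ssum N (sm f ` K) \<inter> Mg (e + n)"
    using sm_mem[OF f] add_subgroupD(2)[OF M.sub] unfolding ssum_def by blast
  show "ssum N (sm f ` K) \<inter> Mg (e + n) \<subseteq> ssum (N \<inter> Mg (e + n)) (sm f ` (K \<inter> Mg n))"
  proof
    fix x assume x: "x \<in> ssum N (sm f ` K) \<inter> Mg (e + n)"
    then obtain u y where uy: "x = u + sm f y" "u \<in> N" "y \<in> K" unfolding ssum_def by blast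
    have "x = comp Mg x (e + n)" using x M.comp_homog[of x "e + n" "e + n"] by simp
    also have "\<dots> = comp Mg u (e + n) + sm f (comp Mg y n)"
      using uy(1) by (simp add: M.comp_add comp_sm_left[OF f])
    also have "\<dots> \<in> ssum (N \<inter> Mg (e + n)) (sm f ` (K \<inter> Mg n))"
      using gsubD(2)[OF N uy(2)] gsubD(2)[OF K uy(3)] M.comp_in by (intro ssumI) auto
    finally show "x \<in> ssum (N \<inter> Mg (e + n)) (sm f ` (K \<inter> Mg n))" .
  qed
qed

text \<open>The isomorphism theorem for multiplication by \<open>f\<close>, one degree at a time;
  every comparison of Hilbert functions in degrees \<open>n\<close> and \<open>e + n\<close> rests
  on it.\<close>

lemma len_mult:
  assumes f: "f \<in> Sg e" and N: "gsub N" and K: "gsub K"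
  shows "len sm (Sg 0) (K \<inter> Mg n \<inter> sm f -` N) (K \<inter> Mg n)
    = len sm (Sg 0) (N \<inter> Mg (e + n)) (ssum N (sm f ` K) \<inter> Mg (e + n))"
proof -
  have "K \<inter> Mg n \<inter> sm f -` N = K \<inter> Mg n \<inter> sm f -` (N \<inter> Mg (e + n))"
    using sm_mem[OF f] by blast
  then have "len sm (Sg 0) (K \<inter> Mg n \<inter> sm f -` N) (K \<inter> Mg n)
    = len sm (Sg 0) (N \<inter> Mg (e + n)) (ssum (N \<inter> Mg (e + n)) (sm f ` (K \<inter> Mg n)))"
    using len_iso(2)[OF is_module is_module, of "sm f" "Sg 0" "K \<inter> Mg n" "N \<inter> Mg (e + n)"]
      submod_component gsubD(1)[OF N] gsubD(1)[OF K] by (simp add: sm_simps sm_commute)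
  then show ?thesis by (simp only: component_ssum_image[OF f N K])
qed

text \<open>If each component of \<open>x\<close> were sent into \<open>N\<close> by some
  \<open>t d\<close> outside \<open>P\<close>, the product of these finitely many scalars would send
  \<open>x\<close> into \<open>N\<close> and still lie outside the prime \<open>P\<close>.\<close>

lemma homogeneous_witness:
  assumes N: "gsub N" and P: "prime_ideal P" and x: "\<And>s. s \<notin> P \<Longrightarrow> sm s x \<notin> N"
  shows "\<exists>d. \<forall>s. s \<notin> P \<longrightarrow> sm s (comp Mg x d) \<notin> N"
proof (rule ccontr)
  assume "\<not> ?thesis"
  then obtain t where t: "\<And>d. t d \<notin> P" "\<And>d. sm (t d) (comp Mg x d) \<in> N" by metis
  define F where "F = {d. comp Mg x d \<noteq> 0}"
  have F: "finite F" by (simp add: F_def M.finite_comp)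
  have "(\<Prod>d\<in>D. t d) \<notin> P" if "finite D" for D
    using that
  proof (induction D)
    case empty
    show ?case using one_notin_prime[OF P] by simp
  next
    case (insert a D)
    then show ?case using t(1) P by (auto simp: prime_ideal_def)
  qed
  then have "sm (\<Prod>d\<in>F. t d) x \<notin> N" using F x by blast
  moreover have "sm (\<Prod>d\<in>F. t d) (comp Mg x d) \<in> N" if "d \<in> F" for d
  proof -
    have "(\<Prod>d\<in>F. t d) = (\<Prod>d\<in>F - {d}. t d) * t d" using F that by (simp add: prod.remove mult.commute)
    then show ?thesis using submodD(5)[OF gsubD(1)[OF N] UNIV_I t(2)] by (simp add: sm_simps)
  qed
  then have "sm (\<Prod>d\<in>F. t d) (\<Sum>d\<in>F. comp Mg x d) \<in> N"
    unfolding sm_sum_right by (rule submod_sum[OF gsubD(1)[OF N]])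
  then have "sm (\<Prod>d\<in>F. t d) x \<in> N" using M.sum_comp[of x] by (simp add: F_def)
  ultimately show False by blast
qed

text \<open>An \<open>A\<close>-submodule \<open>X\<close> of \<open>M\<^sub>n\<close> is recovered from the \<open>S\<close>-submodule it generates as the part
  of degree \<open>n\<close>, so the components of a noetherian graded module are noetherian over \<open>A\<close>.\<close>

lemma noeth_component:
  assumes "noeth sm UNIV UNIV"
  shows "noeth sm (Sg 0) (Mg n)"
  unfolding noeth_def
proof (intro allI impI)
  fix J
  assume J: "\<forall>j. submod sm (Sg 0) (J j) \<and> J j \<subseteq> Mg n \<and> J j \<subseteq> J (Suc j)"
  then have J': "\<And>j. submod sm (Sg 0) (J j)" "\<And>j. J j \<subseteq> Mg n" "\<And>j. J j \<subseteq> J (Suc j)" by blast+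
  define E where "E = (\<lambda>X. {x. \<forall>Y. submod sm UNIV Y \<and> X \<subseteq> Y \<longrightarrow> x \<in> Y})"
  have E_sub: "submod sm UNIV (E X)" for X
    by (rule submodI) (auto simp: E_def submodD)
  have E_mono: "E X \<subseteq> E Y" if "X \<subseteq> Y" for X Y using that unfolding E_def by blast
  have E_trace: "E X \<inter> Mg n = X" if X: "submod sm (Sg 0) X" "X \<subseteq> Mg n" for X
  proof
    show "X \<subseteq> E X \<inter> Mg n" using X(2) unfolding E_def by blast
    \<comment> \<open>An S-submodule that contains \<open>X\<close> and whose part of degree
      \<open>n\<close> lies in \<open>X\<close> (take \<open>a = 1\<close>), hence an upper bound
      for \<open>E X\<close>.\<close>
    define Y where "Y = {x. \<forall>a. comp Mg (sm a x) n \<in> X}"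
    have "submod sm UNIV Y"
      by (rule submodI)
         (use submodD[OF X(1)] in \<open>auto simp: Y_def sm_simps(4) sm_minus_right M.comp_add M.comp_minus simp flip: sm_simps(2)\<close>)
    moreover have "X \<subseteq> Y"
    proof
      fix x assume x: "x \<in> X"
      have "comp Mg (sm a x) n = sm (comp Sg a 0) x" for a
        using comp_sm_right(1)[of x n a 0] x X(2) by auto
      then show "x \<in> Y" using submodD(5)[OF X(1) S.comp_in x] by (simp add: Y_def)
    qed
    ultimately have EY: "E X \<subseteq> Y" unfolding E_def by blast
    show "E X \<inter> Mg n \<subseteq> X"
    proof
      fix x assume x: "x \<in> E X \<inter> Mg n"
      then have "comp Mg (sm 1 x) n \<in> X" using EY by (auto simp: Y_def)
      then show "x \<in> X" using x M.comp_homog[of x n n] by (simp add: sm_simps)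
    qed
  qed
  obtain T where T: "\<And>j. j \<ge> T \<Longrightarrow> E (J j) = E (J T)"
  proof (rule noethD[OF assms, of "\<lambda>j. E (J j)"])
    show "E (J j) \<subseteq> E (J (Suc j))" for j by (rule E_mono[OF J'(3)])
  qed (use E_sub in auto)
  have trace: "E (J j) \<inter> Mg n = J j" for j using J' by (intro E_trace)
  have "J j = J T" if "j \<ge> T" for j
    by (subst (1 2) trace[symmetric]) (simp only: T[OF that])
  then show "\<exists>N. \<forall>j\<ge>N. J j = J N" by blast
qed

end

subsection \<open>Hilbert functions\<close>

definition prime_chain :: "'a set set \<Rightarrow> nat \<Rightarrow> bool" where
  "prime_chain X k \<longleftrightarrow> (\<exists>C::nat \<Rightarrow> 'a set. (\<forall>i\<le>k. C i \<in> X) \<and> (\<forall>i<k. C i \<subset> C (Suc i)))"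

lemma prime_chain_extend:
  assumes "prime_chain X k" "P \<in> Y" "X \<subseteq> Y" "\<And>Q. Q \<in> X \<Longrightarrow> P \<subset> Q"
  shows "prime_chain Y (Suc k)"
proof -
  obtain C where C: "\<And>i. i \<le> k \<Longrightarrow> C i \<in> X" "\<And>i. i < k \<Longrightarrow> C i \<subset> C (Suc i)"
    using assms(1) unfolding prime_chain_def by blast
  define D where "D = (\<lambda>i. case i of 0 \<Rightarrow> P | Suc j \<Rightarrow> C j)"
  have "D i \<in> Y" if "i \<le> Suc k" for i
    using that C(1) assms(2,3) by (auto simp: D_def split: nat.split)
  moreover have "D i \<subset> D (Suc i)" if "i < Suc k" for i
    using that C assms(4) by (cases i) (auto simp: D_def)
  ultimately show ?thesis unfolding prime_chain_def by blast
qed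

text \<open>Collects what finite generation over an artinian local ring provides. That S is
  noetherian over itself serves to find maximal annihilators, that M is noetherian to run the
  induction on submodules.\<close>

locale graded_noeth = graded sm Sg Mg
  for sm :: "'a::comm_ring_1 \<Rightarrow> 'm::ab_group_add \<Rightarrow> 'm"
    and Sg :: "('d::finite \<Rightarrow> nat) \<Rightarrow> 'a set" and Mg :: "('d \<Rightarrow> nat) \<Rightarrow> 'm set" +
  assumes noeth_M: "noeth sm UNIV UNIV" and noeth_S: "noeth (*) (UNIV :: 'a set) UNIV"
    and fin_len_M: "fin_len sm (Sg 0) {0} (Mg n)"
begin

definition hlen :: "'m set \<Rightarrow> 'm set \<Rightarrow> ('d \<Rightarrow> nat) \<Rightarrow> nat" where
  "hlen N K n = len sm (Sg 0) (N \<inter> Mg n) (K \<inter> Mg n)"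

text \<open>The support of K/N, which for \<open>K = UNIV\<close> is \<open>Supp_pp\<close> at
  \<open>N\<close>. The induction needs the relative form, since it cuts M into pieces and the
  support shrinks with the interval from \<open>N\<close> to \<open>K\<close>.\<close>

definition supp :: "'m set \<Rightarrow> 'm set \<Rightarrow> 'a set set" where
  "supp N K = {P. prime_ideal P \<and> homogeneous_ideal Sg P \<and> \<not> Spp Sg \<subseteq> P \<and>
     (\<exists>x\<in>K. \<forall>s. s \<notin> P \<longrightarrow> sm s x \<notin> N)}"

definition colon :: "'m set \<Rightarrow> 'm \<Rightarrow> 'a set" where
  "colon N z = {s. sm s z \<in> N}"

lemma supp_mono: "N \<subseteq> N' \<Longrightarrow> K' \<subseteq> K \<Longrightarrow> supp N' K' \<subseteq> supp N K"
  unfolding supp_def by blast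

lemma fin_len_component: "submod sm UNIV N \<Longrightarrow> fin_len sm (Sg 0) (N \<inter> Mg n) (K \<inter> Mg n)"
  by (rule fin_len_mono[OF fin_len_M]) (auto simp: submodD add_subgroupD(1)[OF M.sub])

lemma hlen_add:
  assumes "gsub N" "gsub K" "gsub L" "N \<subseteq> K" "K \<subseteq> L"
  shows "hlen N L n = hlen N K n + hlen K L n"
  unfolding hlen_def
  using len_add[of "Sg 0" "N \<inter> Mg n" "K \<inter> Mg n" "L \<inter> Mg n"] assms
  by (auto simp: submod_component fin_len_component gsubD)

lemma hlen_refl: "gsub N \<Longrightarrow> hlen N N n = 0"
  unfolding hlen_def by (intro len_refl submod_component gsubD)

lemma hlen_eq_0D:
  assumes "gsub N" "hlen N UNIV n = 0"
  shows "Mg n \<subseteq> N"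
proof -
  have "N \<inter> Mg n = UNIV \<inter> Mg n"
    using assms(2) unfolding hlen_def
    by (intro len_eq_0D[of sm "Sg 0"] fin_len_component submod_component)
       (use gsubD(1)[OF assms(1)] gsubD(1)[OF gsub_UNIV] in auto)
  then show ?thesis by blast
qed

lemma homogeneous_ideal_colon:
  assumes N: "gsub N" and z: "z \<in> Mg d"
  shows "homogeneous_ideal Sg (colon N z)"
  unfolding homogeneous_ideal_def
proof (intro conjI ballI allI)
  note D = submodD[OF gsubD(1)[OF N]]
  show "ideal (colon N z)"
    unfolding ideal_def add_subgroup_def colon_def
    using D by (auto simp: sm_simps sm_minus_left)
  fix s n assume "s \<in> colon N z"
  then show "comp Sg s n \<in> colon N z"
    using gsubD(2)[OF N, of "sm s z" "n + d"] comp_sm_right(1)[OF z] by (simp add: colon_def)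
qed

text \<open>Associated primes: a maximal annihilator of a homogeneous class is prime.\<close>

lemma prime_colon_exists:
  assumes K: "gsub K" and L: "gsub L" and KL: "K \<subset> L"
  shows "\<exists>d. \<exists>z\<in>Mg d. z \<in> L \<and> z \<notin> K \<and> prime_ideal (colon K z)"
proof -
  define F where "F = {P. \<exists>z d. P = colon K z \<and> z \<in> Mg d \<and> z \<in> L \<and> z \<notin> K}"
  obtain x where x: "x \<in> L" "x \<notin> K" using KL by blast
  then obtain n where "comp Mg x n \<notin> K"
    using M.mem_of_comps[of K x] gsubD(1)[OF K] by (auto simp: submod_def)
  then have F0: "colon K (comp Mg x n) \<in> F"
    using gsubD(2)[OF L x(1), of n] M.comp_in[of x n] unfolding F_def by blast
  have F_sub: "submod (*) UNIV P \<and> P \<subseteq> UNIV" if "P \<in> F" for P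
    using that homogeneous_ideal_colon[OF K]
    by (auto simp: F_def homogeneous_ideal_def ideal_def submod_def)
  obtain P where P: "P \<in> F" "\<forall>Q\<in>F. \<not> P \<subset> Q"
    using noeth_maximal[OF noeth_S F0 F_sub] by blast
  then obtain z d where z: "P = colon K z" "z \<in> Mg d" "z \<in> L" "z \<notin> K" unfolding F_def by blast
  have "prime_ideal (colon K z)"
  proof (rule homogeneous_prime_idealI)
    show "homogeneous_ideal Sg (colon K z)" using homogeneous_ideal_colon[OF K z(2)] .
    show "1 \<notin> colon K z" using z(4) by (simp add: colon_def sm_simps)
    fix a b m n assume ab: "a \<in> Sg m" "b \<in> Sg n" "a * b \<in> colon K z"
    show "a \<in> colon K z \<or> b \<in> colon K z"
    proof (cases "a \<in> colon K z")
      case False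
      have "sm a z \<in> Mg (m + d)" using ab(1) z(2) by (rule sm_mem)
      moreover have "sm a z \<in> L" using submodD(5)[OF gsubD(1)[OF L] UNIV_I z(3)] .
      moreover have "sm a z \<notin> K" using False by (simp add: colon_def)
      \<comment> \<open>The annihilator of \<open>sm a z\<close> modulo \<open>K\<close> contains
        that of \<open>z\<close>, so by maximality they agree; and \<open>b\<close> belongs to the
        former.\<close>
      ultimately have "colon K (sm a z) \<in> F" unfolding F_def by blast
      moreover have "colon K z \<subseteq> colon K (sm a z)"
        using submodD(5)[OF gsubD(1)[OF K] UNIV_I] by (auto simp: colon_def sm_commute[of _ a])
      ultimately have "colon K (sm a z) = colon K z" using P(2) z(1) by blast
      moreover have "b \<in> colon K (sm a z)" using ab(3) by (simp add: colon_def sm_simps(2) sm_commute[of b a])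
      ultimately show ?thesis by blast
    qed simp
  qed
  then show ?thesis using z by blast
qed

lemma gsub_adjoin: "gsub K \<Longrightarrow> z \<in> Mg d \<Longrightarrow> gsub (ssum K (cyc z))"
  by (intro gsub_ssum gsub_cyc)

lemma adjoin_upper: "K \<subseteq> ssum K (cyc z)" "gsub K \<Longrightarrow> z \<in> ssum K (cyc z)"
  using ssum_upper1[OF submodD(1)[OF submod_cyc]] ssum_upper2[of K "cyc z"] self_in_cyc[of z]
    submodD(1)[OF gsubD(1)] by blast+

lemma adjoin_least:
  assumes "gsub L" "K \<subseteq> L" "z \<in> L"
  shows "ssum K (cyc z) \<subseteq> L"
proof (rule ssum_least[OF gsubD(1)[OF assms(1)] assms(2)])
  show "cyc z \<subseteq> L" using submodD(5)[OF gsubD(1)[OF assms(1)] UNIV_I assms(3)] by (auto simp: cyc_def)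
qed

text \<open>Modulo \<open>K\<close>, the module S z is a shift of S/P for the prime
  \<open>P = colon K z\<close>, and \<open>f\<close> is a nonzerodivisor on it. Multiplication by
  \<open>f\<close> thus identifies degree \<open>n\<close> with the part of degree
  \<open>e + n\<close> generated by \<open>sm f z\<close>.\<close>

lemma hlen_cyclic_step:
  assumes K: "gsub K" and z: "z \<in> Mg d" and P: "prime_ideal (colon K z)"
    and f: "f \<in> Sg e" "f \<notin> colon K z"
  shows "hlen K (ssum K (cyc z)) (e + n)
    = hlen K (ssum K (cyc z)) n + hlen (ssum K (cyc (sm f z))) (ssum K (cyc z)) (e + n)"
proof -
  let ?L = "ssum K (cyc z)" and ?L' = "ssum K (cyc (sm f z))"
  have L: "gsub ?L" "gsub ?L'" using K z sm_mem[OF f(1) z] by (auto intro: gsub_adjoin)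
  have "sm f z \<in> ?L" using submodD(5)[OF gsubD(1)[OF L(1)] UNIV_I adjoin_upper(2)[OF K]] .
  then have L'L: "?L' \<subseteq> ?L" by (intro adjoin_least L adjoin_upper)
  have "?L \<inter> Mg n \<inter> sm f -` K = K \<inter> Mg n"
  proof
    show "K \<inter> Mg n \<subseteq> ?L \<inter> Mg n \<inter> sm f -` K"
      using adjoin_upper(1)[of K z] submodD(5)[OF gsubD(1)[OF K] UNIV_I] by blast
    show "?L \<inter> Mg n \<inter> sm f -` K \<subseteq> K \<inter> Mg n"
    proof
      fix x assume x: "x \<in> ?L \<inter> Mg n \<inter> sm f -` K"
      then obtain u s where us: "x = u + sm s z" "u \<in> K" by (auto simp: ssum_def cyc_def)
      have "sm f x - sm f u \<in> K"
        using x submodD(4,5)[OF gsubD(1)[OF K]] us(2) by simp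
      then have "f * s \<in> colon K z" using us(1) by (simp add: colon_def sm_simps)
      then have "s \<in> colon K z" using P f(2) by (auto simp: prime_ideal_def)
      then show "x \<in> K \<inter> Mg n" using us x submodD(2)[OF gsubD(1)[OF K]] by (simp add: colon_def)
    qed
  qed
  moreover have "ssum K (sm f ` ?L) = ?L'"
  proof
    show "ssum K (sm f ` ?L) \<subseteq> ?L'"
    proof (rule ssum_least[OF gsubD(1)[OF L(2)] adjoin_upper(1)])
      have "sm f u + sm s (sm f z) \<in> ?L'" if "u \<in> K" for u s
        using submodD(5)[OF gsubD(1)[OF K] UNIV_I that] by (intro ssumI) (auto simp: cyc_def)
      then show "sm f ` ?L \<subseteq> ?L'"
        by (auto simp: ssum_def[of K "range _"] cyc_def[of z] sm_simps(4) sm_commute[of f])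
    qed
    show "?L' \<subseteq> ssum K (sm f ` ?L)"
    proof (rule adjoin_least)
      show "gsub (ssum K (sm f ` ?L))" by (rule gsub_ssum[OF K gsub_image[OF f(1) L(1)]])
      then have zero: "0 \<in> sm f ` ?L" "0 \<in> K"
        using submodD(1)[OF gsubD(1)[OF gsub_image[OF f(1) L(1)]]] submodD(1)[OF gsubD(1)[OF K]] by auto
      show "K \<subseteq> ssum K (sm f ` ?L)" using zero(1) by (rule ssum_upper1)
      have "sm f z \<in> sm f ` ?L" using adjoin_upper(2)[OF K] by (rule imageI)
      then show "sm f z \<in> ssum K (sm f ` ?L)" by (rule subsetD[OF ssum_upper2[OF zero(2)]])
    qed
  qed
  ultimately have "hlen K ?L n = hlen K ?L' (e + n)"
    using len_mult[OF f(1) K L(1), of n] by (simp add: hlen_def)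
  then show ?thesis using hlen_add[OF K L(2,1) adjoin_upper(1) L'L, of "e + n"] by simp
qed

text \<open>In the degrees considered, the homogeneous coefficient of \<open>z\<close> has all its
  entries positive, so it lies in S_++ and sends \<open>z\<close> into \<open>K\<close>.\<close>

lemma hlen_cyclic_irrelevant:
  assumes K: "gsub K" and z: "z \<in> Mg d" and P: "Spp Sg \<subseteq> colon K z" and n: "d + ones \<le> n"
  shows "hlen K (ssum K (cyc z)) n = 0"
proof -
  have "ssum K (cyc z) \<inter> Mg n \<subseteq> K"
  proof
    fix x assume x: "x \<in> ssum K (cyc z) \<inter> Mg n"
    then obtain u s where us: "x = u + sm s z" "u \<in> K" by (auto simp: ssum_def cyc_def)
    have le: "Suc (d i) \<le> n i" for i using le_funD[OF n, of i] by (simp add: ones_def)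
    have n': "n = (n - d) + d" "ones \<le> n - d"
    proof -
      show "n = (n - d) + d" by (rule ext) (use le in \<open>simp add: Suc_leD\<close>)
      show "ones \<le> n - d" by (rule le_funI) (use le in \<open>simp add: ones_def Suc_le_eq\<close>)
    qed
    have "x = comp Mg u n + comp Mg (sm s z) n"
      using x us(1) M.comp_homog[of x n n] by (simp add: M.comp_add)
    also have "comp Mg (sm s z) n = sm (comp Sg s (n - d)) z"
      using comp_sm_right(1)[OF z, of s "n - d"] n'(1) by simp
    finally have x': "x = comp Mg u n + sm (comp Sg s (n - d)) z" .
    have "comp Sg s (n - d) \<in> Spp Sg"
      using n'(2) by (auto simp: Spp_def S.comp_homog[OF S.comp_in])
    then have "sm (comp Sg s (n - d)) z \<in> K" using P by (auto simp: colon_def)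
    then show "x \<in> K" using x' gsubD(2)[OF K us(2)] submodD(2)[OF gsubD(1)[OF K]] by simp
  qed
  then have "ssum K (cyc z) \<inter> Mg n = K \<inter> Mg n" using adjoin_upper(1)[of K z] by blast
  then show ?thesis using hlen_refl[OF K, of n] by (simp add: hlen_def)
qed

text \<open>Noetherian induction on \<open>N\<close>: the part \<open>(N + S z)/N\<close> below a maximal counterexample is a
  shifted \<open>S/P\<close> with \<open>P\<close> prime, whose difference in direction \<open>i\<close> is the Hilbert function of
  \<open>S/(P + f S)\<close> with \<open>f \<in> S\<^sub>i\<close> outside \<open>P\<close>.\<close>

lemma hilbert_eventually_poly:
  assumes "gsub N" "gsub L" "N \<subseteq> L" "\<not> prime_chain (supp N L) s"
  shows "eventually_poly s (\<lambda>n. real (hlen N L n))"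
  using assms
proof (induction s arbitrary: N L rule: less_induct)
  case (less s)
  show ?case
  proof (rule ccontr)
    assume no: "\<not> ?thesis"
    define F where "F = {K. gsub K \<and> N \<subseteq> K \<and> K \<subseteq> L \<and> \<not> eventually_poly s (\<lambda>n. real (hlen K L n))}"
    have F0: "N \<in> F" using no less.prems by (simp add: F_def)
    have F_sub: "submod sm UNIV K \<and> K \<subseteq> UNIV" if "K \<in> F" for K using that gsubD by (simp add: F_def)
    obtain K where K: "K \<in> F" "\<forall>K'\<in>F. \<not> K \<subset> K'"
      using noeth_maximal[OF noeth_M F0 F_sub] by blast
    then have K': "gsub K" "N \<subseteq> K" "K \<subseteq> L" "\<not> eventually_poly s (\<lambda>n. real (hlen K L n))"
      by (auto simp: F_def)
    have "K \<noteq> L"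
    proof
      assume "K = L"
      then have "eventually_poly s (\<lambda>n. real (hlen K L n))"
        using hlen_refl[OF less.prems(2)] by (intro eventually_poly_zero[of 0]) simp
      then show False using K' by blast
    qed
    then have "K \<subset> L" using K' by blast
    then obtain d z where z: "z \<in> Mg d" "z \<in> L" "z \<notin> K" and prime: "prime_ideal (colon K z)"
      using prime_colon_exists[OF K'(1) less.prems(2)] by blast
    define Kz where "Kz = ssum K (cyc z)"
    have Kz: "gsub Kz" "K \<subset> Kz" "Kz \<subseteq> L"
      unfolding Kz_def
      using gsub_adjoin[OF K'(1) z(1)] adjoin_upper(1)[of K z] adjoin_upper(2)[OF K'(1), of z] z
        adjoin_least[OF less.prems(2) K'(3) z(2)] by blast+
    have hom: "homogeneous_ideal Sg (colon K z)" by (rule homogeneous_ideal_colon[OF K'(1) z(1)])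
    have upper: "eventually_poly s (\<lambda>n. real (hlen Kz L n))"
      using K(2) Kz K'(2) by (auto simp: F_def)
    have lower: "eventually_poly s (\<lambda>n. real (hlen K Kz n))"
    proof (cases "Spp Sg \<subseteq> colon K z")
      case True
      then show ?thesis
        using hlen_cyclic_irrelevant[OF K'(1) z(1)] unfolding Kz_def
        by (intro eventually_poly_zero[of "d + ones"]) simp
    next
      case False
      have "colon K z \<in> supp K L"
        using prime hom False z(2) by (auto simp: supp_def colon_def)
      then have Psupp: "colon K z \<in> supp N L" using supp_mono[OF K'(2) order_refl] by blast
      \<comment> \<open>For \<open>s = 0\<close> the hypothesis says that the support is empty, but
        \<open>colon K z\<close> belongs to it.\<close>
      have "s \<noteq> 0"
      proof
        assume "s = 0"
        then have "prime_chain (supp N L) s"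
          using Psupp unfolding prime_chain_def by (intro exI[of _ "\<lambda>_. colon K z"]) simp
        then show False using less.prems(4) by blast
      qed
      then obtain t where t: "s = Suc t" using not0_implies_Suc by blast
      have "eventually_poly t (\<lambda>n. real (hlen K Kz (n + unitv i)) - real (hlen K Kz n))" for i
      proof -
        obtain f where f: "f \<in> Sg (unitv i)" "f \<notin> colon K z"
          using unitv_mem_outside[OF hom False] by blast
        define Kf where "Kf = ssum K (cyc (sm f z))"
        have Kf: "gsub Kf" unfolding Kf_def by (rule gsub_adjoin[OF K'(1) sm_mem[OF f(1) z(1)]])
        have K_Kf: "K \<subseteq> Kf" unfolding Kf_def by (rule adjoin_upper)
        have "sm f z \<in> Kz"
          using submodD(5)[OF gsubD(1)[OF Kz(1)] UNIV_I] adjoin_upper(2)[OF K'(1)] unfolding Kz_def by blast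
        then have Kf_Kz: "Kf \<subseteq> Kz" unfolding Kf_def using Kz by (intro adjoin_least) auto
        \<comment> \<open>Kz/Kf is killed by \<open>colon K z\<close> and by \<open>f\<close>, so
          each prime of its support contains \<open>colon K z\<close> strictly. Prefixing that prime
          to a chain costs one in length, which lowers the bound from \<open>s\<close> to
          \<open>t\<close>.\<close>
        have above: "colon K z \<subset> Q" if Q: "Q \<in> supp Kf Kz" for Q
        proof -
          obtain x where x: "x \<in> Kz" "\<And>s. s \<notin> Q \<Longrightarrow> sm s x \<notin> Kf" using Q unfolding supp_def by blast
          have "sm a x \<in> Kf" if a: "a \<in> colon K z \<or> a = f" for a
          proof -
            obtain u s where us: "x = u + sm s z" "u \<in> K" using x(1) by (auto simp: Kz_def ssum_def cyc_def)
            have "sm a z \<in> Kf"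
              using a K_Kf adjoin_upper(2)[OF K'(1), of "sm f z"] by (auto simp: colon_def Kf_def)
            then have "sm s (sm a z) \<in> Kf" using submodD(5)[OF gsubD(1)[OF Kf] UNIV_I] by blast
            moreover have "sm a u \<in> Kf"
              using submodD(5)[OF gsubD(1)[OF Kf] UNIV_I] us(2) K_Kf by blast
            ultimately show ?thesis
              using us(1) submodD(2)[OF gsubD(1)[OF Kf]] by (simp add: sm_simps sm_commute[of a s])
          qed
          then have "colon K z \<subseteq> Q" "f \<in> Q" using x(2) by blast+
          then show ?thesis using f(2) by blast
        qed
        have "\<not> prime_chain (supp Kf Kz) t"
        proof
          assume "prime_chain (supp Kf Kz) t"
          moreover have "supp Kf Kz \<subseteq> supp N L" using K'(2) K_Kf Kz(3) by (intro supp_mono) auto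
          ultimately have "prime_chain (supp N L) (Suc t)"
            using Psupp above by (intro prime_chain_extend[of "supp Kf Kz"])
          then show False using less.prems(4) t by simp
        qed
        then have "eventually_poly t (\<lambda>n. real (hlen Kf Kz n))"
          using less.IH[of t Kf Kz] Kf Kz(1) Kf_Kz t by blast
        then have "eventually_poly t (\<lambda>n. real (hlen Kf Kz (n + unitv i)))"
          by (rule eventually_poly_shift)
        moreover have "real (hlen Kf Kz (n + unitv i)) = real (hlen K Kz (n + unitv i)) - real (hlen K Kz n)" for n
          using hlen_cyclic_step[OF K'(1) z(1) prime f, of n]
          unfolding Kf_def[symmetric] Kz_def[symmetric] by (simp add: add.commute)
        ultimately show ?thesis by simp
      qed
      then show ?thesis unfolding t by (rule eventually_poly_antidifference)
    qed
    have "real (hlen K L n) = real (hlen K Kz n) + real (hlen Kz L n)" for n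
      using hlen_add[of K Kz L n] K' Kz less.prems by simp
    then show False using eventually_poly_add[OF lower upper] K'(4) by simp
  qed
qed

section \<open>Support and growth of the Hilbert function\<close>

lemma supp_homogeneous_witness:
  assumes P: "P \<in> supp N UNIV" and N: "gsub N"
  obtains d z where "z \<in> Mg d" "\<And>s. s \<notin> P \<Longrightarrow> sm s z \<notin> N"
proof -
  obtain x where x: "\<And>s. s \<notin> P \<Longrightarrow> sm s x \<notin> N" and P': "prime_ideal P" using P unfolding supp_def by blast
  obtain d where "\<forall>s. s \<notin> P \<longrightarrow> sm s (comp Mg x d) \<notin> N"
    using homogeneous_witness[OF N P' x] by blast
  then show thesis using that[of "comp Mg x d" d] M.comp_in by blast
qed

text \<open>No scalar outside \<open>P\<close> sends the homogeneous witness \<open>z\<close> into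
  \<open>N\<close>, and every graded piece of S has an element outside \<open>P\<close>.\<close>

lemma hlen_nonzero_of_supp:
  assumes P: "P \<in> supp N UNIV" and N: "gsub N"
  shows "\<exists>d. \<forall>n. hlen N UNIV (n + d) \<noteq> 0"
proof -
  obtain d z where z: "z \<in> Mg d" "\<And>s. s \<notin> P \<Longrightarrow> sm s z \<notin> N"
    using supp_homogeneous_witness[OF P N] by blast
  have "hlen N UNIV (n + d) \<noteq> 0" for n
  proof
    assume "hlen N UNIV (n + d) = 0"
    then have "Mg (n + d) \<subseteq> N" by (rule hlen_eq_0D[OF N])
    moreover obtain h where "h \<in> Sg n" "h \<notin> P" using mem_outside[of P n] P by (auto simp: supp_def)
    ultimately show False using z sm_mem by blast
  qed
  then show ?thesis by blast
qed

lemma hlen_unbounded_of_chain: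
  assumes PQ: "P \<in> supp N UNIV" "Q \<in> supp N UNIV" "P \<subset> Q" and N: "gsub N"
  shows "\<exists>v. \<forall>n. J \<le> hlen N UNIV (n + v)"
proof -
  obtain d z where z: "z \<in> Mg d" "\<And>s. s \<notin> P \<Longrightarrow> sm s z \<notin> N"
    using supp_homogeneous_witness[OF PQ(1) N] by blast
  have P: "prime_ideal P" and Q: "prime_ideal Q" "homogeneous_ideal Sg Q" "\<not> Spp Sg \<subseteq> Q"
    using PQ by (auto simp: supp_def)
  have Pid: "add_subgroup P" using P by (auto simp: prime_ideal_def ideal_def)
  have Qid: "add_subgroup Q" "\<And>a x. x \<in> Q \<Longrightarrow> a * x \<in> Q" using Q(1) by (auto simp: prime_ideal_def ideal_def)
  obtain g where g: "g \<in> Q" "g \<notin> P" using PQ(3) by blast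
  then obtain e where "comp Sg g e \<notin> P" using S.mem_of_comps[OF Pid] by blast
  moreover define f where "f = comp Sg g e"
  ultimately have f: "f \<in> Sg e" "f \<in> Q" "f \<notin> P"
    using Q(2) g(1) S.comp_in by (auto simp: homogeneous_ideal_def)
  have fj: "f ^ j \<notin> P" for j
  proof (induction j)
    case 0
    show ?case using one_notin_prime[OF P] by simp
  qed (use P f(3) in \<open>auto simp: prime_ideal_def\<close>)
  define deg where "deg = (\<lambda>j. (\<lambda>i. j * e i))"
  have fj_mem: "f ^ j \<in> Sg (deg j)" for j
  proof (induction j)
    case (Suc j)
    have "deg (Suc j) = e + deg j" by (auto simp: deg_def fun_eq_iff)
    moreover have "f ^ Suc j \<in> Sg (e + deg j)" using mult_mem[OF f(1) Suc] by simp
    ultimately show ?case by (simp only:)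
  qed (use one_mem in \<open>simp add: deg_def flip: zero_fun_def\<close>)
  define L where "L = (\<lambda>j. ssum N (cyc (sm (f ^ j) z)))"
  have L: "gsub (L j)" for j unfolding L_def by (rule gsub_adjoin[OF N sm_mem[OF fj_mem z(1)]])
  have NL: "N \<subseteq> L j" for j unfolding L_def by (rule adjoin_upper)
  have gen: "sm (f ^ j) z \<in> L j" for j unfolding L_def by (rule adjoin_upper(2)[OF N])
  have dec: "L (Suc j) \<subseteq> L j" for j
  proof -
    have "sm f (sm (f ^ j) z) \<in> L j" by (rule submodD(5)[OF gsubD(1)[OF L] UNIV_I gen])
    then have "sm (f ^ Suc j) z \<in> L j" by (simp add: sm_simps)
    then have "ssum N (cyc (sm (f ^ Suc j) z)) \<subseteq> L j" by (rule adjoin_least[OF L NL])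
    then show ?thesis by (simp only: L_def)
  qed
  have strict: "L (Suc j) \<inter> Mg n \<subset> L j \<inter> Mg n" if le: "deg j + d \<le> n" for j n
  proof
    show "L (Suc j) \<inter> Mg n \<subseteq> L j \<inter> Mg n" using dec by blast
    \<comment> \<open>An element outside \<open>Q\<close> of the complementary degree moves the
      generator \<open>sm (f ^ j) z\<close> into degree \<open>n\<close>.\<close>
    obtain h where h: "h \<in> Sg (n - (deg j + d))" "h \<notin> Q" using mem_outside[OF Q] by blast
    have n: "n = (n - (deg j + d)) + (deg j + d)" using le by (auto simp: le_fun_def fun_eq_iff)
    have "sm h (sm (f ^ j) z) \<in> Mg n"
      using sm_mem[OF h(1) sm_mem[OF fj_mem[of j] z(1)]] n by simp
    moreover have "sm h (sm (f ^ j) z) \<in> L j"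
      by (rule submodD(5)[OF gsubD(1)[OF L] UNIV_I gen])
    moreover have "sm h (sm (f ^ j) z) \<notin> L (Suc j)"
    proof
      assume "sm h (sm (f ^ j) z) \<in> L (Suc j)"
      then obtain u t where ut: "sm h (sm (f ^ j) z) = u + sm t (sm (f ^ Suc j) z)" "u \<in> N"
        by (auto simp: L_def ssum_def cyc_def)
      \<comment> \<open>Scalars sending \<open>z\<close> into \<open>N\<close> lie in
        \<open>P\<close>. Cancelling \<open>f ^ j\<close> there leaves \<open>h - t * f\<close> in
        \<open>P\<close>, hence in \<open>Q\<close>, and \<open>f\<close> in \<open>Q\<close> would
        force \<open>h\<close> into \<open>Q\<close>.\<close>
      have "sm (f ^ j * (h - t * f)) z = u"
        using ut(1) by (simp add: right_diff_distrib sm_diff_left sm_simps(2)[symmetric] mult_ac)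
      then have "f ^ j * (h - t * f) \<in> P" using z(2) ut(2) by blast
      then have "h - t * f \<in> Q" using fj[of j] P PQ(3) by (auto simp: prime_ideal_def)
      then have "h - t * f + t * f \<in> Q" using Qid(2)[OF f(2)] by (intro add_subgroupD(2)[OF Qid(1)])
      then show False using h(2) by simp
    qed
    ultimately show "L (Suc j) \<inter> Mg n \<noteq> L j \<inter> Mg n" by blast
  qed
  have "J \<le> hlen N UNIV (n + (deg J + d))" for n
    unfolding hlen_def
  proof (rule len_props(2)[OF fin_len_component[OF gsubD(1)[OF N]] submod_component[OF gsubD(1)[OF N]]])
    let ?n = "n + (deg J + d)"
    \<comment> \<open>Reversing the index turns the descending family into an ascending chain;
      degree \<open>deg J + d\<close> is large enough for all of its steps simultaneously.\<close>
    show "chain_between sm (Sg 0) (N \<inter> Mg ?n) (UNIV \<inter> Mg ?n) J"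
      unfolding chain_between_def
    proof (intro exI[of _ "\<lambda>i. L (J - i) \<inter> Mg ?n"] conjI allI impI)
      fix i
      show "submod sm (Sg 0) (L (J - i) \<inter> Mg ?n)" using submod_component gsubD(1)[OF L] by blast
      show "N \<inter> Mg ?n \<subseteq> L (J - i) \<inter> Mg ?n" using NL by blast
      assume "i < J"
      then have "J - i = Suc (J - Suc i)" by simp
      moreover have "deg (J - Suc i) + d \<le> ?n" by (auto simp: le_fun_def deg_def intro!: trans_le_add2 mult_right_mono)
      ultimately show "L (J - i) \<inter> Mg ?n \<subset> L (J - Suc i) \<inter> Mg ?n" using strict by metis
    qed simp
  qed simp
  then show ?thesis by blast
qed

section \<open>Hilbert functions along a filter-regular sequence\<close>

lemma seq_submod_0: "seq_submod sm xs 0 = {0}"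
  by (auto simp: seq_submod_def)

lemma seq_submod_Suc: "seq_submod sm xs (Suc j) = ssum (seq_submod sm xs j) (range (sm (snd (xs ! j))))"
proof
  show "seq_submod sm xs (Suc j) \<subseteq> ssum (seq_submod sm xs j) (range (sm (snd (xs ! j))))"
    by (auto simp: seq_submod_def ssum_def)
  show "ssum (seq_submod sm xs j) (range (sm (snd (xs ! j)))) \<subseteq> seq_submod sm xs (Suc j)"
  proof
    fix x assume "x \<in> ssum (seq_submod sm xs j) (range (sm (snd (xs ! j))))"
    then obtain f y where "x = (\<Sum>i<j. sm (snd (xs ! i)) (f i)) + sm (snd (xs ! j)) y"
      by (auto simp: seq_submod_def ssum_def)
    then have "x = (\<Sum>i<Suc j. sm (snd (xs ! i)) ((f(j := y)) i))" by simp
    then show "x \<in> seq_submod sm xs (Suc j)" unfolding seq_submod_def by blast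
  qed
qed

lemma gsub_seq_submod:
  assumes "\<forall>(i, x)\<in>set xs. x \<in> Sg (unitv i)" "j \<le> length xs"
  shows "gsub (seq_submod sm xs j)"
  using assms(2)
proof (induction j)
  case (Suc j)
  have "(fst (xs ! j), snd (xs ! j)) \<in> set xs" using Suc.prems by simp
  then have "snd (xs ! j) \<in> Sg (unitv (fst (xs ! j)))" using assms(1) by blast
  then show ?case unfolding seq_submod_Suc using Suc by (intro gsub_ssum gsub_image gsub_UNIV) auto
qed (simp add: seq_submod_0 gsub_zero)

text \<open>Injectivity is demanded in the single degree \<open>n\<close>, so that a filter-regular
  element supplies it as soon as \<open>n\<close> is large.\<close>

lemma hlen_filter_regular:
  assumes N: "gsub N" and x: "x \<in> Sg e" and reg: "\<And>y. y \<in> Mg n \<Longrightarrow> sm x y \<in> N \<Longrightarrow> y \<in> N"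
  shows "hlen N UNIV (e + n) = hlen N UNIV n + hlen (ssum N (range (sm x))) UNIV (e + n)"
proof -
  have "UNIV \<inter> Mg n \<inter> sm x -` N = N \<inter> Mg n"
    using reg submodD(5)[OF gsubD(1)[OF N] UNIV_I] by blast
  then have "hlen N UNIV n = hlen N (ssum N (range (sm x))) (e + n)"
    using len_mult[OF x N gsub_UNIV, of n] by (simp add: hlen_def)
  moreover have "N \<subseteq> ssum N (range (sm x))"
    by (intro ssum_upper1) (rule range_eqI[of _ _ 0], simp)
  ultimately show ?thesis
    using hlen_add[OF N gsub_ssum[OF N gsub_image[OF x gsub_UNIV]] gsub_UNIV, of "e + n"] by simp
qed

text \<open>Evaluating at \<open>n + \<kappa> j\<close> instead of \<open>n\<close> absorbs the
  degrees of the elements divided out so far. Each new element then acts as a plain shift of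
  coefficients, with no re-expansion of shifted binomials.\<close>

lemma hlen_iterated_difference:
  assumes deg: "\<forall>(i, x)\<in>set xs. x \<in> Sg (unitv i)" and reg: "filter_regular_seq Mg sm xs"
    and b0: "\<And>\<alpha>. \<alpha> \<notin> degree_below s \<Longrightarrow> b \<alpha> = 0"
    and b: "\<And>n. w \<le> n \<Longrightarrow> real (hlen {0} UNIV n) = binsum s b n"
    and "j \<le> length xs"
  defines "\<kappa> \<equiv> \<lambda>j i. length (filter (\<lambda>p. fst p = i) (take j xs))"
  shows "\<exists>v. \<forall>n\<ge>v. real (hlen (seq_submod sm xs j) UNIV (n + \<kappa> j)) = binsum s (\<lambda>\<alpha>. b (\<alpha> + \<kappa> j)) n"
  using assms(5)
proof (induction j)
  case 0
  have "\<kappa> 0 = 0" by (simp add: \<kappa>_def zero_fun_def)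
  then show ?case using b by (auto simp: seq_submod_0)
next
  case (Suc j)
  define i x N where "i = fst (xs ! j)" and "x = snd (xs ! j)" and "N = seq_submod sm xs j"
  have "(i, x) \<in> set xs" using Suc.prems by (simp add: i_def x_def)
  then have x: "x \<in> Sg (unitv i)" using deg by blast
  have \<kappa>: "\<kappa> (Suc j) = \<kappa> j + unitv i"
    using Suc.prems by (auto simp: \<kappa>_def take_Suc_conv_app_nth fun_eq_iff unitv_def i_def)
  obtain v where v: "\<And>n. v \<le> n \<Longrightarrow> real (hlen N UNIV (n + \<kappa> j)) = binsum s (\<lambda>\<alpha>. b (\<alpha> + \<kappa> j)) n"
    using Suc.IH Suc_leD[OF Suc.prems] unfolding N_def by blast
  have "filter_regular Mg sm N x"
    using reg Suc.prems by (simp add: filter_regular_seq_def N_def x_def)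
  then obtain u where u: "\<And>n y. u \<le> n \<Longrightarrow> y \<in> Mg n \<Longrightarrow> sm x y \<in> N \<Longrightarrow> y \<in> N"
    unfolding filter_regular_def by blast
  have N: "gsub N" unfolding N_def using gsub_seq_submod[OF deg] Suc.prems by simp
  have "real (hlen (seq_submod sm xs (Suc j)) UNIV (n + \<kappa> (Suc j))) = binsum s (\<lambda>\<alpha>. b (\<alpha> + \<kappa> (Suc j))) n"
    if n: "u + v \<le> n" for n
  proof -
    have le: "v \<le> n" "v \<le> n + unitv i" "u \<le> n + \<kappa> j"
      using n by (auto simp: le_fun_def intro: trans_le_add1 add_leD1 add_leD2)
    have "hlen N UNIV (unitv i + (n + \<kappa> j))
        = hlen N UNIV (n + \<kappa> j) + hlen (seq_submod sm xs (Suc j)) UNIV (unitv i + (n + \<kappa> j))"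
      unfolding seq_submod_Suc N_def[symmetric] x_def[symmetric]
      using u[OF le(3)] by (intro hlen_filter_regular[OF N x]) blast
    moreover have "unitv i + (n + \<kappa> j) = n + \<kappa> (Suc j)" "unitv i + (n + \<kappa> j) = (n + unitv i) + \<kappa> j"
      by (simp_all add: \<kappa> add_ac)
    ultimately have "real (hlen (seq_submod sm xs (Suc j)) UNIV (n + \<kappa> (Suc j)))
        = binsum s (\<lambda>\<alpha>. b (\<alpha> + \<kappa> j)) (n + unitv i) - binsum s (\<lambda>\<alpha>. b (\<alpha> + \<kappa> j)) n"
      using v[OF le(1)] v[OF le(2)] by simp
    also have "\<dots> = binsum s (\<lambda>\<alpha>. b (\<alpha> + unitv i + \<kappa> j)) n"
    proof (rule binsum_diff)
      fix \<alpha> :: "'d \<Rightarrow> nat" assume "\<alpha> \<notin> degree_below s"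
      then show "b (\<alpha> + \<kappa> j) = 0" by (intro b0) (simp add: degree_below_def sum.distrib)
    qed
    finally show ?thesis by (simp add: \<kappa> add_ac)
  qed
  then show ?case by blast
qed

lemma supp_eq_Supp_pp: "supp N UNIV = Supp_pp Sg sm N"
  by (simp add: supp_def Supp_pp_def)

lemma qlen_eq_hlen: "gsub N \<Longrightarrow> qlen Sg sm Mg N n = enat (hlen N UNIV n)"
  using qlen_eq_len[of sm Sg N Mg n] fin_len_component[OF gsubD(1), of N n UNIV] submod_component[OF gsubD(1), of N n]
  by (simp add: hlen_def)

end

section \<open>The mixed multiplicity as a constant Hilbert function\<close>

lemma dim_set_prime_chain: "dim_set X = Sup {ereal (real k) | k. prime_chain X k}"
  by (simp add: dim_set_def prime_chain_def)

text \<open>By \<open>monom_sum_unique\<close> the definite description in \<open>mixed_mult\<close>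
  denotes the monomial form of the binomial expansion, and in top degree the factorials
  cancel.\<close>

lemma (in graded_noeth) mixed_mult_eq:
  assumes b: "\<And>n. w \<le> n \<Longrightarrow> real (hlen {0} UNIV n) = binsum (Suc s) b n" and k: "sum k UNIV = s"
  shows "mixed_mult Sg sm Mg k = b k"
proof -
  obtain c where c: "finite {\<alpha>. c \<alpha> \<noteq> 0}" "\<And>n. monom_sum c n = binsum (Suc s) b n"
    "(\<Prod>i\<in>UNIV. fact (k i)) * c k = b k"
    using binsum_conv_monom_sum[of s b] k by metis
  have coeffs: "hilbert_poly_coeffs Sg sm Mg c' \<longleftrightarrow> finite {\<alpha>. c' \<alpha> \<noteq> 0} \<and>
      (\<exists>v. \<forall>n\<ge>v. real (hlen {0} UNIV n) = monom_sum c' n)" for c'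
    unfolding hilbert_poly_coeffs_def monom_sum_def qlen_eq_hlen[OF gsub_zero] by simp
  have "hilbert_poly_coeffs Sg sm Mg c" unfolding coeffs using c b by auto
  moreover have "c' = c" if "hilbert_poly_coeffs Sg sm Mg c'" for c'
  proof -
    obtain v where v: "finite {\<alpha>. c' \<alpha> \<noteq> 0}" "\<And>n. v \<le> n \<Longrightarrow> real (hlen {0} UNIV n) = monom_sum c' n"
      using \<open>hilbert_poly_coeffs Sg sm Mg c'\<close> unfolding coeffs by blast
    show ?thesis
    proof (rule monom_sum_unique[OF v(1) c(1), of "v + w"])
      fix n :: "'d \<Rightarrow> nat" assume "v + w \<le> n"
      then have "v \<le> n" "w \<le> n" by (auto simp: le_fun_def intro: add_leD1 add_leD2)
      then show "monom_sum c' n = monom_sum c n" using v(2) b c(2) by metis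
    qed
  qed
  ultimately have "(THE c. hilbert_poly_coeffs Sg sm Mg c) = c" by (rule the_equality)
  then show ?thesis unfolding mixed_mult_def using c(3) by simp
qed

lemma (in graded_noeth) mixed_mult_filter_regular:
  assumes dim: "ereal (real (\<Sum>i\<in>UNIV. k i)) = dim_set (Supp_pp Sg sm {0})"
    and deg: "\<forall>(i, x)\<in>set xs. x \<in> Sg (unitv i)"
    and count: "\<forall>i. length (filter (\<lambda>p. fst p = i) xs) = k i"
    and reg: "filter_regular_seq Mg sm xs"
  shows "(\<exists>v. \<forall>n\<ge>v. \<exists>l. qlen Sg sm Mg (seq_submod sm xs (length xs)) n = enat l
              \<and> mixed_mult Sg sm Mg k = real l)
       \<and> (mixed_mult Sg sm Mg k \<noteq> 0 \<longleftrightarrow> dim_set (Supp_pp Sg sm (seq_submod sm xs (length xs))) = 0)"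
proof -
  define s where "s = sum k UNIV"
  define N where "N = seq_submod sm xs (length xs)"
  have N: "gsub N" unfolding N_def using gsub_seq_submod[OF deg] by simp
  \<comment> \<open>The dimension is exactly \<open>s\<close>, so the strict degree bound becomes
    \<open>Suc s\<close>.\<close>
  have "\<not> prime_chain (supp {0} UNIV) (Suc s)"
  proof
    assume "prime_chain (supp {0} UNIV) (Suc s)"
    then have "ereal (real (Suc s)) \<le> dim_set (Supp_pp Sg sm {0})"
      unfolding dim_set_prime_chain supp_eq_Supp_pp by (intro Sup_upper) blast
    then show False unfolding dim[symmetric] s_def[symmetric] by simp
  qed
  then have "eventually_poly (Suc s) (\<lambda>n. real (hlen {0} UNIV n))"
    by (intro hilbert_eventually_poly gsub_zero gsub_UNIV) auto
  then obtain b w where b0: "\<And>\<alpha>. \<alpha> \<notin> degree_below (Suc s) \<Longrightarrow> b \<alpha> = 0"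
    and b: "\<And>n. w \<le> n \<Longrightarrow> real (hlen {0} UNIV n) = binsum (Suc s) b n"
    unfolding eventually_poly_def by blast
  have mixed: "mixed_mult Sg sm Mg k = b k" using b s_def[symmetric] by (rule mixed_mult_eq)
  have \<kappa>: "(\<lambda>i. length (filter (\<lambda>p. fst p = i) (take (length xs) xs))) = k" using count by auto
  have "\<exists>v. \<forall>n\<ge>v. real (hlen N UNIV (n + k)) = binsum (Suc s) (\<lambda>\<alpha>. b (\<alpha> + k)) n"
    using hlen_iterated_difference[OF deg reg b0 b order_refl] unfolding \<kappa> N_def .
  then obtain v where v: "\<And>n. v \<le> n \<Longrightarrow> real (hlen N UNIV (n + k)) = binsum (Suc s) (\<lambda>\<alpha>. b (\<alpha> + k)) n"
    by blast
  have "binsum (Suc s) (\<lambda>\<alpha>. b (\<alpha> + k)) n = b k" for n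
  proof -
    \<comment> \<open>A nonzero \<open>\<alpha>\<close> raises the degree of the index above
      \<open>s\<close>, so only the constant term of the shifted expansion is left.\<close>
    have "b (\<alpha> + k) = 0" if \<alpha>: "\<alpha> \<noteq> 0" for \<alpha>
    proof (rule b0)
      obtain i where "\<alpha> i > 0" using nonzero_index[OF \<alpha>] by blast
      then show "\<alpha> + k \<notin> degree_below (Suc s)" by (auto simp: degree_below_def s_def sum.distrib)
    qed
    then have "binsum (Suc s) (\<lambda>\<alpha>. b (\<alpha> + k)) n = (\<Sum>\<alpha>\<in>{0}. b (\<alpha> + k) * binom \<alpha> n)"
      unfolding binsum_def by (intro sum.mono_neutral_right) (auto simp: degree_below_def)
    then show ?thesis by simp
  qed
  with v have const: "real (hlen N UNIV n) = b k" if "v + k \<le> n" for n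
  proof -
    have le: "v i + k i \<le> n i" for i using le_funD[OF that, of i] by simp
    have "n i = (n i - k i) + k i" "v i \<le> n i - k i" for i using le[of i] by linarith+
    then have "n = (n - k) + k" "v \<le> n - k" by (simp_all add: fun_eq_iff le_fun_def)
    then show ?thesis using v[of "n - k"] \<open>\<And>n. binsum (Suc s) (\<lambda>\<alpha>. b (\<alpha> + k)) n = b k\<close> by simp
  qed
  have "\<exists>v. \<forall>n\<ge>v. \<exists>l. qlen Sg sm Mg N n = enat l \<and> mixed_mult Sg sm Mg k = real l"
    unfolding qlen_eq_hlen[OF N] mixed using const by (intro exI[of _ "v + k"]) auto
  moreover have "mixed_mult Sg sm Mg k \<noteq> 0 \<longleftrightarrow> dim_set (Supp_pp Sg sm N) = 0"
  proof
    assume "mixed_mult Sg sm Mg k \<noteq> 0"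
    then have bk: "b k \<noteq> 0" using mixed by simp
    have one: "prime_chain (supp N UNIV) 0"
    proof (rule ccontr)
      assume "\<not> prime_chain (supp N UNIV) 0"
      \<comment> \<open>No index has degree below 0, so the expansion is an empty sum.\<close>
      then have "eventually_poly 0 (\<lambda>n. real (hlen N UNIV n))"
        by (intro hilbert_eventually_poly N gsub_UNIV) auto
      then obtain u where u: "\<And>n. u \<le> n \<Longrightarrow> real (hlen N UNIV n) = 0"
        unfolding eventually_poly_def by (auto simp: binsum_def degree_below_def)
      have "u \<le> u + (v + k)" "v + k \<le> u + (v + k)" by (auto simp: le_fun_def)
      then show False using u const bk by metis
    qed
    have "l = 0" if l: "prime_chain (supp N UNIV) l" for l
    proof (rule ccontr)
      assume "l \<noteq> 0"
      obtain C where C: "\<And>i. i \<le> l \<Longrightarrow> C i \<in> supp N UNIV" "\<And>i. i < l \<Longrightarrow> C i \<subset> C (Suc i)"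
        using l unfolding prime_chain_def by blast
      have C01: "C 0 \<in> supp N UNIV" "C (Suc 0) \<in> supp N UNIV" "C 0 \<subset> C (Suc 0)"
        using C \<open>l \<noteq> 0\<close> by auto
      \<comment> \<open>One more than the floor, so that \<open>J\<close> exceeds the constant value
        \<open>b k\<close>.\<close>
      define J where "J = Suc (nat \<lfloor>b k\<rfloor>)"
      obtain u where u: "\<And>n. J \<le> hlen N UNIV (n + u)"
        using hlen_unbounded_of_chain[OF C01 N, of J] by blast
      have "v + k \<le> (v + k) + u" by (auto simp: le_fun_def)
      then have "real (hlen N UNIV ((v + k) + u)) = b k" by (rule const)
      then show False using u[of "v + k"] by (simp add: J_def flip: of_nat_le_iff[where 'a = real]) linarith
    qed
    then have "{ereal (real l) | l. prime_chain (supp N UNIV) l} = {0}"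
      using one by (auto simp: zero_ereal_def)
    then show "dim_set (Supp_pp Sg sm N) = 0"
      unfolding dim_set_prime_chain supp_eq_Supp_pp[symmetric] by simp
  next
    assume dim0: "dim_set (Supp_pp Sg sm N) = 0"
    \<comment> \<open>The supremum of no lengths is -\<infinity>, so dimension 0 provides an actual
      prime in the support.\<close>
    have "\<exists>l. prime_chain (supp N UNIV) l"
    proof (rule ccontr)
      assume "\<nexists>l. prime_chain (supp N UNIV) l"
      then have "{ereal (real l) | l. prime_chain (supp N UNIV) l} = {}" by blast
      then have "dim_set (Supp_pp Sg sm N) = - \<infinity>"
        unfolding dim_set_prime_chain supp_eq_Supp_pp[symmetric] by (simp add: bot_ereal_def)
      then show False using dim0 by simp
    qed
    then obtain P where "P \<in> supp N UNIV" unfolding prime_chain_def by blast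
    then obtain u where u: "\<And>n. hlen N UNIV (n + u) \<noteq> 0" using hlen_nonzero_of_supp[OF _ N] by blast
    have "v + k \<le> (v + k) + u" by (auto simp: le_fun_def)
    then have "real (hlen N UNIV ((v + k) + u)) = b k" by (rule const)
    then show "mixed_mult Sg sm Mg k \<noteq> 0" using u[of "v + k"] mixed by auto
  qed
  ultimately show ?thesis unfolding N_def by blast
qed

theorem theorem2p4:
  fixes Sg :: "('d::finite \<Rightarrow> nat) \<Rightarrow> 'a::comm_ring_1 set"
    and sm :: "'a \<Rightarrow> 'm::ab_group_add \<Rightarrow> 'm"
    and Mg :: "('d \<Rightarrow> nat) \<Rightarrow> 'm set"
    and k :: "'d \<Rightarrow> nat"
    and xs :: "('d \<times> 'a) list"
  assumes "artinian_local_inf_residue (Sg 0)"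
    and "standard_graded Sg" and "fg_algebra Sg"
    and "graded_module Sg sm Mg" and "fg_module sm"
    and "\<not> Sg ones \<subseteq> radical (ann sm)"
    and "ereal (real (\<Sum>i\<in>UNIV. k i)) = dim_set (Supp_pp Sg sm {0})"
    and "\<forall>(i, x)\<in>set xs. x \<in> Sg (unitv i)"
    and "\<forall>i. length (filter (\<lambda>p. fst p = i) xs) = k i"
    and "filter_regular_seq Mg sm xs"
  shows "(\<exists>v. \<forall>n\<ge>v. \<exists>l. qlen Sg sm Mg (seq_submod sm xs (length xs)) n = enat l
              \<and> mixed_mult Sg sm Mg k = real l)
       \<and> (mixed_mult Sg sm Mg k \<noteq> 0 \<longleftrightarrow> dim_set (Supp_pp Sg sm (seq_submod sm xs (length xs))) = 0)"
proof -
  interpret graded sm Sg Mg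
    using assms(2,4) by unfold_locales (auto simp: graded_module_def)
  obtain m where m: "maximal_ideal_in (Sg 0) m" "\<And>m'. maximal_ideal_in (Sg 0) m' \<Longrightarrow> m' = m"
    and art: "artinian_in (Sg 0)"
    using assms(1) unfolding artinian_local_inf_residue_def by blast
  interpret A: artinian_local "Sg 0" m
  proof
    show "x * y \<in> Sg 0" if "x \<in> Sg 0" "y \<in> Sg 0" for x y using mult_mem[OF that] by simp
  qed (fact one_mem S.sub art m)+
  \<comment> \<open>Finite length of \<open>Sg 0\<close> over itself is the form in which the
    artinian hypothesis enters both the basis theorem and the finiteness of the components.\<close>
  note A = A.fin_len_self A.submod_A one_mem
  obtain H where H: "finite H" "ring_gen (Sg 0 \<union> H) = UNIV"
    using assms(3) unfolding fg_algebra_def by blast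
  obtain G where G: "finite G" "\<And>x. \<exists>c. x = (\<Sum>g\<in>G. sm (c g) g)"
    using assms(5) unfolding fg_module_def by blast
  have M: "noeth sm UNIV UNIV" by (rule noeth_fin_gen[OF G H A])
  interpret graded_noeth sm Sg Mg
  proof
    show "noeth sm UNIV UNIV" by (rule M)
    show "noeth (*) (UNIV :: 'a set) UNIV"
    \<comment> \<open>The ring is a module over itself generated by 1, so the module version of the
      basis theorem applies to it.\<close>
    proof (rule A.noeth_fin_gen[OF _ _ H A])
      show "\<exists>c. x = (\<Sum>g\<in>{1}. c g * g)" for x :: 'a by (intro exI[of _ "\<lambda>_. x"]) simp
    qed simp
    show "fin_len sm (Sg 0) {0} (Mg n)" for n
    proof (rule fin_len_noeth[OF A noeth_component[OF M]])
      show "submod sm (Sg 0) (Mg n)"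
        using submod_component[of UNIV n] by (simp add: gsubD(1)[OF gsub_UNIV])
    qed
  qed
  show ?thesis using assms(7-10) by (rule mixed_mult_filter_regular)
qed

end
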